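(* Let $B=K_{\aleph_0}$ be the countably infinite complete graph. Let $s,t\in\mathbb N_0$, let $$C=\max\{\lceil s^2\cdot 2^{s-3}\rceil,\ 2^{3s+1}\cdot t\}$$ and let $C'\ge 3C(s+1)^{Cs+1}$ be an integer. Let $G_1,\dots,G_{s+t}\subseteq B$ be pairwise vertex disjoint graphs such that $G_i$ is a copy of $G_{\mathrm{inf}}^{C'}$ for each $i\in\{1,\dots,s\}$ and each of $G_{s+1},\dots,G_{s+t}$ is a copy of $G_{\mathrm{star}}$. Then, in the Maker-Breaker game on $B$, Maker has a strategy to claim (all edges of) a copy $K\subseteq B$ of $K_{\aleph_0}$ such that $G_i\cap K$ induces a copy of $S_{\aleph_0}$ for each $i\in\{1,\dots,s\}$ and $G_j\cap K$ induces a copy of $G_{\mathrm{star}}$ for each $j\in\{s+1,\dots,s+t\}$.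
   Context: In the Maker-Breaker game on $B=K_{\aleph_0}$, two players, Maker and Breaker, alternately claim previously unclaimed edges of $B$, one edge per move; Maker moves first and the game lasts $\omega$ moves. Maker claims a subgraph $K$ if she has claimed all edges of $K$ during the game. $S_{\aleph_0}$ is the star with countably infinitely many leaves. $G_{\mathrm{inf}}^{C'}$ is the graph consisting of $C'$ pairwise vertex disjoint copies of $S_{\aleph_0}$. For $j\in\mathbb N=\{1,2,\dots\}$, $S_j$ is the star on $j$ vertices, and $G_{\mathrm{star}}$ is the graph consisting of pairwise vertex disjoint stars $\{S_j\}_{j\in\mathbb N}$ (one for each $j$). *)

theory Defs
  imports Complex_Main "HOL-Library.Disjoint_Sets"
begin

record 'a ugraph =
  verts :: "'a set"
  edges :: "'a set set"

definition is_graph :: "'a ugraph \<Rightarrow> bool" where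
  "is_graph G \<longleftrightarrow> (\<forall>e\<in>edges G. e \<subseteq> verts G \<and> card e = 2)"

definition subgraph :: "'a ugraph \<Rightarrow> 'a ugraph \<Rightarrow> bool" where
  "subgraph H G \<longleftrightarrow>
     is_graph H \<and> is_graph G \<and> verts H \<subseteq> verts G \<and> edges H \<subseteq> edges G"

definition copy_of :: "'a ugraph \<Rightarrow> 'b ugraph \<Rightarrow> bool" where
  "copy_of G H \<longleftrightarrow>
     (\<exists>f. bij_betw f (verts G) (verts H) \<and> edges H = (\<lambda>e. f ` e) ` edges G)"

definition graph_inter :: "'a ugraph \<Rightarrow> 'a ugraph \<Rightarrow> 'a ugraph" where
  "graph_inter G H = \<lparr>verts = verts G \<inter> verts H, edges = edges G \<inter> edges H\<rparr>"

definition disjoint_union :: "'i set \<Rightarrow> ('i \<Rightarrow> 'a ugraph) \<Rightarrow> ('i \<times> 'a) ugraph" where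
  "disjoint_union I G =
     \<lparr>verts = (SIGMA i:I. verts (G i)),
      edges = (\<Union>i\<in>I. (\<lambda>e. Pair i ` e) ` edges (G i))\<rparr>"

definition K_aleph0 :: "nat ugraph" where
  "K_aleph0 = \<lparr>verts = UNIV, edges = {{u, v} | u v. u \<noteq> v}\<rparr>"

definition S_aleph0 :: "nat ugraph" where
  "S_aleph0 = \<lparr>verts = UNIV, edges = {{0, v} | v. 0 < v}\<rparr>"

text \<open>\<open>star j\<close> has \<open>j\<close> vertices, hence \<open>j - 1\<close> leaves; in particular, \<open>star 1\<close> is a
  single isolated vertex.\<close>

definition star :: "nat \<Rightarrow> nat ugraph" where
  "star j = \<lparr>verts = {..<j}, edges = {{0, v} | v. 0 < v \<and> v < j}\<rparr>"

definition G_inf :: "nat \<Rightarrow> (nat \<times> nat) ugraph" where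
  "G_inf n = disjoint_union {..<n} (\<lambda>_. S_aleph0)"

definition G_star :: "(nat \<times> nat) ugraph" where
  "G_star = disjoint_union {1..} star"

text \<open>A play of the Maker-Breaker game on the edges of an infinite graph \<open>B\<close> is the sequence of
  all claimed edges in order: Maker makes the moves \<open>0, 2, 4, \<dots>\<close> and Breaker the moves
  \<open>1, 3, 5, \<dots>\<close>. A strategy of Maker maps the list of all previous moves of both players
  to Maker's next move.\<close>

definition is_play :: "'a ugraph \<Rightarrow> (nat \<Rightarrow> 'a set) \<Rightarrow> bool" where
  "is_play B p \<longleftrightarrow> (\<forall>n. p n \<in> edges B \<and> p n \<notin> p ` {..<n})"

definition maker_edges :: "(nat \<Rightarrow> 'a set) \<Rightarrow> 'a set set" where
  "maker_edges p = p ` {n. even n}"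

definition maker_strategy :: "'a ugraph \<Rightarrow> ('a set list \<Rightarrow> 'a set) \<Rightarrow> bool" where
  "maker_strategy B \<sigma> \<longleftrightarrow>
     (\<forall>h. even (length h) \<and> distinct h \<and> set h \<subseteq> edges B \<longrightarrow> \<sigma> h \<in> edges B - set h)"

definition follows :: "('a set list \<Rightarrow> 'a set) \<Rightarrow> (nat \<Rightarrow> 'a set) \<Rightarrow> bool" where
  "follows \<sigma> p \<longleftrightarrow> (\<forall>n. even n \<longrightarrow> p n = \<sigma> (map p [0..<n]))"

definition maker_can_claim :: "'a ugraph \<Rightarrow> ('a ugraph \<Rightarrow> bool) \<Rightarrow> bool" where
  "maker_can_claim B P \<longleftrightarrow>
     (\<exists>\<sigma>. maker_strategy B \<sigma> \<and>
        (\<forall>p. is_play B p \<and> follows \<sigma> p \<longrightarrow>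
           (\<exists>K. subgraph K B \<and> edges K \<subseteq> maker_edges p \<and> P K)))"

end

theory Submission
  imports Defs "HOL-Library.FuncSet" "HOL-Library.Infinite_Set" "HOL-Library.Nat_Bijection"
begin

text \<open>
  Maker joins a vertex \<open>v\<close> that no claimed edge touches to a vertex of each of many disjoint pairs (pairing
  strategy) and, at the same time, to all members of some set out of any dense family of tuples of centres (Beck's
  potential argument). She first claims, for a positive proportion of the \<open>s\<close>-tuples with one star centre from
  each of \<open>G\<^sub>1, \<dots>, G\<^sub>s\<close>, all edges inside the tuple. Over each such tuple she grows a tree of bounded
  degree whose branches span cliques of hers together with the tuple: a new leaf is joined to its own centre first,
  then to a tuple containing that centre, and descends in the tree of this tuple until it finds a free place.

  A leaf of a finite star with centre \<open>a\<close> has to be joined to \<open>a\<close> first, after which Breaker could cut it off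
  from any prescribed branch. So \<open>a\<close> is joined to two out of four children at every node it reaches, and to many
  tuples; its leaves then descend in the remaining binary tree, until a large clique of leaves of \<open>a\<close> has gathered
  at one place.

  Which tuple and which child a vertex reaches is up to Breaker, but Maker offers him only those which
  vertices of the same kind have visited least often. Hence each kind starves only few children of a node that it visits
  infinitely often, and there are a tuple and an infinite branch whose nodes are visited infinitely often by every
  kind. The kinds of the vertices on this branch are prescribed by their depth, so the branch spans the required
  graph.
\<close>

section \<open>Forcing in finitely many rounds\<close>

text \<open>With \<open>n\<close> centres per forest, a prescribed centre leaves
  \<open>n ^ s / n\<close> tuples. A potential game on a family \<open>Y\<close> of tuples therefore
  costs about \<open>(s + 1) * n ^ s / n\<close>, Breaker's first move and all pair degrees
  together, against an expected gain of \<open>card Y / 2 ^ s\<close>. So a fixed proportion of all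
  tuples suffices as soon as \<open>n\<close> is exponential in \<open>s * s\<close>, a bound for
  the number of edges inside one tuple; this is what the size of \<open>C'\<close> provides.

  The main obstacle is that only one kind can be inserted at a given node, while Maker cannot direct
  a vertex of that kind there. So a round counts as a visit even if nothing is inserted, the rounds
  cycle through the kinds, and the visits are counted separately for each kind. A node visited
  infinitely often by every kind fills up, because the kind wanted there is among its visitors. The
  degree \<open>q\<close> and the share \<open>quota\<close> are chosen such that all kinds together
  can starve neither all children of a full node nor all tuples.\<close>

definition legal :: "'e set \<Rightarrow> 'e list \<Rightarrow> bool" where
  "legal E h \<longleftrightarrow> even (length h) \<and> distinct h \<and> set h \<subseteq> E"

definition maker_moves :: "'e list \<Rightarrow> 'e set" where
  "maker_moves h = {h ! i | i. i < length h \<and> even i}"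

text \<open>A round is a move of Maker followed by Breaker's reply, so \<open>Q\<close> is tested
  only with Maker to move. The disjunct \<open>Q h\<close> in the step turns \<open>n\<close> into
  an upper bound on the number of rounds, which is what \<open>strategy_from_force\<close>
  minimises.\<close>

primrec force :: "'e set \<Rightarrow> nat \<Rightarrow> ('e list \<Rightarrow> bool) \<Rightarrow> 'e list \<Rightarrow> bool" where
  "force E 0 Q h \<longleftrightarrow> Q h"
| "force E (Suc n) Q h \<longleftrightarrow>
     Q h \<or> (\<exists>e\<in>E - set h. \<forall>b\<in>E - set h - {e}. force E n Q (h @ [e, b]))"

lemma maker_moves_subset: "maker_moves h \<subseteq> set h"
  by (auto simp: maker_moves_def)

lemma maker_moves_append: "maker_moves h \<subseteq> maker_moves (h @ x)"
proof
  fix e assume "e \<in> maker_moves h"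
  then obtain i where "e = h ! i" "i < length h" "even i" by (auto simp: maker_moves_def)
  then show "e \<in> maker_moves (h @ x)" by (auto simp: maker_moves_def nth_append intro!: exI[of _ i])
qed

lemma maker_moves_step:
  assumes "even (length h)"
  shows "maker_moves (h @ [e, b]) = insert e (maker_moves h)"
proof (intro set_eqI iffI)
  fix y assume "y \<in> maker_moves (h @ [e, b])"
  then obtain i where i: "y = (h @ [e, b]) ! i" "i < length h + 2" "even i" by (auto simp: maker_moves_def)
  then consider "i < length h" | "i = length h" using assms
    by (metis Suc_eq_plus1 add_2_eq_Suc' even_Suc less_SucE)
  then show "y \<in> insert e (maker_moves h)"
    using i by cases (auto simp: maker_moves_def nth_append)
next
  fix y assume "y \<in> insert e (maker_moves h)"
  moreover have "e \<in> maker_moves (h @ [e, b])" unfolding maker_moves_def using assms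
    by (intro CollectI exI[of _ "length h"]) (simp add: nth_append)
  ultimately show "y \<in> maker_moves (h @ [e, b])" using maker_moves_append[of h "[e, b]"] by auto
qed

lemma force_mono:
  assumes "force E n Q h" and "\<And>h. Q h \<Longrightarrow> Q' h"
  shows "force E n Q' h"
  using assms(1)
proof (induction n arbitrary: h)
  case (Suc n)
  then show ?case using assms(2) unfolding force.simps by meson
qed (simp add: assms(2))

lemma force_Suc: "force E n Q h \<Longrightarrow> force E (Suc n) Q h"
proof (induction n arbitrary: h)
  case (Suc n)
  then show ?case unfolding force.simps(2)[of E "Suc n"] unfolding force.simps(2)[of E n Q h] by meson
qed simp

lemma force_le:
  assumes "force E n Q h" "n \<le> m"
  shows "force E m Q h"
  using assms(2,1) by (induction rule: dec_induct) (auto intro: force_Suc simp del: force.simps(2))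

lemma force_trans:
  "force E n Q h \<Longrightarrow> (\<And>h. Q h \<Longrightarrow> force E m Q' h) \<Longrightarrow> force E (n + m) Q' h"
proof (induction n arbitrary: h)
  case (Suc n)
  show ?case
  proof (cases "Q h")
    case True
    then show ?thesis using Suc.prems(2) force_le[of E m Q' h "Suc n + m"] by simp
  next
    case False
    then obtain e where e: "e \<in> E - set h" "\<forall>b\<in>E - set h - {e}. force E n Q (h @ [e, b])"
      using Suc.prems(1) by auto
    then have "\<forall>b\<in>E - set h - {e}. force E (n + m) Q' (h @ [e, b])"
      using Suc.IH Suc.prems(2) by blast
    then show ?thesis using e(1) by auto
  qed
qed simp

text \<open>Legality and the prefix property survive any sequence of rounds, so they can be added to
  every goal. The bound on \<open>length x\<close> serves later to count how many fresh leaves a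
  block of rounds can spoil.\<close>

lemma force_ext:
  assumes "legal E h" "force E n Q h"
  shows "force E n (\<lambda>h'. Q h' \<and> legal E h' \<and> (\<exists>x. h' = h @ x \<and> length x \<le> 2 * n)) h"
  using assms
proof (induction n arbitrary: h)
  case (Suc n)
  show ?case
  proof (cases "Q h")
    case True
    then show ?thesis using Suc.prems(1) by simp
  next
    case False
    then obtain e where e: "e \<in> E - set h" "\<forall>b\<in>E - set h - {e}. force E n Q (h @ [e, b])"
      using Suc.prems by auto
    have "force E n (\<lambda>h'. Q h' \<and> legal E h' \<and> (\<exists>x. h' = h @ x \<and> length x \<le> 2 * Suc n)) (h @ [e, b])"
      if b: "b \<in> E - set h - {e}" for b
    proof -
      have "legal E (h @ [e, b])" using Suc.prems(1) e(1) b by (auto simp: legal_def)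
      from Suc.IH[OF this] e(2) b
      have "force E n (\<lambda>h'. Q h' \<and> legal E h' \<and> (\<exists>x. h' = (h @ [e, b]) @ x \<and> length x \<le> 2 * n)) (h @ [e, b])"
        by blast
      then show ?thesis by (rule force_mono) auto
    qed
    then show ?thesis using e(1) by auto
  qed
qed auto

text \<open>Maker chases the next checkpoint and, among the moves that force it, plays one with the least
  number of remaining rounds; this number decreases until the checkpoint is reached.\<close>

lemma strategy_from_force:
  fixes E :: "'a set set" and Inv :: "'st \<Rightarrow> 'a set list \<Rightarrow> bool" and Rel :: "'st \<Rightarrow> 'st \<Rightarrow> bool"
  assumes infE: "infinite E"
    and init: "Inv s0 []"
    and step: "\<And>st h. legal E h \<Longrightarrow> Inv st h \<Longrightarrow>
       \<exists>n. force E n (\<lambda>h'. length h < length h' \<and> (\<exists>st'. Inv st' h' \<and> Rel st st')) h"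
  shows "\<exists>\<sigma>. (\<forall>h. even (length h) \<and> distinct h \<and> set h \<subseteq> E \<longrightarrow> \<sigma> h \<in> E - set h) \<and>
     (\<forall>p. (\<forall>n. p n \<in> E \<and> p n \<notin> p ` {..<n}) \<and> follows \<sigma> p \<longrightarrow>
       (\<exists>S f. S 0 = s0 \<and> strict_mono f \<and>
          (\<forall>r. Inv (S r) (map p [0..<f r]) \<and> Rel (S r) (S (Suc r)))))"
proof -
  define Tgt where "Tgt st h0 h' \<longleftrightarrow> length h0 < length h' \<and> (\<exists>st'. Inv st' h' \<and> Rel st st')"
    for st :: 'st and h0 h' :: "'a set list"
  \<comment> \<open>A strategy sees only the list of moves, so the current state and the position at
    the last checkpoint are recomputed by replaying all prefixes of even length.\<close>
  define upd where "upd h' = (\<lambda>(st, h0). if Tgt st h0 h'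
      then (SOME st'. Inv st' h' \<and> Rel st st', h') else (st, h0))" for h'
  define run where "run k h = rec_nat (s0, []) (\<lambda>k. upd (take (2 * Suc k) h)) k"
    for k :: nat and h :: "'a set list"
  have run0: "run 0 h = (s0, [])" for h by (simp add: run_def)
  have runS: "run (Suc k) h = upd (take (2 * Suc k) h) (run k h)" for k h by (simp add: run_def)
  have run_take: "run k (take (2 * m) h) = run k h" if "k \<le> m" for k m h
    using that by (induction k) (simp_all add: run0 runS min_def)
  define good where "good T n h e \<longleftrightarrow> e \<in> E - set h \<and> (\<forall>b\<in>E - set h - {e}. force E n T (h @ [e, b]))"
    for T n h e
  \<comment> \<open>The subtracted 1 is the round about to be played, so the minimum drops whatever
    Breaker replies. The other branch is a default.\<close>
  define pick where "pick T h = (if \<exists>n. force E n T h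
     then SOME e. good T ((LEAST n. force E n T h) - 1) h e
     else SOME e. e \<in> E - set h)" for T h
  \<comment> \<open>The membership test makes \<open>\<sigma>\<close> legal also at histories that
    it would never produce itself.\<close>
  define \<sigma> where "\<sigma> h = (let e = (case run (length h div 2) h of (st, h0) \<Rightarrow> pick (Tgt st h0) h)
     in if e \<in> E - set h then e else SOME e. e \<in> E - set h)" for h
  have ex: "\<exists>e. e \<in> E - set h" for h
    using infE by (metis Diff_eq_empty_iff List.finite_set all_not_in_conv finite_subset)
  have "\<sigma> h \<in> E - set h" for h
    unfolding \<sigma>_def Let_def using someI_ex[OF ex[of h]] by auto
  moreover have "\<exists>S f. S 0 = s0 \<and> strict_mono f \<and>
          (\<forall>r. Inv (S r) (map p [0..<f r]) \<and> Rel (S r) (S (Suc r)))"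
    if play: "\<forall>n. p n \<in> E \<and> p n \<notin> p ` {..<n}" and fol: "follows \<sigma> p" for p
  proof -
    define H where "H k = map p [0..<2 * k]" for k
    have lenH: "length (H k) = 2 * k" for k by (simp add: H_def)
    have takeH: "take (2 * k) (H m) = H k" if "k \<le> m" for k m
      using that by (simp add: H_def take_map)
    have HS: "H (Suc k) = H k @ [p (2 * k), p (2 * k + 1)]" for k
      by (simp add: H_def)
    have setH: "set (H k) = p ` {..<2 * k}" for k by (auto simp: H_def)
    have distH: "distinct (H k)" for k
    proof -
      have "inj p"
        by (rule linorder_injI) (metis image_eqI lessThan_iff play)
      then show ?thesis by (simp add: H_def distinct_map inj_on_def)
    qed
    have legalH: "legal E (H k)" for k
      using play distH[of k] by (auto simp: legal_def lenH setH)
    define R where "R k = run k (H k)" for k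
    have RS: "R (Suc k) = upd (H (Suc k)) (R k)" for k
    proof -
      have "run k (H (Suc k)) = run k (H k)"
        using run_take[of k k "H (Suc k)"] takeH[of k "Suc k"] by simp
      then show ?thesis using takeH[of "Suc k" "Suc k"] by (simp add: R_def runS)
    qed
    have Pm: "good (Tgt st h0) ((LEAST n. force E n (Tgt st h0) (H k)) - 1) (H k) (p (2 * k))"
      if rk: "R k = (st, h0)" and fk: "\<exists>n. force E n (Tgt st h0) (H k)" and nk: "\<not> Tgt st h0 (H k)" for k st h0
    proof -
      let ?T = "Tgt st h0"
      define n where "n = (LEAST n. force E n ?T (H k))"
      have fn: "force E n ?T (H k)" unfolding n_def using fk by (rule LeastI_ex)
      then obtain m where m: "n = Suc m" using nk by (cases n) auto
      have "\<exists>e. good ?T (n - 1) (H k) e" using fn nk unfolding m good_def by auto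
      then have "good ?T (n - 1) (H k) (SOME e. good ?T (n - 1) (H k) e)" by (rule someI_ex)
      then have g: "good ?T (n - 1) (H k) (pick ?T (H k))"
        using fk unfolding pick_def n_def by simp
      have "p (2 * k) = \<sigma> (H k)" using fol unfolding follows_def H_def by simp
      also have "\<dots> = pick ?T (H k)"
        using rk g unfolding \<sigma>_def by (simp add: lenH R_def Let_def good_def)
      finally have *: "p (2 * k) = pick ?T (H k)" .
      show "good (Tgt st h0) ((LEAST n. force E n (Tgt st h0) (H k)) - 1) (H k) (p (2 * k))"
        using g * unfolding n_def by simp
    qed
    have reach: "\<exists>j>k. R j = (SOME st'. Inv st' (H j) \<and> Rel st st', H j) \<and> (\<exists>st'. Inv st' (H j) \<and> Rel st st')"
      if "R k = (st, h0)" "force E n (Tgt st h0) (H k)" "\<not> Tgt st h0 (H k)" for k n st h0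
      using that
    proof (induction n arbitrary: k rule: less_induct)
      case (less n)
      let ?T = "Tgt st h0"
      define l where "l = (LEAST n. force E n ?T (H k))"
      have fl: "force E l ?T (H k)" unfolding l_def using less.prems(2) by (rule LeastI)
      have ln: "l \<le> n" unfolding l_def using less.prems(2) by (rule Least_le)
      have l0: "l \<noteq> 0" using fl less.prems(3) by (cases l) auto
      have "good ?T (l - 1) (H k) (p (2 * k))" unfolding l_def
        using Pm[OF less.prems(1) _ less.prems(3)] less.prems(2) by blast
      moreover have "p (2 * k + 1) \<in> E - set (H k) - {p (2 * k)}"
        using play[rule_format, of "2 * k + 1"] by (force simp: setH)
      ultimately have f: "force E (l - 1) ?T (H (Suc k))"
        unfolding good_def HS by blast
      show ?case
      proof (cases "?T (H (Suc k))")
        case True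
        then have "R (Suc k) = (SOME st'. Inv st' (H (Suc k)) \<and> Rel st st', H (Suc k))"
          using less.prems(1) by (simp add: RS upd_def)
        then show ?thesis using True unfolding Tgt_def by blast
      next
        case False
        then have "R (Suc k) = (st, h0)" using less.prems(1) by (simp add: RS upd_def)
        from less.IH[OF _ this f False] l0 ln show ?thesis
          by (meson Suc_lessD diff_less le_less_trans less_le_trans zero_less_one neq0_conv)
      qed
    qed
    \<comment> \<open>A checkpoint is the number of completed rounds together with the state
      reached; dependent choice then strings the checkpoints together.\<close>
    define good_k where "good_k x \<longleftrightarrow> R (fst x) = (snd x, H (fst x)) \<and> Inv (snd x) (H (fst x))"
      for x :: "nat \<times> 'st"
    have ex0: "good_k (0, s0)" using init by (simp add: good_k_def R_def run0 H_def)
    have exS: "\<exists>y. good_k y \<and> fst x < fst y \<and> Rel (snd x) (snd y)" if "good_k x" for x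
    proof -
      obtain k st where x: "x = (k, st)" by force
      have rk: "R k = (st, H k)" and I: "Inv st (H k)" using that by (auto simp: good_k_def x)
      from step[OF legalH I] obtain n where "force E n (Tgt st (H k)) (H k)"
        unfolding Tgt_def by blast
      from reach[OF rk this] obtain j where j: "j > k"
        "R j = (SOME st'. Inv st' (H j) \<and> Rel st st', H j)" "\<exists>st'. Inv st' (H j) \<and> Rel st st'"
        by (auto simp: Tgt_def)
      from someI_ex[OF j(3)] j(1,2) show ?thesis
        by (intro exI[of _ "(j, SOME st'. Inv st' (H j) \<and> Rel st st')"]) (auto simp: good_k_def x)
    qed
    obtain X where X: "X 0 = (0, s0)" "\<forall>r. good_k (X r)"
      "\<forall>r. fst (X r) < fst (X (Suc r)) \<and> Rel (snd (X r)) (snd (X (Suc r)))"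
      using dependent_nat_choice[of "\<lambda>r x. good_k x \<and> (r = 0 \<longrightarrow> x = (0, s0))"
          "\<lambda>r x y. fst x < fst y \<and> Rel (snd x) (snd y)"] ex0 exS by auto
    show ?thesis
    proof (intro exI conjI allI)
      show "(snd \<circ> X) 0 = s0" using X(1) by simp
      show "strict_mono (\<lambda>r. 2 * fst (X r))" using X(3) by (simp add: strict_mono_Suc_iff)
      show "Inv ((snd \<circ> X) r) (map p [0..<2 * fst (X r)])" for r
        using X(2) by (auto simp: good_k_def H_def)
      show "Rel ((snd \<circ> X) r) ((snd \<circ> X) (Suc r))" for r using X(3) by simp
    qed
  qed
  ultimately show ?thesis by (intro exI[of _ \<sigma>]) auto
qed

section \<open>Games on a finite board\<close>

text \<open>Breaker moves first and Maker may pass. When Breaker plays outside the board in the real game,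
  Maker pretends that he removed an arbitrary element of the board.\<close>

inductive board_win :: "('x set \<Rightarrow> bool) \<Rightarrow> 'x set \<Rightarrow> 'x set \<Rightarrow> bool" for P where
  fin: "P M \<Longrightarrow> board_win P M {}"
| step: "R \<noteq> {} \<Longrightarrow>
    (\<forall>b\<in>R. board_win P M (R - {b}) \<or> (\<exists>m\<in>R - {b}. board_win P (insert m M) (R - {b} - {m}))) \<Longrightarrow> board_win P M R"

lemma board_win_empty: "board_win P M {} \<Longrightarrow> P M"
  by (erule board_win.cases) auto

lemma board_win_move:
  "board_win P M R \<Longrightarrow> b \<in> R \<Longrightarrow> board_win P M (R - {b}) \<or> (\<exists>m\<in>R - {b}. board_win P (insert m M) (R - {b} - {m}))"
  by (erule board_win.cases) auto

text \<open>Maker answers on the board where Breaker has just played, which is possible since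
  Breaker moves first and Maker may pass. The subsets \<open>A\<close> appear because neither goal
  is assumed to be monotone.\<close>

lemma board_win_sum:
  assumes "finite R1" "finite R2" "board_win P1 M1 R1" "board_win P2 M2 R2" "R1 \<inter> R2 = {}"
  shows "board_win (\<lambda>M. (\<exists>A\<subseteq>M. P1 A) \<and> (\<exists>A\<subseteq>M. P2 A)) (M1 \<union> M2) (R1 \<union> R2)"
  using assms
proof (induction "card (R1 \<union> R2)" arbitrary: R1 R2 M1 M2 rule: less_induct)
  case less
  let ?P = "\<lambda>M. (\<exists>A\<subseteq>M. P1 A) \<and> (\<exists>A\<subseteq>M. P2 A)"
  show ?case
  proof (cases "R1 \<union> R2 = {}")
    case True
    then have "P1 M1" "P2 M2" using less.prems(3,4) board_win_empty by auto
    then have "?P (M1 \<union> M2)" by blast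
    then have "board_win ?P (M1 \<union> M2) {}" by (rule board_win.fin)
    then show ?thesis unfolding True .
  next
    case False
    have dec: "card (R1' \<union> R2') < card (R1 \<union> R2)" if "R1' \<union> R2' \<subset> R1 \<union> R2" for R1' R2'
      using that less.prems(1,2) by (simp add: psubset_card_mono)
    show ?thesis
    proof (rule board_win.step[OF False], rule ballI)
      fix b assume "b \<in> R1 \<union> R2"
      then consider "b \<in> R1" "b \<notin> R2" | "b \<in> R2" "b \<notin> R1" using less.prems(5) by blast
      then show "board_win ?P (M1 \<union> M2) (R1 \<union> R2 - {b}) \<or>
        (\<exists>m\<in>R1 \<union> R2 - {b}. board_win ?P (insert m (M1 \<union> M2)) (R1 \<union> R2 - {b} - {m}))"
      proof cases
        case 1
        from board_win_move[OF less.prems(3) 1(1)] show ?thesis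
        proof
          assume w: "board_win P1 M1 (R1 - {b})"
          have "board_win ?P (M1 \<union> M2) (R1 - {b} \<union> R2)"
            by (rule less.hyps[OF dec _ _ w less.prems(4)]) (use 1 less.prems in auto)
          moreover have "R1 - {b} \<union> R2 = R1 \<union> R2 - {b}" using 1 by blast
          ultimately show ?thesis by simp
        next
          assume "\<exists>m\<in>R1 - {b}. board_win P1 (insert m M1) (R1 - {b} - {m})"
          then obtain m where m: "m \<in> R1 - {b}" "board_win P1 (insert m M1) (R1 - {b} - {m})" by blast
          have "board_win ?P (insert m M1 \<union> M2) (R1 - {b} - {m} \<union> R2)"
            by (rule less.hyps[OF dec _ _ m(2) less.prems(4)]) (use 1 m(1) less.prems in auto)
          moreover have "R1 - {b} - {m} \<union> R2 = R1 \<union> R2 - {b} - {m}" using 1 m(1) less.prems(5) by blast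
          ultimately show ?thesis using m(1) by auto
        qed
      next
        case 2
        from board_win_move[OF less.prems(4) 2(1)] show ?thesis
        proof
          assume w: "board_win P2 M2 (R2 - {b})"
          have "board_win ?P (M1 \<union> M2) (R1 \<union> (R2 - {b}))"
            by (rule less.hyps[OF dec _ _ less.prems(3) w]) (use 2 less.prems in auto)
          moreover have "R1 \<union> (R2 - {b}) = R1 \<union> R2 - {b}" using 2 by blast
          ultimately show ?thesis by simp
        next
          assume "\<exists>m\<in>R2 - {b}. board_win P2 (insert m M2) (R2 - {b} - {m})"
          then obtain m where m: "m \<in> R2 - {b}" "board_win P2 (insert m M2) (R2 - {b} - {m})" by blast
          have "board_win ?P (M1 \<union> insert m M2) (R1 \<union> (R2 - {b} - {m}))"
            by (rule less.hyps[OF dec _ _ less.prems(3) m(2)]) (use 2 m(1) less.prems in auto)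
          moreover have "R1 \<union> (R2 - {b} - {m}) = R1 \<union> R2 - {b} - {m}" using 2 m(1) less.prems(5) by blast
          ultimately show ?thesis using m(1) by auto
        qed
      qed
    qed
  qed
qed

text \<open>The invariant is that a set not yet hit keeps two free elements. Maker passes unless
  Breaker takes an element of such a set, and then takes another element of it; by disjointness no
  other set suffers.\<close>

lemma board_win_pairing_aux:
  assumes "finite R" "disjoint \<P>" "\<forall>A\<in>\<P>. A \<inter> M \<noteq> {} \<or> 2 \<le> card (A \<inter> R)"
  shows "board_win (\<lambda>M. \<forall>A\<in>\<P>. A \<inter> M \<noteq> {}) M R"
  using assms(1,3)
proof (induction "card R" arbitrary: R M rule: less_induct)
  case less
  show ?case
  proof (cases "R = {}")
    case True
    then show ?thesis using less.prems(2) by (auto intro: board_win.fin)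
  next
    case False
    show ?thesis
    proof (rule board_win.step[OF False], rule ballI)
      fix b assume b: "b \<in> R"
      show "board_win (\<lambda>M. \<forall>A\<in>\<P>. A \<inter> M \<noteq> {}) M (R - {b}) \<or>
        (\<exists>m\<in>R - {b}. board_win (\<lambda>M. \<forall>A\<in>\<P>. A \<inter> M \<noteq> {}) (insert m M) (R - {b} - {m}))"
      proof (cases "\<exists>A\<in>\<P>. b \<in> A \<and> A \<inter> M = {}")
        case True
        then obtain A where A: "A \<in> \<P>" "b \<in> A" "A \<inter> M = {}" by blast
        then have "2 \<le> card (A \<inter> R)" using less.prems(2) by blast
        then have "\<not> A \<inter> R \<subseteq> {b}" using card_mono[of "{b}" "A \<inter> R"] by auto
        then obtain m where m: "m \<in> A" "m \<in> R" "m \<noteq> b" by blast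
        have "\<forall>A'\<in>\<P>. A' \<inter> insert m M \<noteq> {} \<or> 2 \<le> card (A' \<inter> (R - {b} - {m}))"
        proof
          fix A' assume A': "A' \<in> \<P>"
          show "A' \<inter> insert m M \<noteq> {} \<or> 2 \<le> card (A' \<inter> (R - {b} - {m}))"
          proof (cases "A' = A")
            case False
            then have "A' \<inter> A = {}" using assms(2) A' A(1) by (auto simp: disjoint_def)
            then have "A' \<inter> (R - {b} - {m}) = A' \<inter> R" using A(2) m(1) by blast
            then show ?thesis using less.prems(2) A' by auto
          qed (use m in auto)
        qed
        moreover have "card (R - {b} - {m}) < card R"
          using b less.prems(1) by (intro psubset_card_mono) auto
        ultimately show ?thesis using less.hyps less.prems(1) m by blast
      next
        case False
        have "\<forall>A'\<in>\<P>. A' \<inter> M \<noteq> {} \<or> 2 \<le> card (A' \<inter> (R - {b}))"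
        proof
          fix A' assume A': "A' \<in> \<P>"
          show "A' \<inter> M \<noteq> {} \<or> 2 \<le> card (A' \<inter> (R - {b}))"
          proof (cases "b \<in> A'")
            case True
            then show ?thesis using False A' by blast
          next
            case maker_nbrs: False
            then have "A' \<inter> (R - {b}) = A' \<inter> R" by blast
            then show ?thesis using less.prems(2) A' by auto
          qed
        qed
        moreover have "card (R - {b}) < card R"
          using b less.prems(1) by (intro psubset_card_mono) auto
        ultimately show ?thesis using less.hyps less.prems(1) by blast
      qed
    qed
  qed
qed

lemma board_win_pairing:
  assumes "finite (\<Union>\<P>)" "disjoint \<P>" "\<And>A. A \<in> \<P> \<Longrightarrow> 2 \<le> card A"
  shows "board_win (\<lambda>M. \<forall>A\<in>\<P>. A \<inter> M \<noteq> {}) {} (\<Union>\<P>)"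
proof (rule board_win_pairing_aux[OF assms(1,2)], rule ballI, rule disjI2)
  fix A assume "A \<in> \<P>"
  moreover from this have "A \<inter> \<Union>\<P> = A" by blast
  ultimately show "2 \<le> card (A \<inter> \<Union>\<P>)" using assms(3) by simp
qed

text \<open>The expected number of members \<open>H \<tau>\<close> that Maker owns in the end if every element of the
  remaining board \<open>R\<close> goes to either player with probability one half.\<close>

definition potential :: "'t set \<Rightarrow> ('t \<Rightarrow> 'x set) \<Rightarrow> 'x set \<Rightarrow> 'x set \<Rightarrow> real" where
  "potential Y H M R = (\<Sum>\<tau>\<in>Y. if H \<tau> \<subseteq> M \<union> R then (1/2) ^ card (H \<tau> \<inter> R) else 0)"

text \<open>The share of the potential carried by the sets through \<open>x\<close>, hence both the
  gain if Maker takes \<open>x\<close> and the loss if Breaker does.\<close>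

definition pot_deg :: "'t set \<Rightarrow> ('t \<Rightarrow> 'x set) \<Rightarrow> 'x \<Rightarrow> 'x set \<Rightarrow> 'x set \<Rightarrow> real" where
  "pot_deg Y H x M R = (\<Sum>\<tau>\<in>Y. if x \<in> H \<tau> \<and> H \<tau> \<subseteq> M \<union> R then (1/2) ^ card (H \<tau> \<inter> R) else 0)"

lemma potential_empty:
  assumes "finite Y"
  shows "potential Y H M {} = card {\<tau>\<in>Y. H \<tau> \<subseteq> M}"
  using assms by (simp add: potential_def sum.If_cases Int_def)

lemma potential_maker:
  assumes "finite R" "x \<in> R" "x \<notin> M"
  shows "potential Y H (insert x M) (R - {x}) = potential Y H M R + pot_deg Y H x M R"
  unfolding potential_def pot_deg_def sum.distrib[symmetric]
proof (rule sum.cong[OF refl])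
  fix \<tau>
  have eq: "insert x M \<union> (R - {x}) = M \<union> R" using assms(2) by blast
  show "(if H \<tau> \<subseteq> insert x M \<union> (R - {x}) then (1 / 2) ^ card (H \<tau> \<inter> (R - {x})) else 0) =
     (if H \<tau> \<subseteq> M \<union> R then (1 / 2) ^ card (H \<tau> \<inter> R) else 0) +
     (if x \<in> H \<tau> \<and> H \<tau> \<subseteq> M \<union> R then (1 / 2) ^ card (H \<tau> \<inter> R) else (0::real))"
  proof (cases "x \<in> H \<tau>")
    case True
    then have "H \<tau> \<inter> R = insert x (H \<tau> \<inter> (R - {x}))" using assms(2) by blast
    then have "card (H \<tau> \<inter> R) = Suc (card (H \<tau> \<inter> (R - {x})))"
      using assms(1) by (metis Diff_iff IntD2 card_insert_disjoint finite_Diff finite_Int insertI1)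
    then show ?thesis unfolding eq using True by simp
  next
    case False
    then have "H \<tau> \<inter> (R - {x}) = H \<tau> \<inter> R" by blast
    then show ?thesis unfolding eq by (simp add: False)
  qed
qed

lemma potential_breaker:
  assumes "x \<notin> M"
  shows "potential Y H M (R - {x}) = potential Y H M R - pot_deg Y H x M R"
  unfolding potential_def pot_deg_def sum_subtractf[symmetric]
proof (rule sum.cong[OF refl])
  fix \<tau>
  show "(if H \<tau> \<subseteq> M \<union> (R - {x}) then (1 / 2) ^ card (H \<tau> \<inter> (R - {x})) else 0) =
     (if H \<tau> \<subseteq> M \<union> R then (1 / 2) ^ card (H \<tau> \<inter> R) else 0) -
     (if x \<in> H \<tau> \<and> H \<tau> \<subseteq> M \<union> R then (1 / 2) ^ card (H \<tau> \<inter> R) else (0::real))"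
  proof (cases "x \<in> H \<tau>")
    case True
    then have "\<not> H \<tau> \<subseteq> M \<union> (R - {x})" using assms by blast
    then show ?thesis using True by simp
  next
    case False
    then have "H \<tau> \<inter> (R - {x}) = H \<tau> \<inter> R" "H \<tau> \<subseteq> M \<union> (R - {x}) \<longleftrightarrow> H \<tau> \<subseteq> M \<union> R" by blast+
    then show ?thesis by (simp add: False)
  qed
qed

text \<open>Only the sets through both \<open>m\<close> and \<open>x\<close> change their weight,
  and each of them weighs at most 1 afterwards.\<close>

lemma pot_deg_maker:
  fixes D :: real
  assumes "finite Y" "finite R" "m \<in> R" "card {\<tau>\<in>Y. m \<in> H \<tau> \<and> x \<in> H \<tau>} \<le> D"
  shows "pot_deg Y H x (insert m M) (R - {m}) \<le> pot_deg Y H x M R + D"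
proof -
  have "pot_deg Y H x (insert m M) (R - {m}) \<le>
    (\<Sum>\<tau>\<in>Y. (if x \<in> H \<tau> \<and> H \<tau> \<subseteq> M \<union> R then (1/2) ^ card (H \<tau> \<inter> R) else 0) +
       (if m \<in> H \<tau> \<and> x \<in> H \<tau> then 1 else 0))"
    unfolding pot_deg_def
  proof (rule sum_mono)
    fix \<tau>
    have eq: "insert m M \<union> (R - {m}) = M \<union> R" using assms(3) by blast
    show "(if x \<in> H \<tau> \<and> H \<tau> \<subseteq> insert m M \<union> (R - {m}) then (1/2) ^ card (H \<tau> \<inter> (R - {m})) else 0)
      \<le> (if x \<in> H \<tau> \<and> H \<tau> \<subseteq> M \<union> R then (1/2) ^ card (H \<tau> \<inter> R) else 0) +
       (if m \<in> H \<tau> \<and> x \<in> H \<tau> then 1 else (0::real))"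
    proof (cases "m \<in> H \<tau>")
      case True
      have "(1/2::real) ^ card (H \<tau> \<inter> (R - {m})) \<le> 1 + (1/2) ^ card (H \<tau> \<inter> R)"
        by (rule add_increasing2) (auto intro: power_le_one)
      then show ?thesis unfolding eq using True by simp
    next
      case False
      then have "H \<tau> \<inter> (R - {m}) = H \<tau> \<inter> R" by blast
      then show ?thesis unfolding eq by (simp add: False)
    qed
  qed
  also have "\<dots> = pot_deg Y H x M R + card {\<tau>\<in>Y. m \<in> H \<tau> \<and> x \<in> H \<tau>}"
    unfolding pot_deg_def sum.distrib using assms(1) by (simp add: sum.If_cases Int_def)
  finally show ?thesis using assms(4) by linarith
qed

text \<open>Here Maker is to move, whereas \<open>board_win\<close> describes positions with Breaker
  to move; hence the conclusion names Maker's move. Each free element carries a credit of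
  \<open>D\<close>: a move of Maker and a reply use up two of them and lower the potential by at
  most \<open>D\<close>.\<close>

lemma board_win_potential_aux:
  fixes D k :: real
  assumes fY: "finite Y" and D: "\<And>x y. x \<in> X \<Longrightarrow> y \<in> X \<Longrightarrow> x \<noteq> y \<Longrightarrow> card {\<tau>\<in>Y. x \<in> H \<tau> \<and> y \<in> H \<tau>} \<le> D"
    and D0: "0 \<le> D"
    and R: "finite R" "R \<subseteq> X" "M \<inter> R = {}" "k + D * card R \<le> potential Y H M R"
  shows "(R = {} \<and> k \<le> card {\<tau>\<in>Y. H \<tau> \<subseteq> M}) \<or>
    (\<exists>m\<in>R. board_win (\<lambda>M. k \<le> card {\<tau>\<in>Y. H \<tau> \<subseteq> M}) (insert m M) (R - {m}))"
  using R
proof (induction "card R" arbitrary: R M rule: less_induct)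
  case less
  let ?P = "\<lambda>M. k \<le> card {\<tau>\<in>Y. H \<tau> \<subseteq> M}"
  show ?case
  proof (cases "R = {}")
    case True
    then show ?thesis using less.prems(4) potential_empty[OF fY, of H M] by simp
  next
    case False
    have "finite ((\<lambda>x. pot_deg Y H x M R) ` R)" "(\<lambda>x. pot_deg Y H x M R) ` R \<noteq> {}"
      using less.prems(1) False by auto
    then have "Max ((\<lambda>x. pot_deg Y H x M R) ` R) \<in> (\<lambda>x. pot_deg Y H x M R) ` R" by (rule Max_in)
    then obtain m where m: "m \<in> R" "Max ((\<lambda>x. pot_deg Y H x M R) ` R) = pot_deg Y H m M R" by blast
    have mx: "pot_deg Y H x M R \<le> pot_deg Y H m M R" if "x \<in> R" for x
      unfolding m(2)[symmetric] using that less.prems(1) by simp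
    have mM: "m \<notin> M" using m(1) less.prems(3) by blast
    have pm: "potential Y H (insert m M) (R - {m}) = potential Y H M R + pot_deg Y H m M R"
      using potential_maker[OF less.prems(1) m(1) mM] .
    have "board_win ?P (insert m M) (R - {m})"
    proof (cases "R - {m} = {}")
      case True
      have "0 \<le> pot_deg Y H m M R" unfolding pot_deg_def by (rule sum_nonneg) auto
      moreover have "0 \<le> D * card R" using D0 by simp
      ultimately have "?P (insert m M)"
        using pm less.prems(4) potential_empty[OF fY, of H "insert m M"] unfolding True by linarith
      then show ?thesis unfolding True by (rule board_win.fin)
    next
      case ne: False
      show ?thesis
      proof (rule board_win.step[OF ne], rule ballI)
        fix b assume b: "b \<in> R - {m}"
        let ?R = "R - {m} - {b}"
        have bM: "b \<notin> insert m M" using b less.prems(3) by blast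
        have "card {\<tau>\<in>Y. m \<in> H \<tau> \<and> b \<in> H \<tau>} \<le> D" using D[of m b] b m(1) less.prems(2) by blast
        \<comment> \<open>Before Maker's move the degree of \<open>b\<close> is at most that of
          \<open>m\<close>, which she gains; her move raises the degree of \<open>b\<close> by at
          most \<open>D\<close>.\<close>
        then have "pot_deg Y H b (insert m M) (R - {m}) \<le> pot_deg Y H b M R + D"
          by (rule pot_deg_maker[OF fY less.prems(1) m(1)])
        also have "\<dots> \<le> pot_deg Y H m M R + D" using mx b by simp
        finally have "potential Y H M R - D \<le> potential Y H (insert m M) ?R"
          using potential_breaker[OF bM, of Y H "R - {m}"] pm by linarith
        moreover have cR: "card R = Suc (card (R - {m}))" "card (R - {m}) = Suc (card ?R)"
          using b m(1) less.prems(1) by (metis card_Suc_Diff1 finite_Diff)+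
        have "D * card R = D * card ?R + 2 * D" using cR by (simp add: algebra_simps)
        ultimately have "k + D * card ?R \<le> potential Y H (insert m M) ?R"
          using less.prems(4) D0 by linarith
        then have "(?R = {} \<and> k \<le> card {\<tau>\<in>Y. H \<tau> \<subseteq> insert m M}) \<or>
          (\<exists>m'\<in>?R. board_win ?P (insert m' (insert m M)) (?R - {m'}))"
        proof (rule less.hyps[rotated -1])
          show "card ?R < card R" using cR by linarith
          show "finite ?R" "?R \<subseteq> X" "insert m M \<inter> ?R = {}" using less.prems(1,2,3) by auto
        qed
        then show "board_win ?P (insert m M) ?R \<or> (\<exists>m'\<in>?R. board_win ?P (insert m' (insert m M)) (?R - {m'}))"
        proof
          assume *: "?R = {} \<and> ?P (insert m M)"
          then have "board_win ?P (insert m M) {}" by (intro board_win.fin) simp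
          then show ?thesis using * by metis
        qed blast
      qed
    qed
    then show ?thesis using m(1) by blast
  qed
qed

text \<open>Beck's criterion: Breaker's first move costs at most \<open>D1\<close>, and when Maker always takes the
  element of largest degree, every later round costs at most the pair degree \<open>D2\<close>.\<close>

lemma board_win_potential:
  fixes D1 D2 k :: real
  assumes "finite Y" "finite X" "\<And>\<tau>. \<tau> \<in> Y \<Longrightarrow> H \<tau> \<subseteq> X \<and> card (H \<tau>) \<le> m"
    and "\<And>x. x \<in> X \<Longrightarrow> card {\<tau>\<in>Y. x \<in> H \<tau>} \<le> D1"
    and "\<And>x y. x \<in> X \<Longrightarrow> y \<in> X \<Longrightarrow> x \<noteq> y \<Longrightarrow> card {\<tau>\<in>Y. x \<in> H \<tau> \<and> y \<in> H \<tau>} \<le> D2"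
    and "0 \<le> D1" "0 \<le> D2" and k: "k \<le> card Y / 2 ^ m - D1 - D2 * card X"
  shows "board_win (\<lambda>M. k \<le> card {\<tau>\<in>Y. H \<tau> \<subseteq> M}) {} X"
proof -
  let ?P = "\<lambda>M. k \<le> card {\<tau>\<in>Y. H \<tau> \<subseteq> M}"
  have "card Y / 2 ^ m = (\<Sum>\<tau>\<in>Y. (1/2) ^ m)" by (simp add: power_divide)
  also have "\<dots> \<le> potential Y H {} X"
    unfolding potential_def
  proof (rule sum_mono)
    fix \<tau> assume t: "\<tau> \<in> Y"
    then have "H \<tau> \<inter> X = H \<tau>" "card (H \<tau>) \<le> m" "H \<tau> \<subseteq> X" using assms(3) by auto
    then show "(1/2) ^ m \<le> (if H \<tau> \<subseteq> {} \<union> X then (1/2) ^ card (H \<tau> \<inter> X) else (0::real))"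
      by (simp add: power_decreasing)
  qed
  finally have pot: "k + D1 + D2 * card X \<le> potential Y H {} X" using k by linarith
  show ?thesis
  proof (cases "X = {}")
    case True
    then have "?P {}" using pot potential_empty[OF assms(1), of H "{}"] assms(6) by simp
    then show ?thesis using board_win.fin[of ?P] True by simp
  next
    case False
    show ?thesis
    proof (rule board_win.step[OF False], rule ballI)
      fix b assume b: "b \<in> X"
      have "pot_deg Y H b {} X \<le> (\<Sum>\<tau>\<in>Y. if b \<in> H \<tau> then 1 else 0)"
        unfolding pot_deg_def by (rule sum_mono) (auto intro: power_le_one)
      also have "\<dots> = card {\<tau>\<in>Y. b \<in> H \<tau>}" using assms(1) by (simp add: sum.If_cases Int_def)
      also have "\<dots> \<le> D1" using assms(4)[OF b] .
      finally have "k + D2 * card X \<le> potential Y H {} (X - {b})"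
        using potential_breaker[of b "{}" Y H X] pot by simp
      moreover have "D2 * card (X - {b}) \<le> D2 * card X"
        using assms(2,7) by (intro mult_left_mono) (auto intro: card_mono)
      ultimately have pk: "k + D2 * card (X - {b}) \<le> potential Y H {} (X - {b})" by linarith
      have "(X - {b} = {} \<and> ?P {}) \<or> (\<exists>m\<in>X - {b}. board_win ?P (insert m {}) (X - {b} - {m}))"
        by (rule board_win_potential_aux[of Y X H D2 "X - {b}" "{}" k, OF assms(1) assms(5) assms(7) _ _ _ pk])
          (use assms(2) in auto)
      then show "board_win ?P {} (X - {b}) \<or> (\<exists>m\<in>X - {b}. board_win ?P {m} (X - {b} - {m}))"
      proof
        assume *: "X - {b} = {} \<and> ?P {}"
        then have "board_win ?P {} {}" by (intro board_win.fin) simp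
        then show ?thesis using * by metis
      qed blast
    qed
  qed
qed

text \<open>Maker moves first in the real game but second on the board. So \<open>e\<close> is her
  pending move: she plays it, Breaker's reply is read as his move on the board, and her answer there
  is the next pending move. \<open>S\<close> keeps edges, such as the first one, that do not belong
  to the board.\<close>

lemma board_win_force:
  fixes E :: "'e set" and ed :: "'x \<Rightarrow> 'e"
  assumes "infinite E" "legal E h" "finite R" "e \<in> E - set h" "ed ` R \<subseteq> E - set h - {e}"
    "inj_on ed R" "board_win P M R" "ed ` M \<union> S \<subseteq> insert e (maker_moves h)"
  shows "force E (Suc (card R)) (\<lambda>h'. S \<subseteq> maker_moves h' \<and> (\<exists>M'. P M' \<and> ed ` M' \<subseteq> maker_moves h')) h"
  using assms(2-)
proof (induction "card R" arbitrary: R M h e rule: less_induct)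
  case less
  let ?Q = "\<lambda>h'. S \<subseteq> maker_moves h' \<and> (\<exists>M'. P M' \<and> ed ` M' \<subseteq> maker_moves h')"
  have main: "force E (card R) ?Q (h @ [e, b])" if b: "b \<in> E - set h - {e}" for b
  proof -
    define h1 where "h1 = h @ [e, b]"
    have m1: "maker_moves h1 = insert e (maker_moves h)" using less.prems(1) by (simp add: maker_moves_step legal_def h1_def)
    have s1: "set h1 = insert e (insert b (set h))" by (auto simp: h1_def)
    have l1: "legal E h1" using less.prems(1,3) b by (auto simp: legal_def h1_def)
    have MS: "ed ` M \<union> S \<subseteq> maker_moves h1" using less.prems(7) m1 by simp
    show ?thesis
    proof (cases "R = {}")
      case True
      then have "P M" using less.prems(6) board_win_empty by blast
      then show ?thesis using MS True by (auto simp: h1_def)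
    next
      case False
      obtain x where x: "x \<in> R" "\<forall>y\<in>R. ed y = b \<longrightarrow> y = x"
      proof (cases "\<exists>x\<in>R. ed x = b")
        case True
        then obtain x where x: "x \<in> R" "ed x = b" by blast
        have "\<forall>y\<in>R. ed y = b \<longrightarrow> y = x" using x less.prems(5) by (metis inj_onD)
        with x(1) show thesis by (rule that)
      next
        case nx: False
        then obtain x where "x \<in> R" using False by blast
        then show thesis using that nx by blast
      qed
      have edR: "ed ` (R - {x}) \<subseteq> E - set h1" using less.prems(4) x(2) by (auto simp: s1)
      have inj: "inj_on ed (R - {x})" using less.prems(5) by (rule inj_on_subset) auto
      have cx: "card R = Suc (card (R - {x}))"
        using x(1) less.prems(2) by (metis card_Suc_Diff1)
      from board_win_move[OF less.prems(6) x(1)] have "force E (card R) ?Q h1"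
      proof
        assume w: "board_win P M (R - {x})"
        \<comment> \<open>A pass on the board is realised by an edge outside it.\<close>
        have "infinite (E - set h1 - ed ` (R - {x}))"
          using assms(1) less.prems(2) by (intro Diff_infinite_finite) auto
        then obtain e' where e': "e' \<in> E - set h1 - ed ` (R - {x})"
          by (metis ex_in_conv finite.emptyI)
        have "force E (Suc (card (R - {x}))) ?Q h1"
        proof (rule less.hyps[OF _ l1 _ _ _ inj w])
          show "ed ` (R - {x}) \<subseteq> E - set h1 - {e'}" using e' edR by blast
          show "ed ` M \<union> S \<subseteq> insert e' (maker_moves h1)" using MS by blast
        qed (use cx less.prems(2) e' in simp_all)
        then show ?thesis unfolding cx .
      next
        assume "\<exists>m\<in>R - {x}. board_win P (insert m M) (R - {x} - {m})"
        then obtain m where m: "m \<in> R - {x}" "board_win P (insert m M) (R - {x} - {m})" by blast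
        have cm: "card (R - {x}) = Suc (card (R - {x} - {m}))"
          using m(1) less.prems(2) by (metis card_Suc_Diff1 finite_Diff)
        have inj': "inj_on ed (R - {x} - {m})" using inj by (rule inj_on_subset) auto
        have ne: "ed m \<notin> ed ` (R - {x} - {m})" 
        proof
          assume "ed m \<in> ed ` (R - {x} - {m})"
          then obtain y where y: "y \<in> R - {x}" "y \<noteq> m" "ed m = ed y" by blast
          then show False using inj_onD[OF inj y(3) m(1) y(1)] by simp
        qed
        have "force E (Suc (card (R - {x} - {m}))) ?Q h1"
        proof (rule less.hyps[OF _ l1 _ _ _ inj' m(2)])
          show "ed ` (R - {x} - {m}) \<subseteq> E - set h1 - {ed m}" using ne edR by blast
          show "ed ` insert m M \<union> S \<subseteq> insert (ed m) (maker_moves h1)" using MS by blast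
          show "ed m \<in> E - set h1" using m(1) edR by blast
        qed (use cx cm less.prems(2) in simp_all)
        then show ?thesis by (rule force_le) (simp add: cx cm)
      qed
      then show ?thesis unfolding h1_def .
    qed
  qed
  show ?case unfolding force.simps(2)
    by (rule disjI2, rule bexI[OF _ less.prems(3)], rule ballI, rule main)
qed

section \<open>Joining a fresh vertex\<close>

abbreviation E0 :: "nat set set" where "E0 \<equiv> edges K_aleph0"

lemma E0_iff: "{u, v} \<in> E0 \<longleftrightarrow> u \<noteq> v"
  by (auto simp: K_aleph0_def doubleton_eq_iff)

lemma E0_cases: "e \<in> E0 \<Longrightarrow> \<exists>u v. e = {u, v} \<and> u \<noteq> v"
  by (auto simp: K_aleph0_def)

lemma infinite_E0: "infinite E0"
proof -
  have "inj (\<lambda>v. {0, Suc v})" by (auto simp: inj_on_def doubleton_eq_iff)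
  moreover have "range (\<lambda>v. {0, Suc v}) \<subseteq> E0" by (auto simp: E0_iff)
  ultimately show ?thesis by (meson finite_subset infinite_UNIV_nat range_inj_infinite)
qed

definition maker_nbrs :: "nat set list \<Rightarrow> nat \<Rightarrow> nat set" where
  "maker_nbrs h v = {x. {v, x} \<in> maker_moves h}"

text \<open>No claimed edge touches \<open>v\<close>, so Breaker cannot prevent the first edge
  \<open>{v, c}\<close>; every further edge has to be won. The potential game and the pairing game
  use disjoint sets of edges at \<open>v\<close> and can be played side by side.\<close>

lemma arrive:
  fixes D1 D2 k :: real
  assumes h: "legal E0 h" and v: "v \<notin> \<Union>(set h)" and c: "c \<noteq> v"
    and pot: "finite Y" "finite X" "\<And>\<tau>. \<tau> \<in> Y \<Longrightarrow> H \<tau> \<subseteq> X \<and> card (H \<tau>) \<le> m"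
    "\<And>x. x \<in> X \<Longrightarrow> card {\<tau>\<in>Y. x \<in> H \<tau>} \<le> D1"
    "\<And>x y. x \<in> X \<Longrightarrow> y \<in> X \<Longrightarrow> x \<noteq> y \<Longrightarrow> card {\<tau>\<in>Y. x \<in> H \<tau> \<and> y \<in> H \<tau>} \<le> D2"
    "0 \<le> D1" "0 \<le> D2" "k \<le> card Y / 2 ^ m - D1 - D2 * card X"
    and pair: "finite (\<Union>\<P>)" "disjoint \<P>" "\<And>A. A \<in> \<P> \<Longrightarrow> 2 \<le> card A"
    and disj: "X \<inter> \<Union>\<P> = {}" "v \<notin> X \<union> \<Union>\<P>" "c \<notin> X \<union> \<Union>\<P>"
  shows "force E0 (Suc (card (X \<union> \<Union>\<P>))) (\<lambda>h'. c \<in> maker_nbrs h' v \<and>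
     k \<le> card {\<tau>\<in>Y. H \<tau> \<subseteq> maker_nbrs h' v} \<and> (\<forall>A\<in>\<P>. A \<inter> maker_nbrs h' v \<noteq> {})) h"
proof -
  let ?P1 = "\<lambda>M. k \<le> card {\<tau>\<in>Y. H \<tau> \<subseteq> M}" and ?P2 = "\<lambda>M. \<forall>A\<in>\<P>. A \<inter> M \<noteq> {}"
  let ?P = "\<lambda>M. (\<exists>A\<subseteq>M. ?P1 A) \<and> (\<exists>A\<subseteq>M. ?P2 A)"
  have w1: "board_win ?P1 {} X" using pot by (rule board_win_potential)
  have w2: "board_win ?P2 {} (\<Union>\<P>)" using pair by (rule board_win_pairing)
  have w: "board_win ?P ({} \<union> {}) (X \<union> \<Union>\<P>)"
    using pot(2) pair(1) w1 w2 disj(1) by (rule board_win_sum)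
  have f: "force E0 (Suc (card (X \<union> \<Union>\<P>)))
    (\<lambda>h'. {{v, c}} \<subseteq> maker_moves h' \<and> (\<exists>M'. ?P M' \<and> (\<lambda>x. {v, x}) ` M' \<subseteq> maker_moves h')) h"
  proof (rule board_win_force[OF infinite_E0 h _ _ _ _ w])
    show "finite (X \<union> \<Union>\<P>)" using pot(2) pair(1) by simp
    show "{v, c} \<in> E0 - set h" using v c by (auto simp: E0_iff)
    show "(\<lambda>x. {v, x}) ` (X \<union> \<Union>\<P>) \<subseteq> E0 - set h - {{v, c}}"
    proof (rule image_subsetI)
      fix x assume x: "x \<in> X \<union> \<Union>\<P>"
      then have "x \<noteq> v" "x \<noteq> c" using disj by auto
      then show "{v, x} \<in> E0 - set h - {{v, c}}" using v by (auto simp: E0_iff doubleton_eq_iff)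
    qed
    show "inj_on (\<lambda>x. {v, x}) (X \<union> \<Union>\<P>)" by (auto simp: inj_on_def doubleton_eq_iff)
  qed auto
  show ?thesis
  proof (rule force_mono[OF f])
    fix h' assume a: "{{v, c}} \<subseteq> maker_moves h' \<and> (\<exists>M'. ?P M' \<and> (\<lambda>x. {v, x}) ` M' \<subseteq> maker_moves h')"
    then obtain M' A B where M: "(\<lambda>x. {v, x}) ` M' \<subseteq> maker_moves h'" "A \<subseteq> M'" "?P1 A" "B \<subseteq> M'" "?P2 B"
      by meson
    have M': "M' \<subseteq> maker_nbrs h' v" using M(1) by (auto simp: maker_nbrs_def)
    have "card {\<tau>\<in>Y. H \<tau> \<subseteq> A} \<le> card {\<tau>\<in>Y. H \<tau> \<subseteq> maker_nbrs h' v}"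
      using pot(1) M' M(2) by (intro card_mono) auto
    then have "k \<le> card {\<tau>\<in>Y. H \<tau> \<subseteq> maker_nbrs h' v}" using M(3) by linarith
    moreover have "\<forall>A\<in>\<P>. A \<inter> maker_nbrs h' v \<noteq> {}" using M(4,5) M' by fast
    ultimately show "c \<in> maker_nbrs h' v \<and> k \<le> card {\<tau>\<in>Y. H \<tau> \<subseteq> maker_nbrs h' v} \<and> (\<forall>A\<in>\<P>. A \<inter> maker_nbrs h' v \<noteq> {})"
      using a by (simp add: maker_nbrs_def)
  qed
qed

section \<open>Descents in finite trees and least visited choices\<close>

lemma walk:
  fixes W :: "'a list set"
  assumes "finite W" "[] \<in> W" "\<And>p. p \<in> W \<Longrightarrow> des p = {} \<or> (\<exists>x\<in>des p. x \<in> M \<and> p @ [x] \<in> W)"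
  shows "\<exists>p\<in>W. des p = {} \<and> (\<forall>i<length p. p ! i \<in> M \<and> p ! i \<in> des (take i p) \<and> take i p \<in> W)"
proof -
  \<comment> \<open>\<open>G\<close> consists of the lists that follow \<open>des\<close> inside
    \<open>M\<close>. A longest one cannot be extended, so \<open>des\<close> is empty at its
    end.\<close>
  define G where "G = {p\<in>W. \<forall>i<length p. p ! i \<in> M \<and> p ! i \<in> des (take i p) \<and> take i p \<in> W}"
  have G: "finite G" "[] \<in> G" using assms(1,2) by (auto simp: G_def)
  have "finite (length ` G)" "length ` G \<noteq> {}" using G by auto
  then have "Max (length ` G) \<in> length ` G" by (rule Max_in)
  then obtain p where p: "p \<in> G" "Max (length ` G) = length p" by blast
  have mx: "length p' \<le> length p" if "p' \<in> G" for p'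
    unfolding p(2)[symmetric] using that G(1) by simp
  have "des p = {}"
  proof (rule ccontr)
    assume "des p \<noteq> {}"
    then obtain x where x: "x \<in> des p" "x \<in> M" "p @ [x] \<in> W" using assms(3) p(1) by (auto simp: G_def)
    have "\<forall>i<length (p @ [x]). (p @ [x]) ! i \<in> M \<and> (p @ [x]) ! i \<in> des (take i (p @ [x])) \<and>
        take i (p @ [x]) \<in> W"
    proof (intro allI impI)
      fix i assume "i < length (p @ [x])"
      then consider "i < length p" | "i = length p" by fastforce
      then show "(p @ [x]) ! i \<in> M \<and> (p @ [x]) ! i \<in> des (take i (p @ [x])) \<and> take i (p @ [x]) \<in> W"
        using p(1) x by cases (auto simp: G_def nth_append)
    qed
    then have "p @ [x] \<in> G" using x(3) by (simp add: G_def)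
    from mx[OF this] show False by simp
  qed
  then show ?thesis using p(1) by (auto simp: G_def)
qed

lemma least_subset:
  fixes f :: "'a \<Rightarrow> nat"
  assumes "finite X" "m \<le> card X"
  shows "\<exists>Y\<subseteq>X. card Y = m \<and> (\<forall>y\<in>Y. \<forall>z\<in>X - Y. f y \<le> f z)"
  using assms(2)
proof (induction m)
  case (Suc m)
  then obtain Y where Y: "Y \<subseteq> X" "card Y = m" "\<forall>y\<in>Y. \<forall>z\<in>X - Y. f y \<le> f z" by auto
  have fY: "finite Y" using Y(1) assms(1) finite_subset by blast
  have "X - Y \<noteq> {}" using Suc.prems Y fY by (metis Diff_eq_empty_iff card_mono not_less_eq_eq)
  then obtain x where x: "x \<in> X - Y" "\<And>z. z \<in> X - Y \<Longrightarrow> f x \<le> f z"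
    using assms(1) arg_min_if_finite[of "X - Y" f] by (metis finite_Diff not_less)
  show ?case
  proof (intro exI[of _ "insert x Y"] conjI ballI)
    show "insert x Y \<subseteq> X" using x(1) Y(1) by blast
    show "card (insert x Y) = Suc m" using x(1) fY Y(2) by simp
    fix y z assume "y \<in> insert x Y" "z \<in> X - insert x Y"
    then show "f y \<le> f z" using x(2) Y(3) by auto
  qed
qed auto

text \<open>\<open>W x\<close> is the set of times at which \<open>x\<close> is visited. If
  \<open>m\<close> elements were starved, then from some time on a least visited set of size
  \<open>m\<close> would consist of starved elements only, although one of its members is visited at
  that late time.\<close>

lemma fair_choice:
  fixes W :: "'a \<Rightarrow> nat set"
  assumes X: "finite X" and I: "infinite I"
    and children: "\<And>r. r \<in> I \<Longrightarrow> \<exists>Y\<subseteq>X. card Y = m \<and>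
      (\<forall>y\<in>Y. \<forall>z\<in>X - Y. card (W y \<inter> {..<r}) \<le> card (W z \<inter> {..<r})) \<and> (\<exists>y\<in>Y. r \<in> W y)"
  shows "card {x\<in>X. finite (W x)} < m"
proof (rule ccontr)
  define F where "F = {x\<in>X. finite (W x)}"
  assume "\<not> card {x\<in>X. finite (W x)} < m"
  then have F: "m \<le> card F" by (simp add: F_def)
  have fF: "finite F" using X by (simp add: F_def)
  have "\<forall>\<^sub>F r in sequentially. \<forall>x\<in>F. W x \<subseteq> {..<r}"
    unfolding eventually_ball_finite_distrib[OF fF]
  proof
    fix x assume "x \<in> F"
    then have "finite (W x)" by (simp add: F_def)
    then obtain b where b: "\<forall>y\<in>W x. y < b" using finite_nat_set_iff_bounded by blast
    show "\<forall>\<^sub>F r in sequentially. W x \<subseteq> {..<r}"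
      using eventually_ge_at_top[of b] by eventually_elim (use b in force)
  qed
  \<comment> \<open>The sum bounds the total number of visits to every starved element at
    once.\<close>
  moreover have "\<forall>\<^sub>F r in sequentially. \<forall>z\<in>X - F. (\<Sum>x\<in>F. card (W x)) < card (W z \<inter> {..<r})"
  proof (subst eventually_ball_finite_distrib)
    show "finite (X - F)" using X by simp
    show "\<forall>z\<in>X - F. \<forall>\<^sub>F r in sequentially. (\<Sum>x\<in>F. card (W x)) < card (W z \<inter> {..<r})"
    proof
      fix z assume "z \<in> X - F"
      then have "infinite (W z)" by (simp add: F_def)
      then obtain B where B: "finite B" "card B = Suc (\<Sum>x\<in>F. card (W x))" "B \<subseteq> W z"
        using infinite_arbitrarily_large by blast
      obtain b where b: "\<forall>y\<in>B. y < b" using B(1) finite_nat_set_iff_bounded by blast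
      show "\<forall>\<^sub>F r in sequentially. (\<Sum>x\<in>F. card (W x)) < card (W z \<inter> {..<r})"
        using eventually_ge_at_top[of b]
      proof eventually_elim
        case (elim r)
        then have "B \<subseteq> W z \<inter> {..<r}" using B(3) b by force
        then have "card B \<le> card (W z \<inter> {..<r})" by (intro card_mono) auto
        then show ?case using B(2) by simp
      qed
    qed
  qed
  ultimately have "\<forall>\<^sub>F r in sequentially. (\<forall>x\<in>F. W x \<subseteq> {..<r}) \<and>
      (\<forall>z\<in>X - F. (\<Sum>x\<in>F. card (W x)) < card (W z \<inter> {..<r}))"
    by (rule eventually_conj)
  then obtain r0 where r0: "\<And>r. r \<ge> r0 \<Longrightarrow> (\<forall>x\<in>F. W x \<subseteq> {..<r}) \<and>
      (\<forall>z\<in>X - F. (\<Sum>x\<in>F. card (W x)) < card (W z \<inter> {..<r}))"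
    unfolding eventually_sequentially by blast
  obtain r where r: "r \<in> I" "r \<ge> r0" using I by (metis infinite_nat_iff_unbounded_le)
  from children[OF r(1)] obtain Y where Y: "Y \<subseteq> X" "card Y = m"
    "\<forall>y\<in>Y. \<forall>z\<in>X - Y. card (W y \<inter> {..<r}) \<le> card (W z \<inter> {..<r})" "\<exists>y\<in>Y. r \<in> W y" by blast
  have fY: "finite Y" using Y(1) X finite_subset by blast
  \<comment> \<open>Since \<open>F\<close> has at least \<open>card Y\<close> elements, a member
    \<open>y\<close> of \<open>Y\<close> outside \<open>F\<close> would leave some starved
    \<open>z\<close> outside \<open>Y\<close>; but by now \<open>z\<close> has fewer visits than
    \<open>y\<close>.\<close>
  have "Y \<subseteq> F"
  proof
    fix y assume y: "y \<in> Y"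
    show "y \<in> F"
    proof (rule ccontr)
      assume nF: "y \<notin> F"
      have "\<not> F \<subseteq> Y"
      proof
        assume "F \<subseteq> Y"
        then have "F \<subset> Y" using y nF by blast
        then have "card F < card Y" using fY by (rule psubset_card_mono[rotated])
        then show False using F Y(2) by simp
      qed
      then obtain z where z: "z \<in> F" "z \<notin> Y" by blast
      then have "card (W y \<inter> {..<r}) \<le> card (W z \<inter> {..<r})" using Y(3) y by (auto simp: F_def)
      also have "\<dots> \<le> card (W z)" using z(1) by (intro card_mono) (auto simp: F_def)
      also have "\<dots> \<le> (\<Sum>x\<in>F. card (W x))" using z(1) fF by (intro member_le_sum) auto
      also have "\<dots> < card (W y \<inter> {..<r})" using r0[OF r(2)] y nF Y(1) by blast
      finally show False by simp
    qed
  qed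
  then show False using Y(4) r0[OF r(2)] by blast
qed

section \<open>Cliques of centres\<close>

lemma card_doubletons_le:
  assumes "finite A"
  shows "card {e. \<exists>x\<in>A. \<exists>y\<in>A. e = {x, y}} \<le> card A * card A"
proof -
  have "{e. \<exists>x\<in>A. \<exists>y\<in>A. e = {x, y}} = (\<lambda>(x, y). {x, y}) ` (A \<times> A)" by auto
  then show ?thesis
    using assms card_image_le[of "A \<times> A" "\<lambda>(x, y). {x, y}"] by (simp add: card_cartesian_product)
qed

definition clique :: "nat set set \<Rightarrow> nat set \<Rightarrow> bool" where
  "clique M V \<longleftrightarrow> (\<forall>x\<in>V. \<forall>y\<in>V. x \<noteq> y \<longrightarrow> {x, y} \<in> M)"

lemma clique_insert:
  "clique M V \<Longrightarrow> (\<And>x. x \<in> V \<Longrightarrow> x \<noteq> v \<Longrightarrow> {v, x} \<in> M) \<Longrightarrow> clique M (insert v V)"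
  unfolding clique_def by (auto simp: insert_commute)

lemma clique_mono: "clique M V \<Longrightarrow> M \<subseteq> M' \<Longrightarrow> V' \<subseteq> V \<Longrightarrow> clique M' V'"
  unfolding clique_def by blast

text \<open>Kinds below \<open>s\<close> are the forests of infinite stars, the other kinds the
  families of finite stars. \<open>num_clique\<close> makes at least a
  \<open>1 / 2 ^ (s * s + 1)\<close> share of all tuples cliques of Maker. With an
  \<open>(s + t)\<close>-th of those on offer, \<open>num_leaf\<close> pays for one potential game
  on the tuples through a given centre, and \<open>num_star\<close> for two games in succession, one
  for a star centre and one for each of its leaves.\<close>

locale star_game =
  fixes s t n :: nat and Ctr :: "nat \<Rightarrow> nat set" and Lf :: "nat \<Rightarrow> nat set"
  assumes kinds: "0 < s + t"
    and fin_ctr: "\<And>\<kappa>. \<kappa> < s \<Longrightarrow> finite (Ctr \<kappa>)"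
    and card_ctr: "\<And>\<kappa>. \<kappa> < s \<Longrightarrow> card (Ctr \<kappa>) = n"
    and inf_lf: "\<And>\<kappa> a. \<kappa> < s \<Longrightarrow> a \<in> Ctr \<kappa> \<Longrightarrow> infinite (Lf a)"
    and fin_lf: "\<And>\<kappa> a. s \<le> \<kappa> \<Longrightarrow> \<kappa> < s + t \<Longrightarrow> a \<in> Ctr \<kappa> \<Longrightarrow> finite (Lf a)"
    and big_lf: "\<And>\<kappa> Z. s \<le> \<kappa> \<Longrightarrow> \<kappa> < s + t \<Longrightarrow> infinite {a \<in> Ctr \<kappa>. Z \<le> card (Lf a)}"
    and ctr_disj: "\<And>\<kappa> \<kappa>'. \<kappa> < s + t \<Longrightarrow> \<kappa>' < s + t \<Longrightarrow> \<kappa> \<noteq> \<kappa>' \<Longrightarrow> Ctr \<kappa> \<inter> Ctr \<kappa>' = {}"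
    and lf_disj: "\<And>\<kappa> \<kappa>' a b. \<kappa> < s + t \<Longrightarrow> \<kappa>' < s + t \<Longrightarrow> a \<in> Ctr \<kappa> \<Longrightarrow> b \<in> Ctr \<kappa>' \<Longrightarrow>
      a \<noteq> b \<Longrightarrow> Lf a \<inter> Lf b = {}"
    and lf_ctr: "\<And>\<kappa> \<kappa>' a. \<kappa> < s + t \<Longrightarrow> \<kappa>' < s + t \<Longrightarrow> a \<in> Ctr \<kappa> \<Longrightarrow> Lf a \<inter> Ctr \<kappa>' = {}"
    and num_clique: "real (s * s + 1) * 2 ^ (s * s + 1) \<le> real n"
    and num_leaf: "0 < s \<Longrightarrow> real ((s + 1) * (s + t)) * 2 ^ (s * s + s) < real n"
    and num_star: "0 < t \<Longrightarrow> real ((s + 1) * (s + t)) * 2 ^ (s * s + 2 * s + 2) < real n"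
begin

definition centres :: "nat set" where "centres = (\<Union>i<s. Ctr i)"

definition Tup :: "(nat \<Rightarrow> nat) set" where "Tup = Pi\<^sub>E {..<s} Ctr"

lemma finite_CC: "finite centres" by (simp add: centres_def fin_ctr)

lemma card_CC: "card centres \<le> s * n"
proof -
  have "card centres \<le> (\<Sum>i<s. card (Ctr i))" unfolding centres_def by (rule card_UN_le) simp
  also have "\<dots> = s * n" by (simp add: card_ctr)
  finally show ?thesis .
qed

lemma finite_Tup: "finite Tup" unfolding Tup_def by (rule finite_PiE) (auto simp: fin_ctr)

lemma card_Tup: "card Tup = n ^ s" unfolding Tup_def by (simp add: card_PiE card_ctr)

lemma n_pos: "0 < n"
proof -
  have "0 < real (s * s + 1)" by (simp only: of_nat_0_less_iff)
  then have "0 < real (s * s + 1) * 2 ^ (s * s + 1)" by (rule mult_pos_pos) simp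
  then have "0 < real n" using num_clique by linarith
  then show ?thesis by simp
qed

lemma Tup_ctr: "\<tau> \<in> Tup \<Longrightarrow> i < s \<Longrightarrow> \<tau> i \<in> Ctr i" unfolding Tup_def by auto

lemma Tup_CC: "\<tau> \<in> Tup \<Longrightarrow> \<tau> ` {..<s} \<subseteq> centres" unfolding centres_def using Tup_ctr by blast

lemma ctr_unique: "x \<in> Ctr i \<Longrightarrow> x \<in> Ctr j \<Longrightarrow> i < s + t \<Longrightarrow> j < s + t \<Longrightarrow> i = j"
  using ctr_disj[of i j] by blast

lemma Tup_inj: "\<tau> \<in> Tup \<Longrightarrow> inj_on \<tau> {..<s}"
proof (rule inj_onI)
  fix i j assume a: "\<tau> \<in> Tup" "i \<in> {..<s}" "j \<in> {..<s}" "\<tau> i = \<tau> j"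
  then have "\<tau> i \<in> Ctr i" "\<tau> i \<in> Ctr j" using Tup_ctr[of \<tau> i] Tup_ctr[of \<tau> j] by auto
  then show "i = j" by (rule ctr_unique) (use a in auto)
qed

text \<open>The sets of centres are disjoint for different kinds, so each element of
  \<open>W\<close> prescribes one coordinate of its own.\<close>

lemma Tup_count:
  "card {\<tau> \<in> Tup. W \<subseteq> \<tau> ` {..<s}} \<le> real (n ^ s) / real n ^ card W"
proof (cases "\<exists>\<tau>\<in>Tup. W \<subseteq> \<tau> ` {..<s}")
  case False
  then have *: "{\<tau> \<in> Tup. W \<subseteq> \<tau> ` {..<s}} = {}" by blast
  show ?thesis unfolding * by simp
next
  case True
  then obtain \<tau>0 where t0: "\<tau>0 \<in> Tup" "W \<subseteq> \<tau>0 ` {..<s}" by blast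
  define I where "I = {i. i < s \<and> \<tau>0 i \<in> W}"
  have W: "W = \<tau>0 ` I" using t0(2) by (auto simp: I_def)
  have I: "I \<subseteq> {..<s}" by (auto simp: I_def)
  have fI: "finite I" using I finite_subset by blast
  have cW: "card W = card I" unfolding W
    by (rule card_image) (use Tup_inj[OF t0(1)] I inj_on_subset in blast)
  have cI: "card I \<le> s" using card_mono[OF _ I] by simp
  let ?P = "Pi\<^sub>E {..<s} (\<lambda>i. if i \<in> I then {\<tau>0 i} else Ctr i)"
  have "{\<tau> \<in> Tup. W \<subseteq> \<tau> ` {..<s}} \<subseteq> ?P"
  proof
    fix \<tau> assume "\<tau> \<in> {\<tau> \<in> Tup. W \<subseteq> \<tau> ` {..<s}}"
    then have t: "\<tau> \<in> Tup" "W \<subseteq> \<tau> ` {..<s}" by auto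
    have "\<tau> i = \<tau>0 i" if "i \<in> I" for i
    proof -
      have i: "i < s" "\<tau>0 i \<in> W" using that by (auto simp: I_def)
      then obtain j where j: "j < s" "\<tau>0 i = \<tau> j" using t(2) by auto
      then have "i = j" using Tup_ctr[OF t0(1) i(1)] Tup_ctr[OF t(1) j(1)] i(1) j(1)
          ctr_unique[of "\<tau> j" i j] by simp
      then show ?thesis using j by simp
    qed
    then show "\<tau> \<in> ?P" using t(1) unfolding Tup_def by (auto simp: PiE_iff)
  qed
  moreover have "finite ?P" by (rule finite_PiE) (auto simp: fin_ctr)
  ultimately have "card {\<tau> \<in> Tup. W \<subseteq> \<tau> ` {..<s}} \<le> card ?P" by (rule card_mono[rotated])
  also have "card ?P = (\<Prod>i<s. if i \<in> I then 1 else n)"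
    by (subst card_PiE) (auto intro!: prod.cong simp: card_ctr)
  also have "\<dots> = n ^ card ({..<s} - I)"
    by (simp add: prod.If_cases Diff_eq Compl_eq)
  also have "\<dots> = n ^ (s - card I)" using I fI by (simp add: card_Diff_subset)
  finally have "card {\<tau> \<in> Tup. W \<subseteq> \<tau> ` {..<s}} \<le> real (n ^ (s - card I))" by (simp only: of_nat_le_iff)
  also have "\<dots> = real (n ^ s) / real n ^ card W"
    unfolding of_nat_power cW using power_diff[of "real n" "card I" s] cI n_pos by simp
  finally show ?thesis .
qed

lemma Tup_count_le:
  assumes "Y \<subseteq> Tup" "\<And>\<tau>. \<tau> \<in> Y \<Longrightarrow> Q \<tau> \<Longrightarrow> W \<subseteq> \<tau> ` {..<s}" "k \<le> card W"
  shows "card {\<tau> \<in> Y. Q \<tau>} \<le> real (n ^ s) / real n ^ k"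
proof -
  have "card {\<tau> \<in> Y. Q \<tau>} \<le> card {\<tau> \<in> Tup. W \<subseteq> \<tau> ` {..<s}}"
    using assms(1,2) finite_Tup by (intro card_mono) auto
  also have "\<dots> \<le> real (n ^ s) / real n ^ card W" by (rule Tup_count)
  also have "\<dots> \<le> real (n ^ s) / real n ^ k"
    using assms(3) n_pos by (intro divide_left_mono power_increasing) auto
  finally show ?thesis by simp
qed

text \<open>An edge prescribes two coordinates and two edges at least three, which bounds the
  degrees by \<open>n ^ s / n ^ 2\<close> and \<open>n ^ s / n ^ 3\<close>. The board has at most
  \<open>(s * n) * (s * n)\<close> edges, so the loss is at most
  \<open>(s * s + 1) * n ^ s / n\<close>, and \<open>num_clique\<close> makes this at most half of
  \<open>n ^ s / 2 ^ (s * s)\<close>. The conjunct \<open>h \<noteq> []\<close> is what makes the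
  position a checkpoint later than the start.\<close>

lemma force_many_cliques:
  "\<exists>N. force E0 N (\<lambda>h. h \<noteq> [] \<and> (\<exists>T\<subseteq>Tup. real (n ^ s) / 2 ^ (s * s + 1) \<le> card T \<and>
     (\<forall>\<tau>\<in>T. clique (maker_moves h) (\<tau> ` {..<s})))) []"
proof -
  define H where "H \<tau> = {e. \<exists>i j. i < s \<and> j < s \<and> i \<noteq> j \<and> e = {\<tau> i, \<tau> j}}" for \<tau> :: "nat \<Rightarrow> nat"
  define X where "X = (\<Union>\<tau>\<in>Tup. H \<tau>)"
  define k where "k = real (n ^ s) / 2 ^ (s * s + 1)"
  have HX: "H \<tau> \<subseteq> {e. \<exists>x\<in>\<tau> ` {..<s}. \<exists>y\<in>\<tau> ` {..<s}. e = {x, y}}" for \<tau>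
    unfolding H_def by blast
  have cH: "card (H \<tau>) \<le> s * s" for \<tau>
  proof -
    have "finite {e. \<exists>x\<in>\<tau> ` {..<s}. \<exists>y\<in>\<tau> ` {..<s}. e = {x, y}}"
      by (rule finite_subset[of _ "Pow (\<tau> ` {..<s})"]) auto
    from card_mono[OF this HX[of \<tau>]]
    have "card (H \<tau>) \<le> card (\<tau> ` {..<s}) * card (\<tau> ` {..<s})"
      using card_doubletons_le[of "\<tau> ` {..<s}"] by simp
    also have "\<dots> \<le> s * s" using card_image_le[of "{..<s}" \<tau>] by (intro mult_le_mono) auto
    finally show ?thesis .
  qed
  have XC: "X \<subseteq> {e. \<exists>x\<in>centres. \<exists>y\<in>centres. e = {x, y}}"
  proof
    fix e assume "e \<in> X"
    then obtain \<tau> where t: "\<tau> \<in> Tup" "e \<in> H \<tau>" unfolding X_def by blast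
    then show "e \<in> {e. \<exists>x\<in>centres. \<exists>y\<in>centres. e = {x, y}}" using HX[of \<tau>] Tup_CC[OF t(1)] by blast
  qed
  have fD: "finite {e. \<exists>x\<in>centres. \<exists>y\<in>centres. e = {x, y}}"
    by (rule finite_subset[of _ "Pow centres"]) (auto simp: finite_CC)
  have fX: "finite X" using XC fD finite_subset by blast
  have "card X \<le> card centres * card centres"
    using card_mono[OF fD XC] card_doubletons_le[OF finite_CC] by linarith
  also have "\<dots> \<le> (s * n) * (s * n)" using card_CC by (intro mult_le_mono) auto
  finally have cX: "card X \<le> (s * n) * (s * n)" .
  have e2: "card e = 2 \<and> e \<subseteq> \<tau> ` {..<s}" if te: "\<tau> \<in> Tup" "e \<in> H \<tau>" for \<tau> e
  proof -
    obtain i j where ij: "i < s" "j < s" "i \<noteq> j" "e = {\<tau> i, \<tau> j}" using te(2) unfolding H_def by blast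
    then have "\<tau> i \<noteq> \<tau> j" using Tup_inj[OF te(1)] by (auto dest: inj_onD)
    then show ?thesis using ij by simp
  qed
  have XE: "X \<subseteq> E0"
  proof
    fix e assume "e \<in> X"
    then have "card e = 2" using e2 unfolding X_def by blast
    then obtain x y where "e = {x, y}" "x \<noteq> y" by (auto simp: card_2_iff)
    then show "e \<in> E0" by (simp add: E0_iff)
  qed
  let ?D1 = "real (n ^ s) / real n ^ 2" and ?D2 = "real (n ^ s) / real n ^ 3"
  have w: "board_win (\<lambda>M. k \<le> card {\<tau>\<in>Tup. H \<tau> \<subseteq> M}) {} X"
  proof (rule board_win_potential[of Tup X H "s * s" ?D1 ?D2])
    show "finite Tup" by (rule finite_Tup)
    show "finite X" by (rule fX)
    show "H \<tau> \<subseteq> X \<and> card (H \<tau>) \<le> s * s" if "\<tau> \<in> Tup" for \<tau> using cH that unfolding X_def by blast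
    show "card {\<tau> \<in> Tup. x \<in> H \<tau>} \<le> ?D1" if "x \<in> X" for x
      by (rule Tup_count_le[where W = x]) (use e2 that X_def in auto)
    show "card {\<tau> \<in> Tup. x \<in> H \<tau> \<and> y \<in> H \<tau>} \<le> ?D2" if xy: "x \<in> X" "y \<in> X" "x \<noteq> y" for x y
    proof (rule Tup_count_le[where W = "x \<union> y"])
      have c: "card x = 2" "card y = 2" using xy(1,2) e2 by (auto simp: X_def)
      then have f: "finite x" "finite y" using card_ge_0_finite[of x] card_ge_0_finite[of y] by auto
      have "\<not> y \<subseteq> x" using c f xy(3) by (metis card_subset_eq)
      then have "x \<subset> x \<union> y" by blast
      then have "card x < card (x \<union> y)" using f by (intro psubset_card_mono) auto
      then show "3 \<le> card (x \<union> y)" using c by simp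
    qed (use e2 in auto)
    have "real (s * s) / real n + 1 / real n ^ 2 \<le> real (s * s + 1) / real n"
    proof -
      have "1 / real n ^ 2 \<le> 1 / real n" using n_pos by (simp add: power2_eq_square divide_simps)
      then show ?thesis by (simp add: add_divide_distrib)
    qed
    also have "\<dots> \<le> 1 / 2 ^ (s * s + 1)"
      using num_clique n_pos by (simp add: divide_simps mult.commute)
    finally have q: "real (s * s) / real n + 1 / real n ^ 2 \<le> 1 / 2 ^ (s * s + 1)" .
    have "?D2 * card X \<le> ?D2 * ((s * n) * (s * n))"
      by (intro mult_left_mono) (use cX in \<open>simp_all only: of_nat_le_iff\<close>, simp)
    also have "\<dots> = real (n ^ s) * (real (s * s) / real n)"
      using n_pos by (simp add: divide_simps power2_eq_square power3_eq_cube)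
    finally have "?D1 + ?D2 * card X \<le> real (n ^ s) * (real (s * s) / real n + 1 / real n ^ 2)"
      by (simp add: distrib_left)
    also have "\<dots> \<le> real (n ^ s) * (1 / 2 ^ (s * s + 1))" using q by (intro mult_left_mono) auto
    finally show "k \<le> card Tup / 2 ^ (s * s) - ?D1 - ?D2 * card X"
      unfolding k_def card_Tup by (simp add: field_simps)
  qed simp_all
  \<comment> \<open>An opening move off the board lets Breaker move first on it, and gives a
    nonempty history even if the board is empty.\<close>
  have "infinite (E0 - X)" using infinite_E0 fX by simp
  then obtain e0 where e0: "e0 \<in> E0 - X" by (metis ex_in_conv finite.emptyI)
  have "force E0 (Suc (card X)) (\<lambda>h. {e0} \<subseteq> maker_moves h \<and> (\<exists>M'. k \<le> card {\<tau>\<in>Tup. H \<tau> \<subseteq> M'} \<and> id ` M' \<subseteq> maker_moves h)) []"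
    by (rule board_win_force[OF infinite_E0 _ fX, of "[]" e0 id]) (use w e0 XE in \<open>auto simp: legal_def\<close>)
  then have "force E0 (Suc (card X)) (\<lambda>h. h \<noteq> [] \<and> (\<exists>T\<subseteq>Tup. k \<le> card T \<and> (\<forall>\<tau>\<in>T. clique (maker_moves h) (\<tau> ` {..<s})))) []"
  proof (rule force_mono)
    fix h assume "{e0} \<subseteq> maker_moves h \<and> (\<exists>M'. k \<le> card {\<tau>\<in>Tup. H \<tau> \<subseteq> M'} \<and> id ` M' \<subseteq> maker_moves h)"
    then obtain M' where M: "k \<le> card {\<tau>\<in>Tup. H \<tau> \<subseteq> M'}" "M' \<subseteq> maker_moves h" "e0 \<in> maker_moves h" by auto
    have "h \<noteq> []" using M(3) by (auto simp: maker_moves_def)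
    moreover have "\<exists>T\<subseteq>Tup. k \<le> card T \<and> (\<forall>\<tau>\<in>T. clique (maker_moves h) (\<tau> ` {..<s}))"
    proof (intro exI[of _ "{\<tau>\<in>Tup. H \<tau> \<subseteq> M'}"] conjI ballI M(1))
      fix \<tau> assume t: "\<tau> \<in> {\<tau> \<in> Tup. H \<tau> \<subseteq> M'}"
      show "clique (maker_moves h) (\<tau> ` {..<s})"
        unfolding clique_def
      proof (intro ballI impI)
        fix x y assume "x \<in> \<tau> ` {..<s}" "y \<in> \<tau> ` {..<s}" "x \<noteq> y"
        then have "{x, y} \<in> H \<tau>" unfolding H_def by blast
        then show "{x, y} \<in> maker_moves h" using t M(2) by blast
      qed
    qed auto
    ultimately show "h \<noteq> [] \<and> (\<exists>T\<subseteq>Tup. k \<le> card T \<and> (\<forall>\<tau>\<in>T. clique (maker_moves h) (\<tau> ` {..<s})))" by blast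
  qed
  then show ?thesis unfolding k_def by blast
qed

end

section \<open>Trees of cliques\<close>

type_synonym node = "(nat \<Rightarrow> nat) \<times> nat list"

text \<open>Polymorphic in the root, because it serves both the trees over tuples and the local
  trees whose roots are nodes.\<close>

definition children :: "('t \<times> nat list) set \<Rightarrow> 't \<times> nat list \<Rightarrow> nat set" where
  "children T u = {x. (fst u, snd u @ [x]) \<in> T}"

lemma finite_ch:
  assumes "finite T"
  shows "finite (children T u)"
proof -
  have "children T u \<subseteq> (\<lambda>v. last (snd v)) ` T"
  proof
    fix x assume "x \<in> children T u"
    then have "(fst u, snd u @ [x]) \<in> T" by (simp add: children_def)
    from imageI[OF this, of "\<lambda>v. last (snd v)"] show "x \<in> (\<lambda>v. last (snd v)) ` T" by simp
  qed
  then show ?thesis using assms finite_subset by blast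
qed

lemma prefix_closed_take:
  assumes "\<And>p x. p @ [x] \<in> W \<Longrightarrow> p \<in> W" "p \<in> W"
  shows "take i p \<in> W"
  using assms(2)
proof (induction p rule: rev_induct)
  case (snoc x p)
  show ?case
  proof (cases "i \<le> length p")
    case True
    then show ?thesis using snoc assms(1) by simp
  next
    case False
    then show ?thesis using snoc by simp
  qed
qed simp

lemma prefix_closed_nth:
  assumes "\<And>p x. p @ [x] \<in> W \<Longrightarrow> p \<in> W" "p \<in> W" "i < length p"
  shows "take i p @ [p ! i] \<in> W"
  using prefix_closed_take[OF assms(1,2), where i = "Suc i"] assms(3) by (simp add: take_Suc_conv_app_nth)

text \<open>A label repeated on a branch would have two prefixes of different lengths as its
  parents.\<close>

lemma labels_unique_distinct:
  assumes cl: "\<And>p x. p @ [x] \<in> W \<Longrightarrow> p \<in> W" and p: "p \<in> W"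
    and un: "\<And>p p' x. p @ [x] \<in> W \<Longrightarrow> p' @ [x] \<in> W \<Longrightarrow> p = p'"
  shows "distinct p"
  unfolding distinct_conv_nth
proof (intro allI impI)
  fix i j assume ij: "i < length p" "j < length p" "i \<noteq> j"
  have t: "take i p @ [p ! i] \<in> W" "take j p @ [p ! j] \<in> W"
    using prefix_closed_nth[OF cl p] ij by auto
  show "p ! i \<noteq> p ! j"
  proof
    assume "p ! i = p ! j"
    then have "take i p = take j p" using un t by simp
    then have "length (take i p) = length (take j p)" by simp
    then show False using ij by simp
  qed
qed

lemma binary_tree_card:
  fixes W :: "'a list set"
  assumes "finite W" and cl: "\<And>p x. p @ [x] \<in> W \<Longrightarrow> p \<in> W" and "\<And>p. card {x. p @ [x] \<in> W} \<le> 2"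
    and len: "\<And>p. p \<in> W \<Longrightarrow> length p \<le> N"
  shows "card W \<le> 2 ^ Suc N"
proof -
  have lev: "card {p\<in>W. length p = l} \<le> 2 ^ l" for l
  proof (induction l)
    case 0
    have "card {p\<in>W. length p = 0} \<le> card {[] :: 'a list}" by (rule card_mono) auto
    then show ?case by simp
  next
    case (Suc l)
    have "{p\<in>W. length p = Suc l} \<subseteq> (\<Union>p\<in>{p\<in>W. length p = l}. (\<lambda>x. p @ [x]) ` {x. p @ [x] \<in> W})"
    proof
      fix p assume "p \<in> {p\<in>W. length p = Suc l}"
      then have p: "p \<in> W" "length p = Suc l" by auto
      then obtain p' x where px: "p = p' @ [x]" by (metis length_Suc_conv_rev)
      then have "p' \<in> {p\<in>W. length p = l}" "x \<in> {x. p' @ [x] \<in> W}" using p cl by auto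
      then show "p \<in> (\<Union>p\<in>{p\<in>W. length p = l}. (\<lambda>x. p @ [x]) ` {x. p @ [x] \<in> W})" using px by blast
    qed
    moreover have fin: "finite {x. p @ [x] \<in> W}" for p
    proof (rule finite_imageD[where f = "\<lambda>x. p @ [x]"])
      show "finite ((\<lambda>x. p @ [x]) ` {x. p @ [x] \<in> W})" by (rule finite_subset[OF _ assms(1)]) auto
    qed (simp add: inj_on_def)
    ultimately have "card {p\<in>W. length p = Suc l} \<le>
        card (\<Union>p\<in>{p\<in>W. length p = l}. (\<lambda>x. p @ [x]) ` {x. p @ [x] \<in> W})"
      using assms(1) by (intro card_mono) auto
    also have "\<dots> \<le> (\<Sum>p\<in>{p\<in>W. length p = l}. card ((\<lambda>x. p @ [x]) ` {x. p @ [x] \<in> W}))"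
      using assms(1) by (intro card_UN_le) auto
    also have "\<dots> \<le> (\<Sum>p\<in>{p\<in>W. length p = l}. 2)"
      by (rule sum_mono) (use card_image_le[OF fin] assms(3) le_trans in blast)
    also have "\<dots> \<le> 2 ^ Suc l" using Suc by simp
    finally show ?case .
  qed
  have "W = (\<Union>l\<in>{..N}. {p\<in>W. length p = l})" using len by auto
  then have "card W \<le> (\<Sum>l\<in>{..N}. card {p\<in>W. length p = l})"
    using card_UN_le[of "{..N}" "\<lambda>l. {p\<in>W. length p = l}"] by simp
  also have "\<dots> \<le> (\<Sum>l\<in>{..N}. 2 ^ l)" by (rule sum_mono) (rule lev)
  also have "\<dots> \<le> 2 ^ Suc N" by (induction N) auto
  finally show ?thesis .
qed

text \<open>The abstract tree has the lists over \<open>{..<q}\<close> of length at most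
  \<open>L\<close> as addresses. An injection \<open>f\<close> of the addresses into
  \<open>B\<close> supplies the labels, so no label occurs under two different parents.\<close>

lemma ary_tree:
  fixes B :: "'a set" and q L :: nat
  assumes "finite B" "card {p. set p \<subseteq> {..<q} \<and> length p \<le> L} \<le> card B"
  shows "\<exists>S. finite S \<and> [] \<in> S \<and> (\<forall>w x. w @ [x] \<in> S \<longrightarrow> w \<in> S) \<and>
    (\<forall>w w' x. w @ [x] \<in> S \<longrightarrow> w' @ [x] \<in> S \<longrightarrow> w = w') \<and>
    (\<forall>w\<in>S. set w \<subseteq> B \<and> length w \<le> L \<and> card {x. w @ [x] \<in> S} = (if length w < L then q else 0))"
proof -
  let ?P = "{p. set p \<subseteq> {..<q} \<and> length p \<le> L}"
  have fP: "finite ?P" by (rule finite_lists_length_le) simp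
  from card_le_inj[OF fP assms] obtain f where f: "inj_on f ?P" "f ` ?P \<subseteq> B"
    by (elim exE conjE)
  \<comment> \<open>The node with address \<open>p\<close> becomes the list of the labels of all
    nonempty prefixes of \<open>p\<close>.\<close>
  define path where "path p = map (\<lambda>i. f (take (Suc i) p)) [0..<length p]" for p
  have path0: "path [] = []" by (simp add: path_def)
  have pathS: "path (p @ [j]) = path p @ [f (p @ [j])]" for p j
  proof -
    have "map (\<lambda>i. f (take (Suc i) (p @ [j]))) [0..<length p] = map (\<lambda>i. f (take (Suc i) p)) [0..<length p]"
      by (rule map_cong) auto
    then show ?thesis by (simp add: path_def)
  qed
  have lenp: "length (path p) = length p" for p by (simp add: path_def)
  have pinj: "p = p'" if p: "p \<in> ?P" "p' \<in> ?P" and eq: "path p = path p'" for p p'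
  proof -
    have len: "length p = length p'" using arg_cong[OF eq, of length] unfolding lenp .
    show ?thesis
    proof (cases p rule: rev_cases)
      case Nil
      then show ?thesis using len by simp
    next
      case (snoc p1 j)
      then have "length p' = Suc (length p1)" using len by simp
      then obtain p1' j' where p': "p' = p1' @ [j']" by (metis length_Suc_conv_rev)
      have "f p = f p'" using eq unfolding snoc p' pathS by simp
      from inj_onD[OF f(1) this p] show ?thesis .
    qed
  qed
  have snocE: "\<exists>p j. w = path p \<and> x = f (p @ [j]) \<and> p @ [j] \<in> ?P \<and> p \<in> ?P" if "w @ [x] \<in> path ` ?P" for w x
  proof -
    obtain p where p: "p \<in> ?P" "w @ [x] = path p" using \<open>w @ [x] \<in> path ` ?P\<close> by blast
    then have "p \<noteq> []" using path0 by auto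
    then obtain p1 j where p1: "p = p1 @ [j]" using rev_exhaust by blast
    have "w = path p1" "x = f (p1 @ [j])" using p(2) unfolding p1 pathS by auto
    moreover have "p1 @ [j] \<in> ?P" "p1 \<in> ?P" using p(1) p1 by auto
    ultimately show ?thesis by blast
  qed
  show ?thesis
  proof (intro exI[of _ "path ` ?P"] conjI ballI allI impI)
    show "finite (path ` ?P)" using fP by simp
    show "[] \<in> path ` ?P" using path0 by (intro image_eqI[of _ _ "[]"]) auto
    show "w \<in> path ` ?P" if "w @ [x] \<in> path ` ?P" for w x
      using snocE[OF \<open>w @ [x] \<in> path ` ?P\<close>] by blast
    show "w = w'" if "w @ [x] \<in> path ` ?P" "w' @ [x] \<in> path ` ?P" for w w' x
    proof -
      obtain p j where 1: "w = path p" "x = f (p @ [j])" "p @ [j] \<in> ?P"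
        using snocE[OF \<open>w @ [x] \<in> path ` ?P\<close>] by blast
      obtain p' j' where 2: "w' = path p'" "x = f (p' @ [j'])" "p' @ [j'] \<in> ?P"
        using snocE[OF \<open>w' @ [x] \<in> path ` ?P\<close>] by blast
      have "p @ [j] = p' @ [j']" using inj_onD[OF f(1) _ 1(3) 2(3)] 1(2) 2(2) by simp
      then show ?thesis using 1 2 by simp
    qed
    fix w assume "w \<in> path ` ?P"
    then obtain p where p: "p \<in> ?P" "w = path p" by blast
    show "set w \<subseteq> B"
    proof
      fix x assume "x \<in> set w"
      then obtain i where i: "i < length p" "x = f (take (Suc i) p)" unfolding p(2) path_def by auto
      have "take (Suc i) p \<in> ?P" using p(1) set_take_subset[of "Suc i" p] by auto
      then show "x \<in> B" using f(2) i(2) by blast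
    qed
    show "length w \<le> L" using p by (simp add: lenp)
    have "{x. w @ [x] \<in> path ` ?P} = (\<lambda>j. f (p @ [j])) ` (if length p < L then {..<q} else {})"
    proof (intro set_eqI iffI)
      fix x assume "x \<in> {x. w @ [x] \<in> path ` ?P}"
      then have "w @ [x] \<in> path ` ?P" by simp
      then obtain p' j where 1: "w = path p'" "x = f (p' @ [j])" "p' @ [j] \<in> ?P" "p' \<in> ?P"
        using snocE by blast
      then have "p' = p" using pinj[OF _ p(1)] p(2) by blast
      then show "x \<in> (\<lambda>j. f (p @ [j])) ` (if length p < L then {..<q} else {})" using 1 by auto
    next
      fix x assume "x \<in> (\<lambda>j. f (p @ [j])) ` (if length p < L then {..<q} else {})"
      then obtain j where j: "length p < L" "j < q" "x = f (p @ [j])" by (auto split: if_splits)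
      have "p @ [j] \<in> ?P" using j p(1) by auto
      from imageI[OF this, of path] show "x \<in> {x. w @ [x] \<in> path ` ?P}"
        unfolding pathS j(3) p(2) by simp
    qed
    moreover have "inj_on (\<lambda>j. f (p @ [j])) (if length p < L then {..<q} else {})"
    proof (rule inj_onI)
      fix i j assume a: "i \<in> (if length p < L then {..<q} else {})" "j \<in> (if length p < L then {..<q} else {})"
        "f (p @ [i]) = f (p @ [j])"
      then have "p @ [i] \<in> ?P" "p @ [j] \<in> ?P" using p(1) by (auto split: if_splits)
      from inj_onD[OF f(1) a(3) this] show "i = j" by simp
    qed
    ultimately show "card {x. w @ [x] \<in> path ` ?P} = (if length w < L then q else 0)"
      by (simp add: card_image lenp p(2))
  qed
qed

section \<open>The order of kinds along a branch and the invariant of the tree\<close>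

context star_game begin

text \<open>A branch of a tree is cut into consecutive blobs; blob \<open>d\<close> has kind \<open>d mod (s + t)\<close>. Blobs of a
  kind below \<open>s\<close> are single leaves, and the blobs of any other kind are stars on 1, 2, 3, \<dots> vertices, so that
  every size occurs once. The vertex at depth \<open>l\<close> is vertex \<open>snd (slot l)\<close> of blob \<open>fst (slot l)\<close>.\<close>

definition blob_size :: "nat \<Rightarrow> nat" where
  "blob_size d = (if d mod (s + t) < s then 1 else d div (s + t) + 1)"

definition blob_start :: "nat \<Rightarrow> nat" where "blob_start d = (\<Sum>i<d. blob_size i)"

primrec slot :: "nat \<Rightarrow> nat \<times> nat" where
  "slot 0 = (0, 0)"
| "slot (Suc l) = (case slot l of (d, i) \<Rightarrow> if Suc i < blob_size d then (d, Suc i) else (Suc d, 0))"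

lemma blob_size_pos: "0 < blob_size d" by (simp add: blob_size_def)

lemma blob_start_Suc: "blob_start (Suc d) = blob_start d + blob_size d" by (simp add: blob_start_def)

lemma blob_start_mono: "d < d' \<Longrightarrow> blob_start d + blob_size d \<le> blob_start d'"
  by (induction d') (auto simp: blob_start_Suc less_Suc_eq)

lemma slot_char: "l = blob_start (fst (slot l)) + snd (slot l) \<and> snd (slot l) < blob_size (fst (slot l))"
  by (induction l) (auto simp: blob_start_def blob_size_pos blob_start_Suc split: prod.splits)

lemma slot_start:
  assumes "i < blob_size d"
  shows "slot (blob_start d + i) = (d, i)"
proof -
  obtain d' i' where s: "slot (blob_start d + i) = (d', i')" by force
  then have eq: "blob_start d + i = blob_start d' + i'" "i' < blob_size d'"
    using slot_char[of "blob_start d + i"] by auto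
  then have "d = d'" using blob_start_mono[of d d'] blob_start_mono[of d' d] assms by (cases d d' rule: linorder_cases) auto
  then show ?thesis using s eq by simp
qed

text \<open>One more than all kinds together can starve at a node: at most one child for each of the
  \<open>s\<close> leaf kinds, which are offered two, and at most three for each of the
  \<open>t\<close> star kinds, which are offered four.\<close>

definition q :: nat where "q = s + 3 * t + 1"

text \<open>Vertex \<open>i\<close> of a blob stands \<open>i\<close> places after the start of the
  blob, so \<open>p ! (length p - i)\<close> is the centre of the star to which \<open>x\<close>
  belongs.\<close>

definition label_ok :: "(nat \<Rightarrow> nat) \<Rightarrow> nat list \<Rightarrow> nat \<Rightarrow> bool" where
  "label_ok \<tau> p x \<longleftrightarrow> (case slot (length p) of (d, i) \<Rightarrow>
     let \<kappa> = d mod (s + t) in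
     if \<kappa> < s then x \<in> Lf (\<tau> \<kappa>) else if i = 0 then x \<in> Ctr \<kappa> else x \<in> Lf (p ! (length p - i)))"

text \<open>By the last conjunct, only a node at which a blob starts may still receive children: a star is
  inserted together with all its possible continuations.\<close>

definition tree_inv :: "(nat \<Rightarrow> nat) set \<Rightarrow> node set \<Rightarrow> nat set list \<Rightarrow> bool" where
  "tree_inv Tau T h \<longleftrightarrow> finite T \<and> (\<forall>u\<in>T. fst u \<in> Tau) \<and> (\<forall>\<tau>\<in>Tau. (\<tau>, []) \<in> T) \<and>
    (\<forall>\<tau> p x. (\<tau>, p @ [x]) \<in> T \<longrightarrow> (\<tau>, p) \<in> T \<and> label_ok \<tau> p x \<and> x \<notin> centres \<and> x \<in> \<Union>(set h)) \<and>
    (\<forall>u\<in>T. clique (maker_moves h) (fst u ` {..<s} \<union> set (snd u))) \<and>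
    (\<forall>\<tau> p \<tau>' p' x. (\<tau>, p @ [x]) \<in> T \<longrightarrow> (\<tau>', p' @ [x]) \<in> T \<longrightarrow> \<tau> = \<tau>' \<and> p = p') \<and>
    (\<forall>u\<in>T. card (children T u) \<le> q) \<and>
    (\<forall>u\<in>T. snd (slot (length (snd u))) \<noteq> 0 \<longrightarrow> card (children T u) = q)"

lemma tree_invD:
  assumes "tree_inv Tau T h"
  shows "finite T" "\<And>\<tau> p. (\<tau>, p) \<in> T \<Longrightarrow> \<tau> \<in> Tau" "\<And>\<tau>. \<tau> \<in> Tau \<Longrightarrow> (\<tau>, []) \<in> T"
    "\<And>\<tau> p x. (\<tau>, p @ [x]) \<in> T \<Longrightarrow> (\<tau>, p) \<in> T" "\<And>\<tau> p x. (\<tau>, p @ [x]) \<in> T \<Longrightarrow> label_ok \<tau> p x"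
    "\<And>\<tau> p x. (\<tau>, p @ [x]) \<in> T \<Longrightarrow> x \<notin> centres" "\<And>\<tau> p x. (\<tau>, p @ [x]) \<in> T \<Longrightarrow> x \<in> \<Union>(set h)"
    "\<And>\<tau> p. (\<tau>, p) \<in> T \<Longrightarrow> clique (maker_moves h) (\<tau> ` {..<s} \<union> set p)"
    "\<And>\<tau> p \<tau>' p' x. (\<tau>, p @ [x]) \<in> T \<Longrightarrow> (\<tau>', p' @ [x]) \<in> T \<Longrightarrow> \<tau> = \<tau>' \<and> p = p'"
    "\<And>u. u \<in> T \<Longrightarrow> card (children T u) \<le> q"
    "\<And>u. u \<in> T \<Longrightarrow> snd (slot (length (snd u))) \<noteq> 0 \<Longrightarrow> card (children T u) = q"
proof -
  from assms have A: "finite T" "\<forall>u\<in>T. fst u \<in> Tau" "\<forall>\<tau>\<in>Tau. (\<tau>, []) \<in> T"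
    "\<forall>\<tau> p x. (\<tau>, p @ [x]) \<in> T \<longrightarrow> (\<tau>, p) \<in> T \<and> label_ok \<tau> p x \<and> x \<notin> centres \<and> x \<in> \<Union>(set h)"
    "\<forall>u\<in>T. clique (maker_moves h) (fst u ` {..<s} \<union> set (snd u))"
    "\<forall>\<tau> p \<tau>' p' x. (\<tau>, p @ [x]) \<in> T \<longrightarrow> (\<tau>', p' @ [x]) \<in> T \<longrightarrow> \<tau> = \<tau>' \<and> p = p'"
    "\<forall>u\<in>T. card (children T u) \<le> q"
    "\<forall>u\<in>T. snd (slot (length (snd u))) \<noteq> 0 \<longrightarrow> card (children T u) = q"
    unfolding tree_inv_def by - (elim conjE, assumption)+
  show "finite T" by (rule A(1))
  show "\<tau> \<in> Tau" if "(\<tau>, p) \<in> T" for \<tau> p using bspec[OF A(2) that] by simp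
  show "(\<tau>, []) \<in> T" if "\<tau> \<in> Tau" for \<tau> using bspec[OF A(3) that] .
  show "clique (maker_moves h) (\<tau> ` {..<s} \<union> set p)" if "(\<tau>, p) \<in> T" for \<tau> p
    using bspec[OF A(5) that] by simp
  show "card (children T u) \<le> q" if "u \<in> T" for u using bspec[OF A(7) that] .
  show "card (children T u) = q" if "u \<in> T" "snd (slot (length (snd u))) \<noteq> 0" for u
    using bspec[OF A(8) that(1)] that(2) by simp
  show "(\<tau>, p) \<in> T" "label_ok \<tau> p x" "x \<notin> centres" "x \<in> \<Union>(set h)" if "(\<tau>, p @ [x]) \<in> T" for \<tau> p x
    using A(4)[rule_format, OF that] by - (elim conjE, assumption)+
  show "\<tau> = \<tau>' \<and> p = p'" if "(\<tau>, p @ [x]) \<in> T" "(\<tau>', p' @ [x]) \<in> T" for \<tau> p \<tau>' p' x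
    using A(6) that by blast
qed

lemma tree_inv_mono:
  assumes "tree_inv Tau T h"
  shows "tree_inv Tau T (h @ x)"
proof -
  note I = tree_invD[OF assms]
  show ?thesis
    unfolding tree_inv_def
  proof (intro conjI ballI allI impI)
    show "clique (maker_moves (h @ x)) (fst u ` {..<s} \<union> set (snd u))" if "u \<in> T" for u
      by (rule clique_mono[OF I(8) maker_moves_append order_refl]) (use that in simp)
    show "fst u \<in> Tau" if "u \<in> T" for u by (rule I(2)[of _ "snd u"]) (use that in simp)
    show "finite T" by (rule I(1))
    show "(\<tau>, []) \<in> T" if "\<tau> \<in> Tau" for \<tau> using that by (rule I(3))
    show "card (children T u) \<le> q" if "u \<in> T" for u using that by (rule I(10))
    show "card (children T u) = q" if "u \<in> T" "snd (slot (length (snd u))) \<noteq> 0" for u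
      using that by (rule I(11))
    fix \<tau> p y assume y: "(\<tau>, p @ [y]) \<in> T"
    show "(\<tau>, p) \<in> T" "label_ok \<tau> p y" "y \<notin> centres" using I(4-6)[OF y] by simp_all
    show "y \<in> \<Union>(set (h @ x))" using I(7)[OF y] by simp
    fix \<tau>' p' assume y': "(\<tau>', p' @ [y]) \<in> T"
    show "\<tau> = \<tau>'" "p = p'" using I(9)[OF y y'] by simp_all
  qed
qed

text \<open>The lists in \<open>S\<close> are relative to \<open>p\<close>. They all start with
  \<open>a\<close>, so the node gains exactly one child, and below it each place before the end of
  the blob is filled at once with all its \<open>q\<close> children.\<close>

lemma add_blob:
  assumes inv: "tree_inv Tau T h" and u: "(\<tau>, p) \<in> T" and nf: "card (children T (\<tau>, p)) \<noteq> q"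
    and d: "d = fst (slot (length p))" and h': "h' = h @ x"
    and S: "finite S" "[] \<notin> S" "\<And>w x. w @ [x] \<in> S \<Longrightarrow> w = [] \<or> w \<in> S" "\<And>x. [x] \<in> S \<longleftrightarrow> x = a"
    "\<And>w w' x. w @ [x] \<in> S \<Longrightarrow> w' @ [x] \<in> S \<Longrightarrow> w = w'"
    "\<And>w x. w @ [x] \<in> S \<Longrightarrow> x \<notin> \<Union>(set h) \<and> x \<in> \<Union>(set h') \<and> x \<notin> centres \<and> label_ok \<tau> (p @ w) x"
    "\<And>w. w \<in> S \<Longrightarrow> clique (maker_moves h') (\<tau> ` {..<s} \<union> set p \<union> set w)"
    "\<And>w. w \<in> S \<Longrightarrow> length w \<le> blob_size d \<and> card {x. w @ [x] \<in> S} = (if length w < blob_size d then q else 0)"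
  shows "tree_inv Tau (T \<union> (\<lambda>w. (\<tau>, p @ w)) ` S) h'"
    and "card (children (T \<union> (\<lambda>w. (\<tau>, p @ w)) ` S) (\<tau>, p)) = Suc (card (children T (\<tau>, p)))"
proof -
  let ?S = "(\<lambda>w. (\<tau>, p @ w)) ` S" and ?T = "T \<union> (\<lambda>w. (\<tau>, p @ w)) ` S"
  note I = tree_invD[OF inv]
  note I' = tree_invD[OF tree_inv_mono[OF inv, of x, folded h']]
  \<comment> \<open>A node with free places stands at the start of a blob, by the last conjunct of
    \<open>tree_inv\<close>; so \<open>S\<close> fills precisely blob \<open>d\<close>.\<close>
  have bd: "snd (slot (length p)) = 0" using I(11)[OF u] nf by auto
  have slp: "length p = blob_start d" using slot_char[of "length p"] bd d by simp
  have snocS: "\<exists>w. p1 = p @ w \<and> w @ [y] \<in> S \<and> \<tau>1 = \<tau>" if "(\<tau>1, p1 @ [y]) \<in> ?S" for \<tau>1 p1 y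
  proof -
    obtain w where w: "w \<in> S" "\<tau>1 = \<tau>" "p1 @ [y] = p @ w" using \<open>(\<tau>1, p1 @ [y]) \<in> ?S\<close> by auto
    have "w \<noteq> []" using w(1) S(2) by auto
    then obtain w' y' where "w = w' @ [y']" using rev_exhaust by blast
    then show ?thesis using w by auto
  qed
  have labS: "y \<notin> \<Union>(set h)" if "(\<tau>1, p1 @ [y]) \<in> ?S" for \<tau>1 p1 y
    using snocS[OF that] S(6) by blast
  \<comment> \<open>Labels of \<open>T\<close> have been touched in \<open>h\<close> and those of
    \<open>S\<close> have not, so old and new labels never collide.\<close>
  have disj: "(\<tau>1, p1 @ [y]) \<notin> ?S" if "(\<tau>2, p2 @ [y]) \<in> T" for \<tau>1 \<tau>2 p1 p2 y
    using labS[of \<tau>1 p1 y] I(7)[OF that] by blast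
  have pwT: "(\<tau>, p @ w) \<notin> T" if "w \<in> S" for w
  proof -
    have "w \<noteq> []" using that S(2) by auto
    then obtain w' y where w: "w = w' @ [y]" using rev_exhaust by blast
    then have "(\<tau>, (p @ w') @ [y]) \<in> ?S" using that by auto
    then show ?thesis using disj[of \<tau> "p @ w'" y \<tau> "p @ w'"] w by auto
  qed
  have chS: "children ?T (\<tau>, p @ w) = {y. w @ [y] \<in> S}" if "w \<in> S" for w
  proof (intro set_eqI iffI)
    fix y assume "y \<in> children ?T (\<tau>, p @ w)"
    then have y: "(\<tau>, p @ w @ [y]) \<in> ?T" by (simp add: children_def)
    have "(\<tau>, (p @ w) @ [y]) \<notin> T" using I(4)[of \<tau> "p @ w" y] pwT[OF that] by blast
    then show "y \<in> {y. w @ [y] \<in> S}" using y by auto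
  qed (auto simp: children_def)
  have chp: "children ?T (\<tau>, p) = insert a (children T (\<tau>, p))"
  proof (intro set_eqI iffI)
    fix y assume "y \<in> children ?T (\<tau>, p)"
    then have "(\<tau>, p @ [y]) \<in> T \<or> [y] \<in> S" by (auto simp: children_def)
    then show "y \<in> insert a (children T (\<tau>, p))" using S(4) by (auto simp: children_def)
  next
    fix y assume "y \<in> insert a (children T (\<tau>, p))"
    then show "y \<in> children ?T (\<tau>, p)" using S(4)[of y] by (auto simp: children_def)
  qed
  have "(\<tau>, p @ [a]) \<notin> T" using pwT[of "[a]"] S(4) by simp
  then have aT: "a \<notin> children T (\<tau>, p)" by (simp add: children_def)
  show c: "card (children ?T (\<tau>, p)) = Suc (card (children T (\<tau>, p)))"
    unfolding chp using aT finite_ch[OF I(1)] by simp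
  have cho: "children ?T u = children T u" if "u \<in> T" "u \<noteq> (\<tau>, p)" for u
  proof (intro set_eqI iffI)
    fix y assume "y \<in> children ?T u"
    then have y: "(fst u, snd u @ [y]) \<in> ?T" by (simp add: children_def)
    show "y \<in> children T u"
    proof (rule ccontr)
      assume "y \<notin> children T u"
      then have "(fst u, snd u @ [y]) \<in> ?S" using y by (simp add: children_def)
      from snocS[OF this] obtain w where w: "snd u = p @ w" "w @ [y] \<in> S" "fst u = \<tau>" by blast
      then have "w \<noteq> []" using that(2) by (cases u) auto
      then have "w \<in> S" using S(3)[OF w(2)] by blast
      then show False using pwT[of w] w that(1) by (metis prod.collapse)
    qed
  qed (auto simp: children_def)
  show "tree_inv Tau ?T h'"
    unfolding tree_inv_def
  proof (intro conjI allI impI ballI)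
    show "finite ?T" using I(1) S(1) by simp
    show "fst u \<in> Tau" if "u \<in> ?T" for u using that I(2) u by (cases u) auto
    show "(\<tau>', []) \<in> ?T" if "\<tau>' \<in> Tau" for \<tau>' using I(3)[OF that] by simp
    show "clique (maker_moves h') (fst u ` {..<s} \<union> set (snd u))" if "u \<in> ?T" for u
    proof -
      from that consider "u \<in> T" | w where "w \<in> S" "u = (\<tau>, p @ w)" by blast
      then show ?thesis
      proof cases
        case 1
        then show ?thesis using I'(8)[of "fst u" "snd u"] by simp
      next
        case 2
        then show ?thesis using S(7)[OF 2(1)] by (simp add: Un_assoc)
      qed
    qed
    show "card (children ?T u) \<le> q" if "u \<in> ?T" for u
    proof -
      from that consider "u = (\<tau>, p)" | "u \<in> T" "u \<noteq> (\<tau>, p)" | w where "w \<in> S" "u = (\<tau>, p @ w)" by blast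
      then show ?thesis
      proof cases
        case 1
        then show ?thesis using c I(10)[OF u] nf by simp
      next
        case 2
        then show ?thesis using cho[OF 2] I(10)[OF 2(1)] by simp
      next
        case 3
        then show ?thesis using chS[OF 3(1)] S(8)[OF 3(1)] by simp
      qed
    qed
    show "card (children ?T u) = q" if "u \<in> ?T" and ns: "snd (slot (length (snd u))) \<noteq> 0" for u
    proof -
      from that(1) consider "u = (\<tau>, p)" | "u \<in> T" "u \<noteq> (\<tau>, p)" | w where "w \<in> S" "u = (\<tau>, p @ w)" by blast
      then show ?thesis
      proof cases
        case 1
        then show ?thesis using ns bd by simp
      next
        case 2
        then show ?thesis using cho[OF 2] I(11)[OF 2(1) ns] by simp
      next
        case 3
        \<comment> \<open>A list of full length in \<open>S\<close> reaches the start of the next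
          blob, where children may still be missing.\<close>
        have "length w < blob_size d"
        proof (rule ccontr)
          assume "\<not> length w < blob_size d"
          then have "length w = blob_size d" using S(8)[OF 3(1)] by simp
          then have "length (snd u) = blob_start (Suc d) + 0" using 3 slp by (simp add: blob_start_Suc)
          then have "slot (length (snd u)) = (Suc d, 0)" using slot_start[OF blob_size_pos] by metis
          then show False using ns by simp
        qed
        then show ?thesis using 3 chS[OF 3(1)] S(8)[OF 3(1)] by simp
      qed
    qed
    fix \<tau>1 p1 y assume "(\<tau>1, p1 @ [y]) \<in> ?T"
    then consider "(\<tau>1, p1 @ [y]) \<in> T" | w where "p1 = p @ w" "w @ [y] \<in> S" "\<tau>1 = \<tau>"
      using snocS by blast
    note cs = this
    show "(\<tau>1, p1) \<in> ?T" using cs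
    proof cases
      case 1
      then show ?thesis using I(4) by blast
    next
      case 2
      then show ?thesis using S(3)[OF 2(2)] u by auto
    qed
    show "label_ok \<tau>1 p1 y" using cs by cases (use I(5) S(6) in auto)
    show "y \<notin> centres" using cs by cases (use I(6) S(6) in auto)
    show "y \<in> \<Union>(set h')" using cs by cases (use I'(7) S(6) in blast)+
    fix \<tau>2 p2 assume 2: "(\<tau>2, p2 @ [y]) \<in> ?T"
    from cs have "\<tau>1 = \<tau>2 \<and> p1 = p2"
    proof cases
      case 1
      then have "(\<tau>2, p2 @ [y]) \<in> T" using disj 2 by blast
      then show ?thesis using I(9)[OF 1] by blast
    next
      case cw: 2
      then have "(\<tau>1, p1 @ [y]) \<in> ?S" by auto
      then have "(\<tau>2, p2 @ [y]) \<in> ?S" using disj 2 by blast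
      then obtain w' where "p2 = p @ w'" "w' @ [y] \<in> S" "\<tau>2 = \<tau>" using snocS by blast
      then show ?thesis using cw S(5) by blast
    qed
    then show "\<tau>1 = \<tau>2" "p1 = p2" by auto
  qed
qed

end

section \<open>Attaching leaves of infinite stars\<close>

definition least_in :: "'a set \<Rightarrow> ('a \<Rightarrow> nat) \<Rightarrow> nat \<Rightarrow> 'a set \<Rightarrow> bool" where
  "least_in X f m Y \<longleftrightarrow> Y \<subseteq> X \<and> card Y = m \<and> (\<forall>y\<in>Y. \<forall>z\<in>X - Y. f y \<le> f z)"

context star_game begin

text \<open>For nonempty \<open>Tau\<close> this is the ceiling of
  \<open>card Tau / (s + t)\<close>, the largest number for which \<open>s + t\<close> kinds, each
  starving fewer than \<open>quota Tau\<close> tuples, cannot exhaust \<open>Tau\<close>.\<close>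

definition quota :: "(nat \<Rightarrow> nat) set \<Rightarrow> nat" where
  "quota Tau = Suc ((card Tau - 1) div (s + t))"

definition full :: "node set \<Rightarrow> node \<Rightarrow> bool" where
  "full T u \<longleftrightarrow> u \<in> T \<and> card (children T u) = q"

definition labels :: "node set \<Rightarrow> nat set" where
  "labels T = (\<Union>u. children T u)"

text \<open>Bundles what \<open>add_blob\<close> requires of \<open>S\<close>, so that leaf rounds
  and star rounds deliver the same kind of result.\<close>

definition blob :: "nat set list \<Rightarrow> nat set list \<Rightarrow> (nat \<Rightarrow> nat) \<Rightarrow> nat list \<Rightarrow> nat \<Rightarrow> nat list set \<Rightarrow> bool" where
  "blob h h' \<tau> p a S \<longleftrightarrow> finite S \<and> [] \<notin> S \<and> (\<forall>w x. w @ [x] \<in> S \<longrightarrow> w = [] \<or> w \<in> S) \<and>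
     (\<forall>x. [x] \<in> S \<longleftrightarrow> x = a) \<and> (\<forall>w w' x. w @ [x] \<in> S \<longrightarrow> w' @ [x] \<in> S \<longrightarrow> w = w') \<and>
     (\<forall>w x. w @ [x] \<in> S \<longrightarrow> x \<notin> \<Union>(set h) \<and> x \<in> \<Union>(set h') \<and> x \<notin> centres \<and> label_ok \<tau> (p @ w) x) \<and>
     (\<forall>w\<in>S. clique (maker_moves h') (\<tau> ` {..<s} \<union> set p \<union> set w)) \<and>
     (\<forall>w\<in>S. length w \<le> blob_size (fst (slot (length p))) \<and>
        card {x. w @ [x] \<in> S} = (if length w < blob_size (fst (slot (length p))) then q else 0))"

text \<open>The descent is recorded even if the node reached wants another kind. Then nothing is
  inserted and the round is merely a visit.\<close>

definition outcome :: "node set \<Rightarrow> nat \<Rightarrow> (nat \<Rightarrow> nat) set \<Rightarrow> (node \<Rightarrow> nat set) \<Rightarrow>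
    nat set list \<Rightarrow> nat set list \<Rightarrow> bool" where
  "outcome T \<kappa> Y0 Des h h' \<longleftrightarrow> length h < length h' \<and> (\<exists>x. h' = h @ x) \<and>
     (\<exists>\<tau> p. \<tau> \<in> Y0 \<and> (\<tau>, p) \<in> T \<and> \<not> full T (\<tau>, p) \<and>
       (\<forall>i<length p. full T (\<tau>, take i p) \<and> p ! i \<in> Des (\<tau>, take i p)) \<and>
       (fst (slot (length p)) mod (s + t) = \<kappa> \<longrightarrow> (\<exists>a S. blob h h' \<tau> p a S)))"

lemma labels_sub: "labels T \<subseteq> (\<lambda>u. last (snd u)) ` T"
proof
  fix x assume "x \<in> labels T"
  then obtain u where "(fst u, snd u @ [x]) \<in> T" by (auto simp: labels_def children_def)
  from imageI[OF this, of "\<lambda>u. last (snd u)"] show "x \<in> (\<lambda>u. last (snd u)) ` T" by simp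
qed

lemma card_labels: "finite T \<Longrightarrow> finite (labels T) \<and> card (labels T) \<le> card T"
  using labels_sub[of T] by (meson card_image_le card_mono finite_imageI finite_subset le_trans)

lemma labels_inv:
  assumes "tree_inv Tau T h" "x \<in> labels T"
  shows "x \<in> \<Union>(set h)" "x \<notin> centres"
  using assms(2) tree_invD(6,7)[OF assms(1)] by (auto simp: labels_def children_def)

lemma children_labels: "children T u \<subseteq> labels T" by (auto simp: labels_def)

lemma children_disjoint:
  assumes "tree_inv Tau T h" "x \<in> children T u" "x \<in> children T u'"
  shows "u = u'"
  using tree_invD(9)[OF assms(1), of "fst u" "snd u" x "fst u'" "snd u'"] assms(2,3)
  by (simp add: children_def prod_eq_iff)

lemma kinds_real: "0 < real s + real t"
  using kinds by (metis of_nat_0_less_iff of_nat_add)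

lemma quota_bounds:
  assumes "real (n ^ s) / 2 ^ (s * s + 1) \<le> card Tau"
  shows "real (n ^ s) / (2 ^ (s * s + 1) * real (s + t)) \<le> quota Tau"
    and "(s + t) * (quota Tau - 1) < card Tau" and "quota Tau \<le> card Tau"
proof -
  have "0 < real (n ^ s) / 2 ^ (s * s + 1)" using n_pos by simp
  then have pos: "0 < card Tau" using assms by linarith
  have "card Tau - 1 = (s + t) * ((card Tau - 1) div (s + t)) + (card Tau - 1) mod (s + t)" by simp
  moreover have "(card Tau - 1) mod (s + t) < s + t" using kinds by simp
  ultimately have "card Tau - 1 < (s + t) * ((card Tau - 1) div (s + t)) + (s + t)" by linarith
  then have le: "card Tau \<le> (s + t) * quota Tau" unfolding quota_def using pos by simp
  have "real (n ^ s) / 2 ^ (s * s + 1) \<le> real ((s + t) * quota Tau)" using assms le by linarith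
  then have "real (n ^ s) / 2 ^ (s * s + 1) / (s + t) \<le> quota Tau"
    using kinds_real by (subst pos_divide_le_eq) (simp_all add: mult.commute)
  then show "real (n ^ s) / (2 ^ (s * s + 1) * real (s + t)) \<le> quota Tau"
    by (simp only: divide_divide_eq_left)
  have "(s + t) * ((card Tau - 1) div (s + t)) \<le> card Tau - 1" by (simp only: times_div_less_eq_dividend)
  moreover have "quota Tau - 1 = (card Tau - 1) div (s + t)" by (simp add: quota_def)
  ultimately show "(s + t) * (quota Tau - 1) < card Tau" using pos by (metis One_nat_def Suc_pred less_Suc_eq_le)
  have "(card Tau - 1) div (s + t) \<le> card Tau - 1" by simp
  then show "quota Tau \<le> card Tau" unfolding quota_def using pos by linarith
qed

lemma touched_card:
  assumes "set x \<subseteq> E0"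
  shows "finite (\<Union>(set x)) \<and> card (\<Union>(set x)) \<le> 2 * length x"
proof -
  have c: "card e = 2" if e: "e \<in> set x" for e
  proof -
    have "e \<in> E0" using assms e by blast
    then obtain u v where "e = {u, v}" "u \<noteq> v" using E0_cases by blast
    then show ?thesis by simp
  qed
  then have "finite e" if "e \<in> set x" for e using that card_ge_0_finite[of e] by simp
  moreover have "card (\<Union>(set x)) \<le> (\<Sum>e\<in>set x. card e)" by (rule card_Union_le_sum_card)
  moreover have "(\<Sum>e\<in>set x. card e) \<le> 2 * length x" using c card_length[of x] by simp
  ultimately show ?thesis by auto
qed

lemma walk_tree:
  assumes inv: "tree_inv Tau T h" and \<tau>: "\<tau> \<in> Tau"
    and D: "\<And>u. full T u \<Longrightarrow> D u \<subseteq> children T u \<and> D u \<inter> M \<noteq> {}"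
  shows "\<exists>p. (\<tau>, p) \<in> T \<and> \<not> full T (\<tau>, p) \<and>
    (\<forall>i<length p. full T (\<tau>, take i p) \<and> p ! i \<in> D (\<tau>, take i p)) \<and> set p \<subseteq> M"
proof -
  note I = tree_invD[OF inv]
  define des where "des p = (if full T (\<tau>, p) then D (\<tau>, p) else {})" for p
  define W where "W = {p. (\<tau>, p) \<in> T}"
  have "W \<subseteq> snd ` T" by (force simp: W_def)
  then have fW: "finite W" using I(1) finite_subset by blast
  have "\<exists>p\<in>W. des p = {} \<and> (\<forall>i<length p. p ! i \<in> M \<and> p ! i \<in> des (take i p) \<and> take i p \<in> W)"
  proof (rule walk[OF fW])
    show "[] \<in> W" using I(3)[OF \<tau>] by (simp add: W_def)
    fix p assume "p \<in> W"
    show "des p = {} \<or> (\<exists>x\<in>des p. x \<in> M \<and> p @ [x] \<in> W)"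
    proof (cases "full T (\<tau>, p)")
      case True
      then obtain x where "x \<in> D (\<tau>, p)" "x \<in> M" "x \<in> children T (\<tau>, p)" using D by blast
      then show ?thesis using True by (auto simp: des_def W_def children_def)
    qed (simp add: des_def)
  qed
  then obtain p where p: "p \<in> W" "des p = {}"
    "\<forall>i<length p. p ! i \<in> M \<and> p ! i \<in> des (take i p) \<and> take i p \<in> W" by blast
  show ?thesis
  proof (intro exI[of _ p] conjI)
    show "(\<tau>, p) \<in> T" using p(1) by (simp add: W_def)
    show "\<not> full T (\<tau>, p)"
    proof
      assume "full T (\<tau>, p)"
      then have "D (\<tau>, p) = {}" using p(2) by (simp add: des_def)
      then show False using D[OF \<open>full T (\<tau>, p)\<close>] by simp
    qed
    show "\<forall>i<length p. full T (\<tau>, take i p) \<and> p ! i \<in> D (\<tau>, take i p)"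
      using p(3) by (auto simp: des_def split: if_splits)
    show "set p \<subseteq> M" using p(3) by (auto simp: in_set_conv_nth)
  qed
qed

text \<open>The first edge of a leaf must go to its centre, so the centre is fixed before it is
  known which tuple will be reached. After that, a potential game on the other \<open>s - 1\<close>
  coordinates catches a tuple through this centre, while pairing secures an offered child at every
  full node.\<close>

lemma leaf_force:
  assumes h: "legal E0 h" and Tau: "Tau \<subseteq> Tup" "real (n ^ s) / 2 ^ (s * s + 1) \<le> card Tau"
    and inv: "tree_inv Tau T h" and \<kappa>: "\<kappa> < s" and Y0: "Y0 \<subseteq> Tau" "card Y0 = quota Tau"
    and Des: "\<And>u. full T u \<Longrightarrow> Des u \<subseteq> children T u \<and> card (Des u) = 2"
  shows "\<exists>N. force E0 N (outcome T \<kappa> Y0 Des h) h"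
proof -
  note I = tree_invD[OF inv]
  have fY0: "finite Y0" using Y0(1) Tau(1) finite_Tup finite_subset by (metis subset_trans)
  have Y0T: "Y0 \<subseteq> Tup" using Y0(1) Tau(1) by blast
  have s0: "0 < s" using \<kappa> by simp
  define Yc where "Yc c = {\<tau> \<in> Y0. \<tau> \<kappa> = c}" for c
  \<comment> \<open>By averaging, some centre lies in at least the \<open>n\<close>-th part of the
    offered tuples.\<close>
  have "\<exists>c\<in>Ctr \<kappa>. real (card Y0) / n \<le> card (Yc c)"
  proof (rule ccontr)
    assume neg: "\<not> (\<exists>c\<in>Ctr \<kappa>. real (card Y0) / n \<le> card (Yc c))"
    have "Y0 = (\<Union>c\<in>Ctr \<kappa>. Yc c)" using Y0T Tup_ctr \<kappa> by (auto simp: Yc_def)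
    then have "card Y0 \<le> (\<Sum>c\<in>Ctr \<kappa>. card (Yc c))" using card_UN_le[OF fin_ctr[OF \<kappa>], of Yc] by simp
    then have "real (card Y0) \<le> (\<Sum>c\<in>Ctr \<kappa>. real (card (Yc c)))" by (metis of_nat_le_iff of_nat_sum)
    also have "\<dots> < (\<Sum>c\<in>Ctr \<kappa>. real (card Y0) / n)"
    proof (rule sum_strict_mono[OF fin_ctr[OF \<kappa>]])
      show "Ctr \<kappa> \<noteq> {}" using card_ctr[OF \<kappa>] n_pos by auto
    qed (use neg in force)
    also have "\<dots> = card Y0" using card_ctr[OF \<kappa>] n_pos by simp
    finally show False by simp
  qed
  then obtain c where c: "c \<in> Ctr \<kappa>" "real (quota Tau) / n \<le> card (Yc c)" using Y0(2) by auto
  have "infinite (Lf c - \<Union>(set h))"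
    using inf_lf[OF \<kappa> c(1)] touched_card[of h] h by (auto simp: legal_def)
  then obtain v where v: "v \<in> Lf c" "v \<notin> \<Union>(set h)" by (metis DiffE ex_in_conv finite.emptyI)
  have vC: "v \<notin> Ctr i" if "i < s + t" for i using lf_ctr[OF _ that c(1)] \<kappa> v(1) by auto
  have vCC: "v \<notin> centres" using vC by (auto simp: centres_def)
  have cCC: "c \<in> centres" using c(1) \<kappa> by (auto simp: centres_def)
  define X where "X = centres - Ctr \<kappa>"
  define H where "H \<tau> = \<tau> ` ({..<s} - {\<kappa>})" for \<tau> :: "nat \<Rightarrow> nat"
  have HX: "H \<tau> \<subseteq> X" if "\<tau> \<in> Tup" for \<tau>
  proof
    fix x assume "x \<in> H \<tau>"
    then obtain i where i: "i < s" "i \<noteq> \<kappa>" "x = \<tau> i" by (auto simp: H_def)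
    then have "x \<in> Ctr i" using Tup_ctr[OF that] by simp
    then show "x \<in> X" using i \<kappa> ctr_unique[of x i \<kappa>] by (auto simp: X_def centres_def)
  qed
  have cH: "c \<in> \<tau> ` {..<s}" if "\<tau> \<in> Yc c" for \<tau> using that \<kappa> by (auto simp: Yc_def)
  have Hs: "H \<tau> \<subseteq> \<tau> ` {..<s}" for \<tau> by (auto simp: H_def)
  have fX: "finite X" using finite_CC by (simp add: X_def)
  \<comment> \<open>All tuples in \<open>Yc c\<close> contain \<open>c\<close>, so one further
    element prescribes two coordinates in total, and two further elements prescribe three.\<close>
  let ?D1 = "real (n ^ s) / real n ^ 2" and ?D2 = "real (n ^ s) / real n ^ 3"
  define k where "k = card (Yc c) / 2 ^ (s - 1) - ?D1 - ?D2 * card X"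
  have kpos: "0 < k"
  proof -
    let ?A = "real (n ^ s) / real n ^ 2"
    have "card X \<le> s * n" using card_CC card_mono[OF finite_CC, of X] by (auto simp: X_def)
    then have "?D2 * card X \<le> ?D2 * (s * n)"
      by (intro mult_left_mono) (simp_all only: of_nat_le_iff, simp)
    also have "\<dots> = ?A * s" using n_pos by (simp add: field_simps power2_eq_square power3_eq_cube)
    finally have "?D2 * card X \<le> ?A * s" .
    moreover have "?A * real (s + 1) = ?A * s + ?A"
      by (simp only: of_nat_add of_nat_1 distrib_left mult_1_right)
    ultimately have 1: "?D1 + ?D2 * card X \<le> ?A * real (s + 1)" by linarith
    have "real ((s + 1) * (s + t)) * 2 ^ (s * s + s) < real n" using num_leaf s0 by blast
    then have "real (s + 1) * (real (s + t) * 2 ^ (s * s + s)) < real n"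
      by (simp only: of_nat_mult mult.assoc)
    moreover have "0 < real (s + t) * 2 ^ (s * s + s)" using kinds_real by simp
    ultimately have "real (s + 1) < n / (real (s + t) * 2 ^ (s * s + s))"
      by (simp only: pos_less_divide_eq)
    then have "?A * real (s + 1) < ?A * (n / (real (s + t) * 2 ^ (s * s + s)))"
      using n_pos by (intro mult_strict_left_mono) auto
    also have "\<dots> = real (n ^ s) / (2 ^ (s * s + 1) * real (s + t)) / n / 2 ^ (s - 1)"
    proof -
      have "s * s + s = (s * s + 1) + (s - 1)" using s0 by simp
      then have "(2::real) ^ (s * s + s) = 2 ^ (s * s + 1) * 2 ^ (s - 1)" by (metis power_add)
      then show ?thesis using n_pos by (simp add: divide_simps power2_eq_square)
    qed
    also have "\<dots> \<le> quota Tau / n / 2 ^ (s - 1)"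
      using quota_bounds(1)[OF Tau(2)] by (intro divide_right_mono) auto
    also have "\<dots> \<le> card (Yc c) / 2 ^ (s - 1)" using c(2) by (intro divide_right_mono) auto
    finally show ?thesis using 1 unfolding k_def by linarith
  qed
  \<comment> \<open>Each offer consists of two children, and a label occurs under one parent only;
    this makes the offers a family of disjoint pairs.\<close>
  define \<P> where "\<P> = Des ` {u. full T u}"
  have PL: "\<Union>\<P> \<subseteq> labels T" unfolding \<P>_def using Des children_labels[of T] by blast
  have fP: "finite (\<Union>\<P>)" using PL card_labels[OF I(1)] finite_subset by blast
  have f: "force E0 (Suc (card (X \<union> \<Union>\<P>))) (\<lambda>h'. c \<in> maker_nbrs h' v \<and>
     k \<le> card {\<tau>\<in>Yc c. H \<tau> \<subseteq> maker_nbrs h' v} \<and> (\<forall>A\<in>\<P>. A \<inter> maker_nbrs h' v \<noteq> {})) h"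
  proof (rule arrive[OF h v(2), where m = "s - 1" and ?D1.0 = ?D1 and ?D2.0 = ?D2])
    show "c \<noteq> v" using vCC cCC by auto
    show "finite (Yc c)" using fY0 by (simp add: Yc_def)
    show "finite X" by (rule fX)
    show "H \<tau> \<subseteq> X \<and> card (H \<tau>) \<le> s - 1" if "\<tau> \<in> Yc c" for \<tau>
    proof -
      have "card (H \<tau>) \<le> card ({..<s} - {\<kappa>})" unfolding H_def by (rule card_image_le) simp
      also have "\<dots> = s - 1" using \<kappa> by (simp add: card_Diff_singleton)
      finally show ?thesis using HX that Y0T by (auto simp: Yc_def)
    qed
    have Ycs: "Yc c \<subseteq> Tup" using Y0T by (auto simp: Yc_def)
    show "card {\<tau> \<in> Yc c. x \<in> H \<tau>} \<le> ?D1" if "x \<in> X" for x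
    proof (rule Tup_count_le[OF Ycs, where W = "{c, x}"])
      have "c \<noteq> x" using that c(1) by (auto simp: X_def)
      then show "2 \<le> card {c, x}" by simp
    qed (use cH Hs in auto)
    show "card {\<tau> \<in> Yc c. x \<in> H \<tau> \<and> y \<in> H \<tau>} \<le> ?D2" if "x \<in> X" "y \<in> X" "x \<noteq> y" for x y
    proof (rule Tup_count_le[OF Ycs, where W = "{c, x, y}"])
      have "c \<noteq> x" "c \<noteq> y" using that c(1) by (auto simp: X_def)
      then show "3 \<le> card {c, x, y}" using that by simp
    qed (use cH Hs in auto)
    show "disjoint \<P>" unfolding \<P>_def disjoint_def using Des children_disjoint[OF inv] by blast
    show "2 \<le> card A" if "A \<in> \<P>" for A using that Des by (auto simp: \<P>_def)
    show "X \<inter> \<Union>\<P> = {}" using PL labels_inv(2)[OF inv] by (auto simp: X_def)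
    show "v \<notin> X \<union> \<Union>\<P>" using PL labels_inv(1)[OF inv] v(2) vCC by (auto simp: X_def)
    show "c \<notin> X \<union> \<Union>\<P>" using PL labels_inv(2)[OF inv] cCC c(1) by (auto simp: X_def)
  qed (use fP k_def in auto)
  from force_ext[OF h f]
  have "force E0 (Suc (card (X \<union> \<Union>\<P>))) (outcome T \<kappa> Y0 Des h) h"
  proof (rule force_mono)
    fix h' assume a: "(c \<in> maker_nbrs h' v \<and> k \<le> card {\<tau>\<in>Yc c. H \<tau> \<subseteq> maker_nbrs h' v} \<and> (\<forall>A\<in>\<P>. A \<inter> maker_nbrs h' v \<noteq> {})) \<and>
      legal E0 h' \<and> (\<exists>x. h' = h @ x \<and> length x \<le> 2 * Suc (card (X \<union> \<Union>\<P>)))"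
    then obtain x where x: "h' = h @ x" by blast
    have cv: "{v, c} \<in> maker_moves h'" using a by (simp add: maker_nbrs_def)
    then have vh': "v \<in> \<Union>(set h')" using maker_moves_subset by fast
    have "x \<noteq> []" using vh' v(2) x by auto
    have "0 < card {\<tau>\<in>Yc c. H \<tau> \<subseteq> maker_nbrs h' v}" using a kpos by linarith
    then have "{\<tau>\<in>Yc c. H \<tau> \<subseteq> maker_nbrs h' v} \<noteq> {}" by (metis card.empty less_numeral_extra(3))
    then obtain \<tau> where \<tau>: "\<tau> \<in> Yc c" "H \<tau> \<subseteq> maker_nbrs h' v" by blast
    have \<tau>0: "\<tau> \<in> Y0" "\<tau> \<kappa> = c" using \<tau>(1) by (auto simp: Yc_def)
    have "\<exists>p. (\<tau>, p) \<in> T \<and> \<not> full T (\<tau>, p) \<and>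
      (\<forall>i<length p. full T (\<tau>, take i p) \<and> p ! i \<in> Des (\<tau>, take i p)) \<and> set p \<subseteq> maker_nbrs h' v"
    proof (rule walk_tree[OF inv])
      show "\<tau> \<in> Tau" using \<tau>0(1) Y0(1) by blast
      show "Des u \<subseteq> children T u \<and> Des u \<inter> maker_nbrs h' v \<noteq> {}" if "full T u" for u
      proof -
        have "Des u \<in> \<P>" using that by (auto simp: \<P>_def)
        then show ?thesis using Des[OF that] a by blast
      qed
    qed
    then obtain p where p: "(\<tau>, p) \<in> T" "\<not> full T (\<tau>, p)"
      "\<forall>i<length p. full T (\<tau>, take i p) \<and> p ! i \<in> Des (\<tau>, take i p)" "set p \<subseteq> maker_nbrs h' v" by blast
    have nbv: "\<tau> ` {..<s} \<subseteq> maker_nbrs h' v"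
    proof
      fix y assume "y \<in> \<tau> ` {..<s}"
      then show "y \<in> maker_nbrs h' v" using \<tau>(2) \<tau>0(2) a unfolding H_def by (cases "y = c") auto
    qed
    have cl: "clique (maker_moves h') (insert v (\<tau> ` {..<s} \<union> set p))"
    proof (rule clique_insert)
      show "clique (maker_moves h') (\<tau> ` {..<s} \<union> set p)"
        using tree_invD(8)[OF tree_inv_mono[OF inv] p(1)] x by simp
      show "{v, y} \<in> maker_moves h'" if "y \<in> \<tau> ` {..<s} \<union> set p" for y
        using that nbv p(4) by (auto simp: maker_nbrs_def)
    qed
    \<comment> \<open>A blob of a kind below \<open>s\<close> is the single vertex \<open>v\<close>,
      which starts and ends it.\<close>
    have "blob h h' \<tau> p v {[v]}" if m: "fst (slot (length p)) mod (s + t) = \<kappa>"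
    proof -
      have "blob_size (fst (slot (length p))) = 1" using m \<kappa> by (simp add: blob_size_def)
      moreover have "label_ok \<tau> p v" using m \<kappa> v(1) \<tau>0(2)
        by (cases "slot (length p)") (auto simp: label_ok_def Let_def)
      moreover have "{x. [v, x] \<in> {[v]}} = {}" by simp
      ultimately show ?thesis using v(2) vh' vCC cl unfolding blob_def
        by (auto simp: append_eq_Cons_conv insert_commute)
    qed
    then have "fst (slot (length p)) mod (s + t) = \<kappa> \<longrightarrow> (\<exists>a S. blob h h' \<tau> p a S)" by blast
    moreover have "length h < length h'" "\<exists>x. h' = h @ x" using x \<open>x \<noteq> []\<close> by auto
    ultimately show "outcome T \<kappa> Y0 Des h h'"
      unfolding outcome_def using \<tau>0(1) p(1-3) by blast
  qed
  then show ?thesis by blast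
qed


section \<open>Attaching finite stars\<close>

definition ends :: "node set \<Rightarrow> (nat \<Rightarrow> nat) set \<Rightarrow> (node \<Rightarrow> nat set) \<Rightarrow> node set" where
  "ends T Ya D = {u \<in> T. \<not> full T u \<and> fst u \<in> Ya \<and>
     (\<forall>i<length (snd u). full T (fst u, take i (snd u)) \<and> snd u ! i \<in> D (fst u, take i (snd u)))}"

text \<open>After the centre \<open>a\<close> has been joined to two children of every full node, the leaves of \<open>a\<close> descend
  to the remaining ends \<open>u\<close>; \<open>Loc\<close> collects, below each \<open>u\<close>, a binary tree of leaves whose branches are cliques.\<close>

definition loc_inv :: "node set \<Rightarrow> nat \<Rightarrow> nat \<Rightarrow> nat set list \<Rightarrow> (node \<times> nat list) set \<Rightarrow> nat set list \<Rightarrow> bool" where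
  "loc_inv U a N h Loc h' \<longleftrightarrow> finite Loc \<and> (\<forall>v\<in>Loc. fst v \<in> U) \<and> (\<forall>u\<in>U. (u, []) \<in> Loc) \<and>
    (\<forall>u w x. (u, w @ [x]) \<in> Loc \<longrightarrow> (u, w) \<in> Loc \<and> x \<in> Lf a \<and> x \<notin> \<Union>(set h) \<and> x \<in> \<Union>(set h')) \<and>
    (\<forall>v\<in>Loc. clique (maker_moves h') (insert a (fst (fst v) ` {..<s} \<union> set (snd (fst v)) \<union> set (snd v)))) \<and>
    (\<forall>u w u' w' x. (u, w @ [x]) \<in> Loc \<longrightarrow> (u', w' @ [x]) \<in> Loc \<longrightarrow> u = u' \<and> w = w') \<and>
    (\<forall>v. card (children Loc v) \<le> 2) \<and> (\<forall>v\<in>Loc. length (snd v) \<le> N)"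

lemma loc_invD:
  assumes "loc_inv U a N h Loc h'"
  shows "finite Loc" "\<And>u w. (u, w) \<in> Loc \<Longrightarrow> u \<in> U" "\<And>u. u \<in> U \<Longrightarrow> (u, []) \<in> Loc"
    "\<And>u w x. (u, w @ [x]) \<in> Loc \<Longrightarrow> (u, w) \<in> Loc" "\<And>u w x. (u, w @ [x]) \<in> Loc \<Longrightarrow> x \<in> Lf a"
    "\<And>u w x. (u, w @ [x]) \<in> Loc \<Longrightarrow> x \<notin> \<Union>(set h)"
    "\<And>u w x. (u, w @ [x]) \<in> Loc \<Longrightarrow> x \<in> \<Union>(set h')"
    "\<And>\<tau> p w. ((\<tau>, p), w) \<in> Loc \<Longrightarrow> clique (maker_moves h') (insert a (\<tau> ` {..<s} \<union> set p \<union> set w))"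
    "\<And>u w u' w' x. (u, w @ [x]) \<in> Loc \<Longrightarrow> (u', w' @ [x]) \<in> Loc \<Longrightarrow> u = u' \<and> w = w'"
    "\<And>v. card (children Loc v) \<le> 2" "\<And>u w. (u, w) \<in> Loc \<Longrightarrow> length w \<le> N"
proof -
  from assms have A: "finite Loc" "\<forall>v\<in>Loc. fst v \<in> U" "\<forall>u\<in>U. (u, []) \<in> Loc"
    "\<forall>u w x. (u, w @ [x]) \<in> Loc \<longrightarrow> (u, w) \<in> Loc \<and> x \<in> Lf a \<and> x \<notin> \<Union>(set h) \<and> x \<in> \<Union>(set h')"
    "\<forall>v\<in>Loc. clique (maker_moves h') (insert a (fst (fst v) ` {..<s} \<union> set (snd (fst v)) \<union> set (snd v)))"
    "\<forall>u w u' w' x. (u, w @ [x]) \<in> Loc \<longrightarrow> (u', w' @ [x]) \<in> Loc \<longrightarrow> u = u' \<and> w = w'"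
    "\<forall>v. card (children Loc v) \<le> 2" "\<forall>v\<in>Loc. length (snd v) \<le> N"
    unfolding loc_inv_def by - (elim conjE, assumption)+
  show "finite Loc" by (rule A(1))
  show "u \<in> U" if "(u, w) \<in> Loc" for u w using bspec[OF A(2) that] by simp
  show "(u, []) \<in> Loc" if "u \<in> U" for u using bspec[OF A(3) that] .
  show "clique (maker_moves h') (insert a (\<tau> ` {..<s} \<union> set p \<union> set w))" if "((\<tau>, p), w) \<in> Loc" for \<tau> p w
    using bspec[OF A(5) that] by simp
  show "card (children Loc v) \<le> 2" for v by (rule spec[OF A(7)])
  show "length w \<le> N" if "(u, w) \<in> Loc" for u w using bspec[OF A(8) that] by simp
  show "(u, w) \<in> Loc" "x \<in> Lf a" "x \<notin> \<Union>(set h)" "x \<in> \<Union>(set h')" if "(u, w @ [x]) \<in> Loc" for u w x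
    using A(4)[rule_format, OF that] by - (elim conjE, assumption)+
  show "u = u' \<and> w = w'" if "(u, w @ [x]) \<in> Loc" "(u', w' @ [x]) \<in> Loc" for u w u' w' x
    using A(6) that by blast
qed

definition loc_labels :: "(node \<times> nat list) set \<Rightarrow> nat set" where
  "loc_labels Loc = (\<Union>v. children Loc v)"

lemma card_loc_labels: "finite Loc \<Longrightarrow> finite (loc_labels Loc) \<and> card (loc_labels Loc) \<le> card Loc"
proof -
  have "loc_labels Loc \<subseteq> (\<lambda>v. last (snd v)) ` Loc"
  proof
    fix x assume "x \<in> loc_labels Loc"
    then obtain v where "(fst v, snd v @ [x]) \<in> Loc" by (auto simp: loc_labels_def children_def)
    from imageI[OF this, of "\<lambda>u. last (snd u)"] show "x \<in> (\<lambda>u. last (snd u)) ` Loc" by simp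
  qed
  then show "finite Loc \<Longrightarrow> finite (loc_labels Loc) \<and> card (loc_labels Loc) \<le> card Loc"
    by (meson card_image_le card_mono finite_imageI finite_subset le_trans)
qed

text \<open>Every successful step adds one element to \<open>Loc\<close>, so this cap forces a
  branch with \<open>N\<close> vertices after boundedly many steps.\<close>

lemma loc_card:
  assumes inv: "loc_inv U a N h Loc h'" and "finite U"
  shows "card Loc \<le> card U * 2 ^ Suc N"
proof -
  note L = loc_invD[OF inv]
  have "Loc \<subseteq> (SIGMA u:U. {w. (u, w) \<in> Loc})" using L(2) by auto
  moreover have fin: "finite {w. (u, w) \<in> Loc}" for u
    by (rule finite_subset[of _ "snd ` Loc"]) (auto simp: L(1) intro: rev_image_eqI)
  ultimately have "card Loc \<le> card (SIGMA u:U. {w. (u, w) \<in> Loc})"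
    using assms(2) by (intro card_mono) auto
  also have "\<dots> = (\<Sum>u\<in>U. card {w. (u, w) \<in> Loc})" using assms(2) fin by simp
  also have "\<dots> \<le> (\<Sum>u\<in>U. 2 ^ Suc N)"
  proof (rule sum_mono)
    fix u
    show "card {w. (u, w) \<in> Loc} \<le> 2 ^ Suc N"
    proof (rule binary_tree_card[OF fin])
      show "card {x. w @ [x] \<in> {w. (u, w) \<in> Loc}} \<le> 2" for w
        using L(10)[of "(u, w)"] by (simp add: children_def)
    qed (use L(4,11) in auto)
  qed
  finally show ?thesis by simp
qed

lemma star_ctr:
  assumes \<kappa>: "s \<le> \<kappa>" "\<kappa> < s + t" and a: "a \<in> Ctr \<kappa>"
  shows "a \<notin> centres" "Lf a \<inter> centres = {}" "a \<notin> Lf a"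
proof -
  show "a \<notin> centres"
  proof
    assume "a \<in> centres"
    then obtain i where i: "i < s" "a \<in> Ctr i" by (auto simp: centres_def)
    then have "i = \<kappa>" by (intro ctr_unique[OF i(2) a]) (use \<kappa> in auto)
    then show False using i \<kappa> by simp
  qed
  show "Lf a \<inter> centres = {}"
  proof (rule ccontr)
    assume "Lf a \<inter> centres \<noteq> {}"
    then obtain x i where "x \<in> Lf a" "i < s" "x \<in> Ctr i" by (auto simp: centres_def)
    then show False using lf_ctr[OF \<kappa>(2) _ a, of i] by auto
  qed
  show "a \<notin> Lf a" using lf_ctr[OF \<kappa>(2) \<kappa>(2) a] a by auto
qed

text \<open>The leaf \<open>b\<close> is joined to \<open>a\<close> first. It then wins a tuple
  among those joined to \<open>a\<close>, one of the two children left to it at each full node, and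
  one child of each local node that already has two. Its descent through both trees therefore ends
  at a local node with room for \<open>b\<close>.\<close>

lemma star_step:
  assumes h: "legal E0 h'" and inv: "tree_inv Tau T h" and hx: "h' = h @ y"
    and Ya: "Ya \<subseteq> Tau" "Tau \<subseteq> Tup"
    and num: "0 < card Ya / 2 ^ s - real (n ^ s) / real n - real (n ^ s) / real n ^ 2 * card centres"
    and D: "\<And>u. full T u \<Longrightarrow> D u \<subseteq> children T u \<and> card (D u) = 2"
    and \<kappa>: "s \<le> \<kappa>" "\<kappa> < s + t" and a: "a \<in> Ctr \<kappa>" "a \<notin> \<Union>(set h)"
    and L: "loc_inv (ends T Ya D) a N h Loc h'"
    and short: "\<And>v. v \<in> Loc \<Longrightarrow> length (snd v) < N"
    and b: "b \<in> Lf a" "b \<notin> \<Union>(set h')"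
    and Bz: "card centres + card T + card Loc \<le> Bz"
  shows "force E0 (Suc Bz) (\<lambda>h''. \<exists>Loc'. loc_inv (ends T Ya D) a N h Loc' h'' \<and> card Loc' = Suc (card Loc)) h'"
proof -
  note I = tree_invD[OF inv]
  note LI = loc_invD[OF L]
  let ?U = "ends T Ya D"
  \<comment> \<open>The saturated local nodes; at all others the descent may stop.\<close>
  define LC where "LC = {v. card (children Loc v) = 2}"
  define \<P> where "\<P> = D ` {u. full T u} \<union> children Loc ` LC"
  have PL: "\<Union>\<P> \<subseteq> labels T \<union> loc_labels Loc"
    unfolding \<P>_def loc_labels_def using D children_labels[of T] by blast
  have fP: "finite (\<Union>\<P>)" by (rule finite_subset[OF PL]) (use card_labels[OF I(1)] card_loc_labels[OF LI(1)] in auto)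
  have lT: "x \<in> \<Union>(set h)" "x \<notin> centres" if "x \<in> labels T" for x using labels_inv[OF inv that] by auto
  have lL: "x \<in> Lf a" "x \<notin> \<Union>(set h)" "x \<in> \<Union>(set h')" if "x \<in> loc_labels Loc" for x
    using that LI(5-7) by (auto simp: loc_labels_def children_def)
  have aC: "a \<notin> centres" using star_ctr[OF \<kappa> a(1)] by blast
  have Lfa: "x \<notin> centres \<and> x \<noteq> a" if "x \<in> Lf a" for x using star_ctr[OF \<kappa> a(1)] that by blast
  have sub: "\<Union>(set h) \<subseteq> \<Union>(set h')" using hx by auto
  \<comment> \<open>The tuples in \<open>Ya\<close> need not share a centre, so one element
    prescribes only one coordinate, in contrast to \<open>leaf_force\<close>.\<close>
  let ?D1 = "real (n ^ s) / real n ^ 1" and ?D2 = "real (n ^ s) / real n ^ 2"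
  define k where "k = card Ya / 2 ^ s - ?D1 - ?D2 * card centres"
  have kpos: "0 < k" using num by (simp add: k_def)
  have f: "force E0 (Suc (card (centres \<union> \<Union>\<P>))) (\<lambda>h'. a \<in> maker_nbrs h' b \<and>
     k \<le> card {\<tau>\<in>Ya. \<tau> ` {..<s} \<subseteq> maker_nbrs h' b} \<and> (\<forall>A\<in>\<P>. A \<inter> maker_nbrs h' b \<noteq> {})) h'"
  proof (rule arrive[OF h b(2), where m = s and ?D1.0 = ?D1 and ?D2.0 = ?D2])
    show "a \<noteq> b" using Lfa b(1) by auto
    have YT: "Ya \<subseteq> Tup" using Ya by blast
    then show "finite Ya" using finite_Tup finite_subset by blast
    show "finite centres" by (rule finite_CC)
    show "\<tau> ` {..<s} \<subseteq> centres \<and> card (\<tau> ` {..<s}) \<le> s" if "\<tau> \<in> Ya" for \<tau>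
      using Tup_CC YT that card_image_le[of "{..<s}" \<tau>] by auto
    show "card {\<tau> \<in> Ya. x \<in> \<tau> ` {..<s}} \<le> ?D1" for x
      by (rule Tup_count_le[OF YT, where W = "{x}"]) auto
    show "card {\<tau> \<in> Ya. x \<in> \<tau> ` {..<s} \<and> y \<in> \<tau> ` {..<s}} \<le> ?D2" if "x \<noteq> y" for x y
      by (rule Tup_count_le[OF YT, where W = "{x, y}"]) (use that in auto)
    show "disjoint \<P>"
      unfolding disjoint_def
    proof (intro ballI impI)
      fix A B assume A: "A \<in> \<P>" and B: "B \<in> \<P>" and ne: "A \<noteq> B"
      show "A \<inter> B = {}"
      proof (rule ccontr)
        assume "A \<inter> B \<noteq> {}"
        then obtain x where x: "x \<in> A" "x \<in> B" by blast
        have cs: "(\<exists>u. full T u \<and> C = D u \<and> x \<in> children T u) \<or> (\<exists>v. C = children Loc v \<and> x \<in> children Loc v)"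
          if C: "C \<in> \<P>" "x \<in> C" for C
        proof -
          from C(1) consider u where "full T u" "C = D u" | v where "C = children Loc v"
            unfolding \<P>_def by blast
          then show ?thesis
          proof cases
            case 1
            then have "x \<in> children T u" using D[OF 1(1)] C(2) by blast
            then show ?thesis using 1 by blast
          next
            case 2
            then show ?thesis using C(2) by blast
          qed
        qed
        \<comment> \<open>Labels of \<open>T\<close> were touched before the star entered, local
          labels were not.\<close>
        have exc: "\<not> (x \<in> children T u \<and> x \<in> children Loc v)" for u v
        proof
          assume "x \<in> children T u \<and> x \<in> children Loc v"
          then have "x \<in> labels T" "x \<in> loc_labels Loc" unfolding labels_def loc_labels_def by blast+
          then show False using lT(1) lL(2) by blast
        qed
        from cs[OF A x(1)] cs[OF B x(2)] consider
          u u' where "A = D u" "x \<in> children T u" "B = D u'" "x \<in> children T u'"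
          | v v' where "A = children Loc v" "x \<in> children Loc v" "B = children Loc v'" "x \<in> children Loc v'"
          using exc by blast
        then show False
        proof cases
          case 1
          then show False using children_disjoint[OF inv] ne by blast
        next
          case 2
          then have "v = v'" using LI(9)[of "fst v" "snd v" x "fst v'" "snd v'"] by (auto simp: children_def prod_eq_iff)
          then show False using 2 ne by simp
        qed
      qed
    qed
    show "2 \<le> card A" if "A \<in> \<P>" for A using that D by (auto simp: \<P>_def LC_def)
    show "centres \<inter> \<Union>\<P> = {}" using PL lT(2) lL(1) Lfa by blast
    show "b \<notin> centres \<union> \<Union>\<P>" using PL lT(1) lL(3) sub b Lfa by blast
    show "a \<notin> centres \<union> \<Union>\<P>" using PL lT(1) lL(1) a(2) aC Lfa by blast
  qed (use fP k_def in auto)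
  have "card (centres \<union> \<Union>\<P>) \<le> card centres + card (labels T \<union> loc_labels Loc)"
    using card_Un_le[of centres "\<Union>\<P>"] card_mono[OF _ PL] card_labels[OF I(1)] card_loc_labels[OF LI(1)] by simp
  also have "\<dots> \<le> Bz"
    using card_Un_le[of "labels T" "loc_labels Loc"] card_labels[OF I(1)] card_loc_labels[OF LI(1)] Bz by linarith
  finally have cB: "Suc (card (centres \<union> \<Union>\<P>)) \<le> Suc Bz" by simp
  from force_ext[OF h f]
  have "force E0 (Suc (card (centres \<union> \<Union>\<P>)))
    (\<lambda>h''. \<exists>Loc'. loc_inv ?U a N h Loc' h'' \<and> card Loc' = Suc (card Loc)) h'"
  proof (rule force_mono)
    fix h'' assume A: "(a \<in> maker_nbrs h'' b \<and> k \<le> card {\<tau>\<in>Ya. \<tau> ` {..<s} \<subseteq> maker_nbrs h'' b} \<and> (\<forall>A\<in>\<P>. A \<inter> maker_nbrs h'' b \<noteq> {})) \<and>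
      legal E0 h'' \<and> (\<exists>x. h'' = h' @ x \<and> length x \<le> 2 * Suc (card (centres \<union> \<Union>\<P>)))"
    then obtain x where x: "h'' = h' @ x" by blast
    have ab: "{b, a} \<in> maker_moves h''" using A by (simp add: maker_nbrs_def)
    then have bh'': "b \<in> \<Union>(set h'')" using maker_moves_subset by fast
    have hit: "A \<inter> maker_nbrs h'' b \<noteq> {}" if "A \<in> \<P>" for A using A that by blast
    have mkm: "maker_moves h' \<subseteq> maker_moves h''" unfolding x by (rule maker_moves_append)
    have "0 < card {\<tau>\<in>Ya. \<tau> ` {..<s} \<subseteq> maker_nbrs h'' b}" using A kpos by linarith
    then have "{\<tau>\<in>Ya. \<tau> ` {..<s} \<subseteq> maker_nbrs h'' b} \<noteq> {}" by (metis card.empty less_numeral_extra(3))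
    then obtain \<tau> where \<tau>: "\<tau> \<in> Ya" "\<tau> ` {..<s} \<subseteq> maker_nbrs h'' b" by blast
    have "\<exists>p. (\<tau>, p) \<in> T \<and> \<not> full T (\<tau>, p) \<and>
      (\<forall>i<length p. full T (\<tau>, take i p) \<and> p ! i \<in> D (\<tau>, take i p)) \<and> set p \<subseteq> maker_nbrs h'' b"
    proof (rule walk_tree[OF inv])
      show "\<tau> \<in> Tau" using \<tau>(1) Ya(1) by blast
      show "D u \<subseteq> children T u \<and> D u \<inter> maker_nbrs h'' b \<noteq> {}" if "full T u" for u
        using D[OF that] hit[of "D u"] that by (simp add: \<P>_def)
    qed
    then obtain p where p: "(\<tau>, p) \<in> T" "\<not> full T (\<tau>, p)"
      "\<forall>i<length p. full T (\<tau>, take i p) \<and> p ! i \<in> D (\<tau>, take i p)" "set p \<subseteq> maker_nbrs h'' b" by blast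
    let ?u = "(\<tau>, p)"
    have uU: "?u \<in> ?U" using p \<tau>(1) by (simp add: ends_def)
    define W where "W = {w. (?u, w) \<in> Loc}"
    define des where "des w = (if (?u, w) \<in> LC then children Loc (?u, w) else {})" for w
    have fW: "finite W"
      by (rule finite_subset[of _ "snd ` Loc"]) (auto simp: LI(1) W_def intro: rev_image_eqI)
    have "\<exists>w\<in>W. des w = {} \<and> (\<forall>i<length w. w ! i \<in> maker_nbrs h'' b \<and> w ! i \<in> des (take i w) \<and> take i w \<in> W)"
    proof (rule walk[OF fW])
      show "[] \<in> W" using LI(3)[OF uU] by (simp add: W_def)
      fix w assume "w \<in> W"
      show "des w = {} \<or> (\<exists>x\<in>des w. x \<in> maker_nbrs h'' b \<and> w @ [x] \<in> W)"
      proof (cases "(?u, w) \<in> LC")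
        case True
        then have "children Loc (?u, w) \<in> \<P>" by (simp add: \<P>_def)
        from hit[OF this] obtain x where "x \<in> children Loc (?u, w)" "x \<in> maker_nbrs h'' b" by blast
        then show ?thesis using True by (auto simp: des_def W_def children_def)
      qed (simp add: des_def)
    qed
    then obtain w where w: "w \<in> W" "des w = {}"
      "\<forall>i<length w. w ! i \<in> maker_nbrs h'' b \<and> w ! i \<in> des (take i w) \<and> take i w \<in> W" by blast
    have wL: "(?u, w) \<in> Loc" using w(1) by (simp add: W_def)
    have wn: "set w \<subseteq> maker_nbrs h'' b" using w(3) by (auto simp: in_set_conv_nth)
    have c2: "card (children Loc (?u, w)) \<le> 1"
    proof (rule ccontr)
      assume "\<not> card (children Loc (?u, w)) \<le> 1"
      then have "card (children Loc (?u, w)) = 2" using LI(10)[of "(?u, w)"] by linarith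
      then have "(?u, w) \<in> LC" "children Loc (?u, w) \<noteq> {}" by (auto simp: LC_def)
      then show False using w(2) by (simp add: des_def)
    qed
    let ?v = "(?u, w @ [b])"
    let ?L = "insert ?v Loc"
    have bl: "(u', w' @ [b]) \<notin> Loc" for u' w' using LI(7)[of u' w' b] b(2) by blast
    have vL: "?v \<notin> Loc" using bl .
    have chL: "children ?L v = (if v = (?u, w) then insert b (children Loc v) else children Loc v)" for v
      by (auto simp: children_def prod_eq_iff)
    have cl: "clique (maker_moves h'') (insert b (insert a (\<tau> ` {..<s} \<union> set p \<union> set w)))"
    proof (rule clique_insert)
      show "clique (maker_moves h'') (insert a (\<tau> ` {..<s} \<union> set p \<union> set w))"
        by (rule clique_mono[OF LI(8)[OF wL] mkm order_refl])
      show "{b, y} \<in> maker_moves h''" if "y \<in> insert a (\<tau> ` {..<s} \<union> set p \<union> set w)" for y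
        using that ab \<tau>(2) p(4) wn by (auto simp: maker_nbrs_def)
    qed
    have "loc_inv ?U a N h ?L h''"
      unfolding loc_inv_def
    proof (intro conjI ballI allI impI)
      show "finite ?L" using LI(1) by simp
      show "fst v \<in> ?U" if "v \<in> ?L" for v using that LI(2)[of "fst v" "snd v"] uU by auto
      show "(u, []) \<in> ?L" if "u \<in> ?U" for u using LI(3)[OF that] by simp
      show "clique (maker_moves h'') (insert a (fst (fst v) ` {..<s} \<union> set (snd (fst v)) \<union> set (snd v)))" if "v \<in> ?L" for v
      proof (cases "v = ?v")
        case True
        show ?thesis by (rule clique_mono[OF cl order_refl]) (auto simp: True)
      next
        case False
        then have vv: "((fst (fst v), snd (fst v)), snd v) \<in> Loc" using that by simp
        show ?thesis by (rule clique_mono[OF LI(8)[OF vv] mkm order_refl])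
      qed
      show "card (children ?L v) \<le> 2" for v
      proof (cases "v = (?u, w)")
        case True
        have "card (insert b (children Loc v)) \<le> Suc (card (children Loc v))" by (rule card_insert_le_m1) (use finite_ch[OF LI(1)] in auto)
        then show ?thesis using c2 chL True by simp
      next
        case False
        then show ?thesis using LI(10)[of v] chL by simp
      qed
      show "length (snd v) \<le> N" if "v \<in> ?L" for v
        using that LI(11)[of "fst v" "snd v"] short[OF wL] by auto
      fix u1 w1 y assume y: "(u1, w1 @ [y]) \<in> ?L"
      then have cs: "(u1, w1 @ [y]) \<in> Loc \<or> (u1 = ?u \<and> w1 = w \<and> y = b)" by auto
      show "(u1, w1) \<in> ?L" using cs LI(4)[of u1 w1 y] wL by auto
      show "y \<in> Lf a" using cs LI(5)[of u1 w1 y] b(1) by auto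
      show "y \<notin> \<Union>(set h)" using cs LI(6)[of u1 w1 y] b(2) sub by blast
      show "y \<in> \<Union>(set h'')" using cs LI(7)[of u1 w1 y] bh'' x by auto
      fix u2 w2 assume y2: "(u2, w2 @ [y]) \<in> ?L"
      then have cs2: "(u2, w2 @ [y]) \<in> Loc \<or> (u2 = ?u \<and> w2 = w \<and> y = b)" by auto
      have "u1 = u2 \<and> w1 = w2" using cs cs2 LI(9)[of u1 w1 y u2 w2] bl by blast
      then show "u1 = u2" "w1 = w2" by auto
    qed
    moreover have "card ?L = Suc (card Loc)" using vL LI(1) by simp
    ultimately show "\<exists>Loc'. loc_inv ?U a N h Loc' h'' \<and> card Loc' = Suc (card Loc)" by blast
  qed
  then show ?thesis using cB by (rule force_le)
qed


text \<open>\<open>m\<close> is the number of leaves that may still have to be inserted. The first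
  inequality in the last assumption makes \<open>m\<close> insertions exceed the cap of
  \<open>loc_card\<close>; the second keeps enough untouched leaves in reserve, whatever Breaker
  spoils meanwhile.\<close>

lemma star_iter:
  assumes inv: "tree_inv Tau T h"
    and Ya: "Ya \<subseteq> Tau" "Tau \<subseteq> Tup"
    and num: "0 < card Ya / 2 ^ s - real (n ^ s) / real n - real (n ^ s) / real n ^ 2 * card centres"
    and D: "\<And>u. full T u \<Longrightarrow> D u \<subseteq> children T u \<and> card (D u) = 2"
    and \<kappa>: "s \<le> \<kappa>" "\<kappa> < s + t" and a: "a \<in> Ctr \<kappa>" "a \<notin> \<Union>(set h)"
    and Bz: "Bz = card centres + card T + card T * 2 ^ Suc N"
    and h': "legal E0 h'" "h' = h @ y" "loc_inv (ends T Ya D) a N h Loc h'"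
    and m: "card T * 2 ^ Suc N < card Loc + m" "m * (4 * Suc Bz) < card (Lf a - \<Union>(set h'))"
  shows "force E0 (m * Suc Bz) (\<lambda>h''. \<exists>Loc'. loc_inv (ends T Ya D) a N h Loc' h'' \<and>
    (\<exists>v\<in>Loc'. N \<le> length (snd v))) h'"
  using h' m
proof (induction m arbitrary: h' y Loc)
  case (0 h' y Loc)
  have fT: "finite T" using tree_invD(1)[OF inv] .
  have UT: "ends T Ya D \<subseteq> T" by (auto simp: ends_def)
  then have "card (ends T Ya D) * 2 ^ Suc N \<le> card T * 2 ^ Suc N"
    using card_mono[OF fT UT] by (intro mult_le_mono1)
  then show ?case using loc_card[OF 0(3)] UT fT finite_subset[OF UT fT] 0(4) by linarith
next
  case (Suc m h' y Loc)
  let ?Q = "\<lambda>h''. \<exists>Loc'. loc_inv (ends T Ya D) a N h Loc' h'' \<and> (\<exists>v\<in>Loc'. N \<le> length (snd v))"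
  have fT: "finite T" using tree_invD(1)[OF inv] .
  have UT: "ends T Ya D \<subseteq> T" by (auto simp: ends_def)
  have le: "card Loc \<le> card T * 2 ^ Suc N"
    using loc_card[OF Suc.prems(3) finite_subset[OF UT fT]] card_mono[OF fT UT]
    by (meson le_trans mult_le_mono1)
  show ?case
  proof (cases "\<exists>v\<in>Loc. N \<le> length (snd v)")
    case True
    then have "?Q h'" using Suc.prems(3) by blast
    then have "force E0 0 ?Q h'" by simp
    then show ?thesis by (rule force_le) simp
  next
    case False
    have "Lf a - \<Union>(set h') \<noteq> {}" using Suc.prems(5) by (metis card.empty not_less_zero)
    then obtain b where b: "b \<in> Lf a" "b \<notin> \<Union>(set h')" by blast
    have f: "force E0 (Suc Bz) (\<lambda>h''. \<exists>Loc'. loc_inv (ends T Ya D) a N h Loc' h'' \<and>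
      card Loc' = Suc (card Loc)) h'"
      by (rule star_step[OF Suc.prems(1) inv Suc.prems(2) Ya num D \<kappa> a Suc.prems(3) _ b])
        (use False le Bz in \<open>auto simp: not_le\<close>)
    have "force E0 (Suc Bz + m * Suc Bz) ?Q h'"
    proof (rule force_trans[OF force_ext[OF Suc.prems(1) f]])
      fix h'' assume "(\<exists>Loc'. loc_inv (ends T Ya D) a N h Loc' h'' \<and> card Loc' = Suc (card Loc)) \<and>
        legal E0 h'' \<and> (\<exists>x. h'' = h' @ x \<and> length x \<le> 2 * Suc Bz)"
      then obtain Loc' x where A: "loc_inv (ends T Ya D) a N h Loc' h''" "card Loc' = Suc (card Loc)"
        "legal E0 h''" "h'' = h' @ x" "length x \<le> 2 * Suc Bz" by blast
      have xE: "set x \<subseteq> E0" using A(3,4) by (auto simp: legal_def)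
      note tx = touched_card[OF xE]
      have "Lf a - \<Union>(set h'') = (Lf a - \<Union>(set h')) - \<Union>(set x)" using A(4) by auto
      then have "card (Lf a - \<Union>(set h')) - card (\<Union>(set x)) \<le> card (Lf a - \<Union>(set h''))"
        using diff_card_le_card_Diff[of "\<Union>(set x)" "Lf a - \<Union>(set h')"] tx by simp
      \<comment> \<open>Each of the at most \<open>Suc Bz\<close> rounds claims two edges, and each
        edge touches two vertices.\<close>
      moreover have "card (\<Union>(set x)) \<le> 4 * Suc Bz" using tx A(5) by linarith
      moreover have "Suc m * (4 * Suc Bz) = m * (4 * Suc Bz) + 4 * Suc Bz" by simp
      ultimately have "m * (4 * Suc Bz) < card (Lf a - \<Union>(set h''))" using Suc.prems(5) by linarith
      moreover have "h'' = h @ (y @ x)" using A(4) Suc.prems(2) by simp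
      moreover have "card T * 2 ^ Suc N < card Loc' + m" using Suc.prems(4) A(2) by simp
      ultimately show "force E0 (m * Suc Bz) ?Q h''" using Suc.IH[OF A(3) _ A(1)] by blast
    qed
    then show ?thesis unfolding mult_Suc .
  qed
qed

text \<open>A touched vertex is a leaf of at most one star of kind \<open>\<kappa>\<close>, its
  value under \<open>g\<close>; so finitely many touched vertices spoil only finitely many
  stars.\<close>

lemma fresh_star:
  assumes h: "legal E0 h" and \<kappa>: "s \<le> \<kappa>" "\<kappa> < s + t"
  shows "\<exists>a\<in>Ctr \<kappa>. Z \<le> card (Lf a) \<and> a \<notin> \<Union>(set h) \<and> Lf a \<inter> \<Union>(set h) = {}"
proof -
  let ?V = "\<Union>(set h)"
  have fV: "finite ?V" using touched_card[of h] h by (auto simp: legal_def)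
  define g where "g x = (SOME a. a \<in> Ctr \<kappa> \<and> x \<in> Lf a)" for x
  have g: "g x = a" if "a \<in> Ctr \<kappa>" "x \<in> Lf a" for a x
  proof -
    have "g x \<in> Ctr \<kappa> \<and> x \<in> Lf (g x)" unfolding g_def by (rule someI[of _ a]) (use that in simp)
    then show ?thesis using lf_disj[OF \<kappa>(2) \<kappa>(2), of "g x" a] that by blast
  qed
  have "infinite ({a \<in> Ctr \<kappa>. Z \<le> card (Lf a)} - (?V \<union> g ` ?V))"
    using big_lf[OF \<kappa>] fV by (intro Diff_infinite_finite) auto
  then obtain a where a: "a \<in> {a \<in> Ctr \<kappa>. Z \<le> card (Lf a)} - (?V \<union> g ` ?V)"
    by (metis ex_in_conv finite.emptyI)
  have "Lf a \<inter> ?V = {}"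
  proof (rule ccontr)
    assume "Lf a \<inter> ?V \<noteq> {}"
    then obtain x where "x \<in> Lf a" "x \<in> ?V" by blast
    then have "a \<in> g ` ?V" using g[of a x] a by blast
    then show False using a by blast
  qed
  then show ?thesis using a by blast
qed

text \<open>A branch of \<open>Loc\<close> with \<open>N\<close> vertices is a clique of leaves of \<open>a\<close>, so its vertices can be
  rearranged arbitrarily, in particular as a tree in which every inner node has \<open>q\<close> children.\<close>

lemma star_blob:
  assumes inv: "tree_inv Tau T h" and h2: "h2 = h @ x"
    and \<kappa>: "s \<le> \<kappa>" "\<kappa> < s + t" and a: "a \<in> Ctr \<kappa>" "a \<notin> \<Union>(set h)" "a \<in> \<Union>(set h2)"
    and L: "loc_inv U a N h Loc h2" and w: "((\<tau>, p), w) \<in> Loc" "N \<le> length w"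
    and nf: "(\<tau>, p) \<in> T" "\<not> full T (\<tau>, p)"
    and N: "card {p'. set p' \<subseteq> {..<q} \<and> length p' \<le> blob_size (fst (slot (length p))) - 1} \<le> N"
    and m: "fst (slot (length p)) mod (s + t) = \<kappa>"
  shows "\<exists>S. blob h h2 \<tau> p a S"
proof -
  note I = tree_invD[OF inv]
  note LI = loc_invD[OF L]
  define d where "d = fst (slot (length p))"
  have slot0: "snd (slot (length p)) = 0" using I(11)[OF nf(1)] nf by (auto simp: full_def)
  have slp: "length p = blob_start d" using slot_char[of "length p"] slot0 by (simp add: d_def)
  have "distinct w"
  proof (rule labels_unique_distinct[where W = "{w. ((\<tau>, p), w) \<in> Loc}"])
    show "p1 = p2" if "p1 @ [y] \<in> {w. ((\<tau>, p), w) \<in> Loc}" "p2 @ [y] \<in> {w. ((\<tau>, p), w) \<in> Loc}" for p1 p2 y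
      using that LI(9)[of "(\<tau>, p)" p1 y "(\<tau>, p)" p2] by simp
  qed (use w(1) LI(4) in auto)
  then have cw: "card (set w) = length w" by (rule distinct_card)
  have wlab: "y \<in> Lf a \<and> y \<notin> \<Union>(set h) \<and> y \<in> \<Union>(set h2)" if yw: "y \<in> set w" for y
  proof -
    obtain i where i: "i < length w" "y = w ! i" using yw by (auto simp: in_set_conv_nth)
    have "take i w @ [w ! i] \<in> {w. ((\<tau>, p), w) \<in> Loc}"
      by (rule prefix_closed_nth) (use LI(4) w(1) i(1) in auto)
    then have "((\<tau>, p), take i w @ [y]) \<in> Loc" using i(2) by simp
    then show ?thesis using LI(5-7) by blast
  qed
  \<comment> \<open>The first place of the blob is taken by the centre \<open>a\<close>, which
    leaves depth \<open>blob_size d - 1\<close> for its leaves.\<close>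
  have "card {p'. set p' \<subseteq> {..<q} \<and> length p' \<le> blob_size d - 1} \<le> card (set w)"
    using N w(2) cw unfolding d_def by linarith
  from ary_tree[OF finite_set this] obtain S0 where S0: "finite S0" "[] \<in> S0" "\<forall>v x. v @ [x] \<in> S0 \<longrightarrow> v \<in> S0"
    "\<forall>v v' x. v @ [x] \<in> S0 \<longrightarrow> v' @ [x] \<in> S0 \<longrightarrow> v = v'"
    "\<forall>v\<in>S0. set v \<subseteq> set w \<and> length v \<le> blob_size d - 1 \<and> card {x. v @ [x] \<in> S0} = (if length v < blob_size d - 1 then q else 0)"
    by (elim exE conjE)
  define S where "S = (\<lambda>v. a # v) ` S0"
  have snocS: "(v = [] \<and> x = a) \<or> (\<exists>v'. v = a # v' \<and> v' @ [x] \<in> S0)" if "v @ [x] \<in> S" for v x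
  proof (cases v)
    case Nil
    then show ?thesis using that by (auto simp: S_def)
  next
    case (Cons y v')
    then show ?thesis using that by (auto simp: S_def)
  qed
  have aw: "a \<notin> set w" using wlab star_ctr(3)[OF \<kappa> a(1)] by blast
  have lab0: "x \<in> set w" if "v @ [x] \<in> S0" for v x using S0(5) that by fastforce
  have szd: "0 < blob_size d" by (rule blob_size_pos)
  show ?thesis
  proof (intro exI[of _ S], unfold blob_def d_def[symmetric], intro conjI ballI allI impI)
    show "finite S" using S0(1) by (simp add: S_def)
    show "[] \<notin> S" by (auto simp: S_def)
    show "v = [] \<or> v \<in> S" if "v @ [x] \<in> S" for v x
      using snocS[OF that] S0(3) by (auto simp: S_def)
    show "[x] \<in> S \<longleftrightarrow> x = a" for x using S0(2) by (auto simp: S_def)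
    show "v = v'" if "v @ [x] \<in> S" "v' @ [x] \<in> S" for v v' x
      using snocS[OF that(1)] snocS[OF that(2)] S0(4) aw lab0 by blast
    show "clique (maker_moves h2) (\<tau> ` {..<s} \<union> set p \<union> set v)" if vS: "v \<in> S" for v
    proof -
      obtain v' where v': "v = a # v'" "v' \<in> S0" using vS by (auto simp: S_def)
      then have "set v' \<subseteq> set w" using S0(5) by blast
      then show ?thesis using v'(1) by (intro clique_mono[OF LI(8)[OF w(1)] order_refl]) auto
    qed
    show "length v \<le> blob_size d" if "v \<in> S" for v
      using that S0(5) szd by (fastforce simp: S_def)
    show "card {x. v @ [x] \<in> S} = (if length v < blob_size d then q else 0)" if vS: "v \<in> S" for v
    proof -
      obtain v' where v': "v = a # v'" "v' \<in> S0" using vS by (auto simp: S_def)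
      have "{x. v @ [x] \<in> S} = {x. v' @ [x] \<in> S0}" unfolding v' by (auto simp: S_def)
      then show ?thesis using S0(5) v' szd by auto
    qed
    fix v x assume vx: "v @ [x] \<in> S"
    note sn = snocS[OF vx]
    show "x \<notin> \<Union>(set h)" using sn a(2) lab0 wlab by blast
    show "x \<in> \<Union>(set h2)" using sn a(3) lab0 wlab by blast
    show "x \<notin> centres" using sn star_ctr(1,2)[OF \<kappa> a(1)] lab0 wlab by blast
    have len: "length v < blob_size d"
      using sn
    proof
      assume "\<exists>v'. v = a # v' \<and> v' @ [x] \<in> S0"
      then obtain v' where "v = a # v'" "v' @ [x] \<in> S0" by blast
      then show ?thesis using S0(5) szd by fastforce
    qed (use szd in simp)
    have sl: "slot (length (p @ v)) = (d, length v)" using slot_start[OF len] slp by simp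
    show "label_ok \<tau> (p @ v) x"
      using sn
    proof
      assume "v = [] \<and> x = a"
      then show ?thesis unfolding label_ok_def sl using m a(1) \<kappa> by (simp add: d_def Let_def)
    next
      assume "\<exists>v'. v = a # v' \<and> v' @ [x] \<in> S0"
      then obtain v' where v': "v = a # v'" "v' @ [x] \<in> S0" by blast
      then have "x \<in> Lf a" using lab0 wlab by blast
      then show ?thesis unfolding label_ok_def sl using m \<kappa> v'(1) by (simp add: d_def Let_def)
    qed
  qed
qed

text \<open>The centre has to enter before its leaves, but the node that receives the star is known
  only when enough leaves have gathered there. All sizes are therefore fixed for the whole tree,
  before the star is chosen.\<close>

lemma star_force:
  assumes h: "legal E0 h" and Tau: "Tau \<subseteq> Tup" "real (n ^ s) / 2 ^ (s * s + 1) \<le> card Tau"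
    and inv: "tree_inv Tau T h" and \<kappa>: "s \<le> \<kappa>" "\<kappa> < s + t" and Y0: "Y0 \<subseteq> Tau" "card Y0 = quota Tau"
    and Des: "\<And>u. full T u \<Longrightarrow> Des u \<subseteq> children T u \<and> card (Des u) = 4"
  shows "\<exists>M. force E0 M (outcome T \<kappa> Y0 Des h) h"
proof -
  note I = tree_invD[OF inv]
  \<comment> \<open>The sum over all nodes bounds the size of the blob wanted at whichever node is
    reached.\<close>
  define Lmax where "Lmax = (\<Sum>u\<in>T. blob_size (fst (slot (length (snd u)))))"
  define N where "N = card {p'. set p' \<subseteq> {..<q} \<and> length p' \<le> Lmax}"
  define Bz where "Bz = card centres + card T + card T * 2 ^ Suc N"
  define m where "m = Suc (card T * 2 ^ Suc N)"
  \<comment> \<open>The first summand inside \<open>Suc\<close> covers the vertices touched while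
    \<open>a\<close> is joined to the tree, the second those touched while its leaves
    descend.\<close>
  define Z where "Z = Suc (4 * Suc (card centres + card T) + m * (4 * Suc Bz))"
  obtain a where a: "a \<in> Ctr \<kappa>" "Z \<le> card (Lf a)" "a \<notin> \<Union>(set h)" "Lf a \<inter> \<Union>(set h) = {}"
    using fresh_star[OF h \<kappa>] by blast
  have fLf: "finite (Lf a)" by (rule fin_lf[OF \<kappa> a(1)])
  have "Lf a \<noteq> {}" using a(2) by (auto simp: Z_def)
  \<comment> \<open>\<open>arrive\<close> needs some first edge at the new vertex. For the centre
    \<open>a\<close> one of its own leaves is spent on it; as a touched vertex it is no candidate
    for insertion later.\<close>
  then obtain z where z: "z \<in> Lf a" by blast
  \<comment> \<open>The four offered children are split into two pairs. Pairing gives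
    \<open>a\<close> a neighbour in each, and these two neighbours form the pair that is left to the
    leaves of \<open>a\<close>.\<close>
  have "\<exists>P. fst P \<union> snd P = Des u \<and> fst P \<inter> snd P = {} \<and> card (fst P) = 2 \<and> card (snd P) = 2"
    if u: "full T u" for u
  proof -
    have c: "card (Des u) = 4" using Des[OF u] by simp
    then have f: "finite (Des u)" by (simp add: card_ge_0_finite)
    obtain A where A: "A \<subseteq> Des u" "card A = 2" using obtain_subset_with_card_n[of 2 "Des u"] c by auto
    have "card (Des u - A) = 2" using card_Diff_subset[of A "Des u"] A c f finite_subset by auto
    then show ?thesis using A by (intro exI[of _ "(A, Des u - A)"]) auto
  qed
  then obtain P where P: "\<And>u. full T u \<Longrightarrow> fst (P u) \<union> snd (P u) = Des u \<and> fst (P u) \<inter> snd (P u) = {} \<and>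
    card (fst (P u)) = 2 \<and> card (snd (P u)) = 2" by metis
  have YT: "Y0 \<subseteq> Tup" using Y0(1) Tau(1) by blast
  have fY0: "finite Y0" using YT finite_Tup finite_subset by blast
  let ?D1 = "real (n ^ s) / real n ^ 1" and ?D2 = "real (n ^ s) / real n ^ 2"
  define c0 where "c0 = ?D1 + ?D2 * card centres"
  define k where "k = card Y0 / 2 ^ s - ?D1 - ?D2 * card centres"
  have c0: "c0 \<le> real (n ^ s) / n * real (s + 1)"
  proof -
    have "?D2 * card centres \<le> ?D2 * real (s * n)"
      by (rule mult_left_mono) (simp_all only: of_nat_le_iff card_CC, simp)
    also have "\<dots> = real (n ^ s) / n * s" using n_pos by (simp add: field_simps power2_eq_square)
    finally have "?D2 * card centres \<le> real (n ^ s) / n * s" .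
    moreover have "real (n ^ s) / n * real (s + 1) = real (n ^ s) / n * s + real (n ^ s) / n"
      by (simp only: of_nat_add of_nat_1 distrib_left mult_1_right)
    ultimately show ?thesis unfolding c0_def by simp
  qed
  \<comment> \<open>The leaves play their potential game on the tuples won by \<open>a\<close>, so
    the factor \<open>1 / 2 ^ s\<close> enters twice. Each game subtracts \<open>c0\<close>, and
    \<open>c0 / 2 ^ s + c0\<close> is at most \<open>2 * c0\<close>.\<close>
  have knum: "0 < k / 2 ^ s - c0"
  proof -
    let ?A = "real (n ^ s) / n"
    have t0: "0 < t" using \<kappa> by simp
    define V where "V = quota Tau / 2 ^ s / 2 ^ s"
    have Apos: "0 < ?A" using n_pos by simp
    let ?W = "real (s + t) * 2 ^ (s * s + 2 * s + 2)"
    have "real (s + 1) * ?W < real n" using num_star[OF t0] by (simp only: of_nat_mult mult.assoc)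
    moreover have Wpos: "0 < ?W" using kinds_real by simp
    ultimately have "real (s + 1) < n / ?W" by (simp only: pos_less_divide_eq)
    then have "?A * real (s + 1) < ?A * (n / ?W)" using Apos by (rule mult_strict_left_mono)
    also have "?A * (n / ?W) = real (n ^ s) / ?W" using n_pos by simp
    also have "\<dots> = real (n ^ s) / (2 ^ (s * s + 1) * real (s + t)) / 2 ^ s / 2 ^ s / 2"
      by (simp add: divide_simps power_add mult.commute mult.left_commute power_mult power2_eq_square)
    also have "\<dots> \<le> V / 2"
      unfolding V_def using quota_bounds(1)[OF Tau(2)] by (intro divide_right_mono) auto
    finally have "2 * c0 < V" using c0 by linarith
    moreover have "c0 / 2 ^ s \<le> c0"
    proof -
      have "0 \<le> c0" by (simp add: c0_def)
      moreover have "(1::real) \<le> 2 ^ s" by simp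
      ultimately have "c0 * 1 \<le> c0 * 2 ^ s" by (intro mult_left_mono)
      then show ?thesis by (simp add: pos_divide_le_eq)
    qed
    moreover have "k / 2 ^ s = V - c0 / 2 ^ s"
      unfolding k_def c0_def V_def Y0(2) by (simp add: diff_divide_distrib add_divide_distrib)
    ultimately show ?thesis by linarith
  qed
  define \<P> where "\<P> = (\<lambda>u. fst (P u)) ` {u. full T u} \<union> (\<lambda>u. snd (P u)) ` {u. full T u}"
  have PD: "\<exists>u. full T u \<and> A \<subseteq> children T u \<and> card A = 2 \<and> (A = fst (P u) \<or> A = snd (P u))" if AP: "A \<in> \<P>" for A
  proof -
    obtain u where u: "full T u" "A = fst (P u) \<or> A = snd (P u)" using AP unfolding \<P>_def by blast
    then show ?thesis using P[OF u(1)] Des[OF u(1)] by blast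
  qed
  have PL: "\<Union>\<P> \<subseteq> labels T" using PD children_labels[of T] by blast
  have fP: "finite (\<Union>\<P>)" by (rule finite_subset[OF PL]) (use card_labels[OF I(1)] in auto)
  have lT: "x \<in> \<Union>(set h)" "x \<notin> centres" if "x \<in> labels T" for x using labels_inv[OF inv that] by auto
  note sc = star_ctr[OF \<kappa> a(1)]
  have f: "force E0 (Suc (card (centres \<union> \<Union>\<P>))) (\<lambda>h'. z \<in> maker_nbrs h' a \<and>
     k \<le> card {\<tau>\<in>Y0. \<tau> ` {..<s} \<subseteq> maker_nbrs h' a} \<and> (\<forall>A\<in>\<P>. A \<inter> maker_nbrs h' a \<noteq> {})) h"
  proof (rule arrive[OF h a(3), where m = s and ?D1.0 = ?D1 and ?D2.0 = ?D2])
    show "z \<noteq> a" using sc(3) z by auto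
    show "finite Y0" by (rule fY0)
    show "finite centres" by (rule finite_CC)
    show "\<tau> ` {..<s} \<subseteq> centres \<and> card (\<tau> ` {..<s}) \<le> s" if "\<tau> \<in> Y0" for \<tau>
      using Tup_CC YT that card_image_le[of "{..<s}" \<tau>] by auto
    show "card {\<tau> \<in> Y0. x \<in> \<tau> ` {..<s}} \<le> ?D1" for x
      by (rule Tup_count_le[OF YT, where W = "{x}"]) auto
    show "card {\<tau> \<in> Y0. x \<in> \<tau> ` {..<s} \<and> y \<in> \<tau> ` {..<s}} \<le> ?D2" if "x \<noteq> y" for x y
      by (rule Tup_count_le[OF YT, where W = "{x, y}"]) (use that in auto)
    show "disjoint \<P>"
      unfolding disjoint_def
    proof (intro ballI impI)
      fix A B assume A: "A \<in> \<P>" and B: "B \<in> \<P>" and ne: "A \<noteq> B"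
      show "A \<inter> B = {}"
      proof (rule ccontr)
        assume "A \<inter> B \<noteq> {}"
        then obtain x where x: "x \<in> A" "x \<in> B" by blast
        obtain u where u: "full T u" "A \<subseteq> children T u" "A = fst (P u) \<or> A = snd (P u)" using PD[OF A] by blast
        obtain v where v: "full T v" "B \<subseteq> children T v" "B = fst (P v) \<or> B = snd (P v)" using PD[OF B] by blast
        have "u = v" using children_disjoint[OF inv, of x u v] x u(2) v(2) by blast
        then show False using u v ne x P[OF u(1)] by blast
      qed
    qed
    show "2 \<le> card A" if "A \<in> \<P>" for A using PD[OF that] by auto
    show "centres \<inter> \<Union>\<P> = {}" using PL lT(2) by blast
    show "a \<notin> centres \<union> \<Union>\<P>" using PL lT(1) a(3) sc(1) by blast
    show "z \<notin> centres \<union> \<Union>\<P>" using PL lT(1) a(4) sc(2) z by blast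
  qed (use fP k_def in auto)
  have "force E0 (Suc (card (centres \<union> \<Union>\<P>)) + m * Suc Bz) (outcome T \<kappa> Y0 Des h) h"
  proof (rule force_trans[OF force_ext[OF h f]])
    fix h1 assume A: "(z \<in> maker_nbrs h1 a \<and> k \<le> card {\<tau>\<in>Y0. \<tau> ` {..<s} \<subseteq> maker_nbrs h1 a} \<and> (\<forall>A\<in>\<P>. A \<inter> maker_nbrs h1 a \<noteq> {})) \<and>
      legal E0 h1 \<and> (\<exists>x. h1 = h @ x \<and> length x \<le> 2 * Suc (card (centres \<union> \<Union>\<P>)))"
    then obtain x where x: "h1 = h @ x" "length x \<le> 2 * Suc (card (centres \<union> \<Union>\<P>))" by blast
    have l1: "legal E0 h1" using A by blast
    have az: "{a, z} \<in> maker_moves h1" using A by (simp add: maker_nbrs_def)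
    then have ah1: "a \<in> \<Union>(set h1)" using maker_moves_subset by fast
    have xne: "x \<noteq> []" using ah1 a(3) x(1) by auto
    have mk1: "maker_moves h \<subseteq> maker_moves h1" unfolding x(1) by (rule maker_moves_append)
    define Ya where "Ya = {\<tau>\<in>Y0. \<tau> ` {..<s} \<subseteq> maker_nbrs h1 a}"
    have "\<exists>D. D \<subseteq> Des u \<inter> maker_nbrs h1 a \<and> card D = 2" if u: "full T u" for u
    proof -
      have "fst (P u) \<in> \<P>" "snd (P u) \<in> \<P>" using u by (auto simp: \<P>_def)
      then obtain x1 x2 where "x1 \<in> fst (P u) \<inter> maker_nbrs h1 a" "x2 \<in> snd (P u) \<inter> maker_nbrs h1 a" using A by blast
      then have "{x1, x2} \<subseteq> Des u \<inter> maker_nbrs h1 a \<and> x1 \<noteq> x2" using P[OF u] by blast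
      then show ?thesis by (intro exI[of _ "{x1, x2}"]) simp
    qed
    then obtain D where D: "\<And>u. full T u \<Longrightarrow> D u \<subseteq> Des u \<inter> maker_nbrs h1 a \<and> card (D u) = 2" by metis
    have D': "D u \<subseteq> children T u \<and> card (D u) = 2" if "full T u" for u using D[OF that] Des[OF that] by blast
    let ?U = "ends T Ya D"
    \<comment> \<open>At first only the roots of the local trees are present, one for each end that
      a leaf of \<open>a\<close> can reach.\<close>
    define Loc where "Loc = (\<lambda>u. (u, [] :: nat list)) ` ?U"
    have UT: "?U \<subseteq> T" by (auto simp: ends_def)
    have Ya: "Ya \<subseteq> Tau" using Y0(1) by (auto simp: Ya_def)
    have kY: "k \<le> card Ya" using A by (simp add: Ya_def)
    have num: "0 < card Ya / 2 ^ s - real (n ^ s) / real n - real (n ^ s) / real n ^ 2 * card centres"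
    proof -
      have "k / 2 ^ s \<le> card Ya / 2 ^ s" using kY by (rule divide_right_mono) simp
      then show ?thesis using knum unfolding c0_def by simp
    qed
    have L: "loc_inv ?U a N h Loc h1"
      unfolding loc_inv_def
    proof (intro conjI ballI allI impI)
      show "finite Loc" unfolding Loc_def using finite_subset[OF UT I(1)] by simp
      have chL: "children Loc v = {}" for v by (auto simp: Loc_def children_def)
      show "card (children Loc v) \<le> 2" for v by (simp add: chL)
      show "clique (maker_moves h1) (insert a (fst (fst v) ` {..<s} \<union> set (snd (fst v)) \<union> set (snd v)))"
        if vL: "v \<in> Loc" for v
      proof -
        obtain \<tau> p where v: "v = ((\<tau>, p), [])" "(\<tau>, p) \<in> ?U" using vL by (auto simp: Loc_def)
        have U: "(\<tau>, p) \<in> T" "\<tau> \<in> Ya" "\<forall>i<length p. full T (\<tau>, take i p) \<and> p ! i \<in> D (\<tau>, take i p)"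
          using v(2) by (auto simp: ends_def)
        have "set p \<subseteq> maker_nbrs h1 a" using U(3) D by (fastforce simp: in_set_conv_nth)
        then have "clique (maker_moves h1) (insert a (\<tau> ` {..<s} \<union> set p))"
          using U(2) by (intro clique_insert clique_mono[OF I(8)[OF U(1)] mk1 order_refl])
            (auto simp: Ya_def maker_nbrs_def)
        then show ?thesis using v by simp
      qed
    qed (auto simp: Loc_def)
    have "card (\<Union>\<P>) \<le> card T" using card_mono[OF _ PL] card_labels[OF I(1)] by linarith
    then have "card (centres \<union> \<Union>\<P>) \<le> card centres + card T"
      by (rule order_trans[OF card_Un_le add_left_mono])
    then have "2 * Suc (card (centres \<union> \<Union>\<P>)) \<le> 2 * Suc (card centres + card T)" by simp
    then have "length x \<le> 2 * Suc (card centres + card T)" by (rule order_trans[OF x(2)])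
    moreover have "set x \<subseteq> E0" using l1 x(1) by (auto simp: legal_def)
    note tx = touched_card[OF this]
    ultimately have cx: "card (\<Union>(set x)) \<le> 4 * Suc (card centres + card T)" by linarith
    have "Lf a - \<Union>(set h1) = Lf a - \<Union>(set x)" using a(4) x(1) by auto
    then have "card (Lf a) - card (\<Union>(set x)) \<le> card (Lf a - \<Union>(set h1))"
      using diff_card_le_card_Diff[of "\<Union>(set x)" "Lf a"] tx by simp
    then have fresh: "m * (4 * Suc Bz) < card (Lf a - \<Union>(set h1))" using cx a(2) unfolding Z_def by linarith
    have g: "force E0 (m * Suc Bz) (\<lambda>h''. \<exists>Loc'. loc_inv ?U a N h Loc' h'' \<and>
      (\<exists>v\<in>Loc'. N \<le> length (snd v))) h1"
      by (rule star_iter[OF inv Ya Tau(1) num D' \<kappa> a(1,3) Bz_def l1 x(1) L _ fresh]) (simp_all add: m_def)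
    show "force E0 (m * Suc Bz) (outcome T \<kappa> Y0 Des h) h1"
    proof (rule force_mono[OF force_ext[OF l1 g]])
      fix h2 assume B: "(\<exists>Loc'. loc_inv ?U a N h Loc' h2 \<and> (\<exists>v\<in>Loc'. N \<le> length (snd v))) \<and>
        legal E0 h2 \<and> (\<exists>x. h2 = h1 @ x \<and> length x \<le> 2 * (m * Suc Bz))"
      then obtain Loc' \<tau> p w y where L': "loc_inv ?U a N h Loc' h2" "((\<tau>, p), w) \<in> Loc'" "N \<le> length w"
        "h2 = h1 @ y" by auto
      have "(\<tau>, p) \<in> ?U" using loc_invD(2)[OF L'(1,2)] .
      then have U: "(\<tau>, p) \<in> T" "\<not> full T (\<tau>, p)" "\<tau> \<in> Ya"
        "\<forall>i<length p. full T (\<tau>, take i p) \<and> p ! i \<in> D (\<tau>, take i p)"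
        by (auto simp: ends_def)
      have h2: "h2 = h @ (x @ y)" using L'(4) x(1) by simp
      have ah2: "a \<in> \<Union>(set h2)" using ah1 L'(4) by auto
      have "blob_size (fst (slot (length (snd (\<tau>, p))))) \<le> Lmax"
        unfolding Lmax_def by (rule member_le_sum[OF U(1)]) (simp_all add: I(1))
      then have "{p'. set p' \<subseteq> {..<q} \<and> length p' \<le> blob_size (fst (slot (length p))) - 1} \<subseteq>
        {p'. set p' \<subseteq> {..<q} \<and> length p' \<le> Lmax}" by auto
      then have cN: "card {p'. set p' \<subseteq> {..<q} \<and> length p' \<le> blob_size (fst (slot (length p))) - 1} \<le> N"
        unfolding N_def by (rule card_mono[rotated]) (rule finite_lists_length_le, simp)
      have "fst (slot (length p)) mod (s + t) = \<kappa> \<longrightarrow> (\<exists>a S. blob h h2 \<tau> p a S)"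
        using star_blob[OF inv h2 \<kappa> a(1,3) ah2 L'(1-3) U(1,2) cN] by blast
      moreover have "length h < length h2" "\<exists>x. h2 = h @ x" using h2 xne by auto
      moreover have "\<forall>i<length p. full T (\<tau>, take i p) \<and> p ! i \<in> Des (\<tau>, take i p)" using U(4) D by blast
      moreover have "\<tau> \<in> Y0" using U(3) by (simp add: Ya_def)
      ultimately show "outcome T \<kappa> Y0 Des h h2" unfolding outcome_def using U(1,2) by blast
    qed
  qed
  then show ?thesis by blast
qed


section \<open>Fair rounds and the infinite branch\<close>

definition visits :: "node \<Rightarrow> node \<Rightarrow> bool" where
  "visits u e \<longleftrightarrow> fst e = fst u \<and> (\<exists>w. snd e = snd u @ w)"

definition extend :: "node \<Rightarrow> nat \<Rightarrow> node" where "extend u x = (fst u, snd u @ [x])"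

text \<open>Counted for each kind separately, since many visits by some kinds could otherwise hide
  that another kind stays away.\<close>

definition visit_count :: "node list \<Rightarrow> nat \<Rightarrow> node \<Rightarrow> nat" where
  "visit_count es \<kappa> u = card {r. r < length es \<and> r mod (s + t) = \<kappa> \<and> visits u (es ! r)}"

text \<open>A leaf needs one pair at a node. A star centre needs two pairs, because two of its
  neighbours must be left for its own leaves to choose from.\<close>

definition offer_size :: "nat \<Rightarrow> nat" where "offer_size \<kappa> = (if \<kappa> < s then 2 else 4)"

text \<open>Keeps of a round only what the fairness argument uses. \<open>es\<close> lists the nodes
  at which the earlier rounds ended, so its length determines the kind whose turn it is, and
  \<open>e\<close> is the node at which this round ends.\<close>

definition round_rel :: "(nat \<Rightarrow> nat) set \<Rightarrow> node set \<Rightarrow> node list \<Rightarrow> node set \<Rightarrow> node \<Rightarrow> bool" where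
  "round_rel Tau T es T' e \<longleftrightarrow> (let \<kappa> = length es mod (s + t) in
     T \<subseteq> T' \<and> e \<in> T \<and> \<not> full T e \<and>
     (\<exists>Y. least_in Tau (\<lambda>\<tau>. visit_count es \<kappa> (\<tau>, [])) (quota Tau) Y \<and> fst e \<in> Y) \<and>
     (\<forall>i<length (snd e). full T (fst e, take i (snd e)) \<and>
       (\<exists>Y. least_in (children T (fst e, take i (snd e))) (\<lambda>x. visit_count es \<kappa> (extend (fst e, take i (snd e)) x)) (offer_size \<kappa>) Y \<and>
          snd e ! i \<in> Y)) \<and>
     (fst (slot (length (snd e))) mod (s + t) = \<kappa> \<longrightarrow> card (children T' e) = Suc (card (children T e))))"

lemma offer_size_le_q: "\<kappa> < s + t \<Longrightarrow> offer_size \<kappa> \<le> q"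
  by (auto simp: offer_size_def q_def)

lemma round_force:
  assumes h: "legal E0 h" and Tau: "Tau \<subseteq> Tup" "real (n ^ s) / 2 ^ (s * s + 1) \<le> card Tau"
    and inv: "tree_inv Tau T h"
  shows "\<exists>N. force E0 N (\<lambda>h'. length h < length h' \<and> (\<exists>T' e. tree_inv Tau T' h' \<and> round_rel Tau T es T' e)) h"
proof -
  define \<kappa> where "\<kappa> = length es mod (s + t)"
  have \<kappa>K: "\<kappa> < s + t" using kinds by (simp add: \<kappa>_def)
  have fTau: "finite Tau" using Tau(1) finite_Tup finite_subset by blast
  obtain Y0 where Y0: "least_in Tau (\<lambda>\<tau>. visit_count es \<kappa> (\<tau>, [])) (quota Tau) Y0"
    using least_subset[OF fTau quota_bounds(3)[OF Tau(2)], of "\<lambda>\<tau>. visit_count es \<kappa> (\<tau>, [])"]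
    unfolding least_in_def by blast
  have "\<exists>Y. least_in (children T u) (\<lambda>x. visit_count es \<kappa> (extend u x)) (offer_size \<kappa>) Y" if u: "full T u" for u
  proof -
    have "offer_size \<kappa> \<le> card (children T u)" using u offer_size_le_q[OF \<kappa>K] by (simp add: full_def)
    from least_subset[OF finite_ch[OF tree_invD(1)[OF inv]] this, of "\<lambda>x. visit_count es \<kappa> (extend u x)"]
    show ?thesis unfolding least_in_def by blast
  qed
  then obtain Des where Des: "\<And>u. full T u \<Longrightarrow> least_in (children T u) (\<lambda>x. visit_count es \<kappa> (extend u x)) (offer_size \<kappa>) (Des u)"
    by metis
  have Y0': "Y0 \<subseteq> Tau" "card Y0 = quota Tau" using Y0 by (auto simp: least_in_def)
  have Des': "Des u \<subseteq> children T u \<and> card (Des u) = offer_size \<kappa>" if "full T u" for u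
    using Des[OF that] by (simp add: least_in_def)
  have "\<exists>N. force E0 N (outcome T \<kappa> Y0 Des h) h"
  proof (cases "\<kappa> < s")
    case True
    show ?thesis by (rule leaf_force[OF h Tau inv True Y0']) (use Des' True in \<open>simp add: offer_size_def\<close>)
  next
    case False
    then show ?thesis
      by (intro star_force[OF h Tau inv _ \<kappa>K Y0']) (use Des' False in \<open>simp_all add: offer_size_def\<close>)
  qed
  then obtain N where N: "force E0 N (outcome T \<kappa> Y0 Des h) h" by blast
  have "force E0 N (\<lambda>h'. length h < length h' \<and> (\<exists>T' e. tree_inv Tau T' h' \<and> round_rel Tau T es T' e)) h"
  proof (rule force_mono[OF N])
    fix h' assume "outcome T \<kappa> Y0 Des h h'"
    then obtain \<tau> p x where o: "length h < length h'" "h' = h @ x" "\<tau> \<in> Y0" "(\<tau>, p) \<in> T" "\<not> full T (\<tau>, p)"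
      "\<forall>i<length p. full T (\<tau>, take i p) \<and> p ! i \<in> Des (\<tau>, take i p)"
      "fst (slot (length p)) mod (s + t) = \<kappa> \<longrightarrow> (\<exists>a S. blob h h' \<tau> p a S)"
      unfolding outcome_def by blast
    have nf: "card (children T (\<tau>, p)) \<noteq> q" using o(4,5) by (simp add: full_def)
    have "\<exists>T'. T \<subseteq> T' \<and> tree_inv Tau T' h' \<and>
      (fst (slot (length p)) mod (s + t) = \<kappa> \<longrightarrow> card (children T' (\<tau>, p)) = Suc (card (children T (\<tau>, p))))"
    proof (cases "fst (slot (length p)) mod (s + t) = \<kappa>")
      case False
      then show ?thesis using tree_inv_mono[OF inv, of x] o(2) by blast
    next
      case True
      then obtain a S where B: "blob h h' \<tau> p a S" using o(7) by blast
      note A = add_blob[OF inv o(4) nf refl o(2), of S a]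
      let ?T = "T \<union> (\<lambda>w. (\<tau>, p @ w)) ` S"
      have "tree_inv Tau ?T h'" by (rule A(1)) (use B in \<open>unfold blob_def, blast+\<close>)
      moreover have "card (children ?T (\<tau>, p)) = Suc (card (children T (\<tau>, p)))"
        by (rule A(2)) (use B in \<open>unfold blob_def, blast+\<close>)
      ultimately show ?thesis by blast
    qed
    then obtain T' where T': "T \<subseteq> T'" "tree_inv Tau T' h'"
      "fst (slot (length p)) mod (s + t) = \<kappa> \<longrightarrow> card (children T' (\<tau>, p)) = Suc (card (children T (\<tau>, p)))" by blast
    have "round_rel Tau T es T' (\<tau>, p)"
      unfolding round_rel_def Let_def \<kappa>_def[symmetric] fst_conv snd_conv
    proof (intro conjI allI impI)
      show "\<exists>Y. least_in Tau (\<lambda>\<tau>. visit_count es \<kappa> (\<tau>, [])) (quota Tau) Y \<and> \<tau> \<in> Y" using Y0 o(3) by blast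
      show "full T (\<tau>, take i p)" if "i < length p" for i using o(6) that by blast
      show "\<exists>Y. least_in (children T (\<tau>, take i p)) (\<lambda>x. visit_count es \<kappa> (extend (\<tau>, take i p) x)) (offer_size \<kappa>) Y \<and> p ! i \<in> Y"
        if "i < length p" for i using o(6) that Des by blast
    qed (use T' o(4,5) in simp_all)
    then show "length h < length h' \<and> (\<exists>T' e. tree_inv Tau T' h' \<and> round_rel Tau T es T' e)"
      using T'(2) o(1) by blast
  qed
  then show ?thesis by blast
qed

text \<open>Each kind starves fewer than \<open>offer_size \<kappa>\<close> children of a node that it visits infinitely often;
  as \<open>q\<close> exceeds the total number of starved children, some child is again visited infinitely often by all kinds.\<close>

lemma branch:
  fixes T :: "nat \<Rightarrow> node set" and e :: "nat \<Rightarrow> node"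
  assumes Tau: "Tau \<subseteq> Tup" "real (n ^ s) / 2 ^ (s * s + 1) \<le> card Tau"
    and inv: "\<And>r. tree_inv Tau (T r) (h r)"
    and round_rel: "\<And>r. round_rel Tau (T r) (map e [0..<r]) (T (Suc r)) (e r)"
  shows "\<exists>\<tau>\<in>Tau. \<exists>x. \<forall>l. \<exists>r. (\<tau>, map x [0..<l]) \<in> T r"
proof -
  define W where "W \<kappa> u = {r. r mod (s + t) = \<kappa> \<and> visits u (e r)}" for \<kappa> u
  define good where "good u \<longleftrightarrow> (\<forall>\<kappa><s + t. infinite (W \<kappa> u))" for u
  have cntW: "visit_count (map e [0..<r]) \<kappa> u = card (W \<kappa> u \<inter> {..<r})" for r \<kappa> u
    unfolding visit_count_def by (rule arg_cong[of _ _ card]) (auto simp: W_def)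
  have Tmono: "T r \<subseteq> T r'" if "r \<le> r'" for r r'
    using that
  proof (induction rule: dec_induct)
    case (step m)
    then show ?case using round_rel[of m] by (auto simp: round_rel_def Let_def)
  qed simp
  have chmono: "children (T r) u \<subseteq> children (T r') u" if "r \<le> r'" for r r' u
    using Tmono[OF that] by (auto simp: children_def)
  have fch: "finite (children (T r) u)" for r u by (rule finite_ch[OF tree_invD(1)[OF inv]])
  have fTau: "finite Tau" using Tau(1) finite_Tup finite_subset by blast
  have infk: "infinite {r. r mod (s + t) = \<kappa>}" if "\<kappa> < s + t" for \<kappa>
    unfolding infinite_nat_iff_unbounded_le
  proof
    fix m
    have "(m * (s + t) + \<kappa>) mod (s + t) = \<kappa>" using that by simp
    moreover have "m * 1 \<le> m * (s + t)" by (rule mult_le_mono2) (use kinds in linarith)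
    then have "m \<le> m * (s + t) + \<kappa>" by linarith
    ultimately show "\<exists>r\<ge>m. r \<in> {r. r mod (s + t) = \<kappa>}" by blast
  qed
  \<comment> \<open>The tuples are treated like the children of a single node, with
    \<open>quota Tau\<close> of them offered in every round.\<close>
  have root: "\<exists>\<tau>\<in>Tau. good (\<tau>, [])"
  proof (rule ccontr)
    assume neg: "\<not> (\<exists>\<tau>\<in>Tau. good (\<tau>, []))"
    define F where "F \<kappa> = {\<tau>\<in>Tau. finite (W \<kappa> (\<tau>, []))}" for \<kappa>
    have cF: "card (F \<kappa>) \<le> quota Tau - 1" if k: "\<kappa> < s + t" for \<kappa>
    proof -
      have "card (F \<kappa>) < quota Tau" unfolding F_def
      proof (rule fair_choice[OF fTau infk[OF k]])
        fix r assume r: "r \<in> {r. r mod (s + t) = \<kappa>}"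
        then obtain Y where Y: "least_in Tau (\<lambda>\<tau>. visit_count (map e [0..<r]) \<kappa> (\<tau>, [])) (quota Tau) Y" "fst (e r) \<in> Y"
          using round_rel[of r] by (auto simp: round_rel_def Let_def)
        have "r \<in> W \<kappa> (fst (e r), [])" using r by (simp add: W_def visits_def)
        then show "\<exists>Y\<subseteq>Tau. card Y = quota Tau \<and> (\<forall>y\<in>Y. \<forall>z\<in>Tau - Y.
          card (W \<kappa> (y, []) \<inter> {..<r}) \<le> card (W \<kappa> (z, []) \<inter> {..<r})) \<and> (\<exists>y\<in>Y. r \<in> W \<kappa> (y, []))"
          using Y unfolding least_in_def cntW by blast
      qed
      then show ?thesis by simp
    qed
    have "Tau \<subseteq> (\<Union>\<kappa><s + t. F \<kappa>)" using neg by (auto simp: good_def F_def)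
    then have "card Tau \<le> card (\<Union>\<kappa><s + t. F \<kappa>)" using fTau by (intro card_mono) (auto simp: F_def)
    also have "\<dots> \<le> (\<Sum>\<kappa><s + t. card (F \<kappa>))" by (rule card_UN_le) simp
    also have "\<dots> \<le> (\<Sum>\<kappa><s + t. quota Tau - 1)" by (rule sum_mono) (use cF in simp)
    also have "\<dots> = (s + t) * (quota Tau - 1)" by simp
    finally show False using quota_bounds(2)[OF Tau(2)] by linarith
  qed
  have fullmono: "full (T r') u \<and> children (T r') u = children (T r) u" if "full (T r) u" "r \<le> r'" for r r' u
  proof -
    have u: "u \<in> T r'" using that Tmono by (auto simp: full_def)
    have "card (children (T r') u) \<le> card (children (T r) u)"
      using tree_invD(10)[OF inv u] that(1) by (simp add: full_def)
    then have "children (T r) u = children (T r') u" using chmono[OF that(2)] fch by (metis card_seteq)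
    then show ?thesis using that(1) u by (simp add: full_def)
  qed
  \<comment> \<open>A descent continues only from full nodes, so it cannot pass through
    \<open>u\<close>.\<close>
  have visit_end: "e r = u" if nf: "\<not> full (T r) u" and v: "visits u (e r)" for r u
  proof -
    obtain w where w: "fst (e r) = fst u" "snd (e r) = snd u @ w" using v by (auto simp: visits_def)
    have "w = []"
    proof (rule ccontr)
      assume "w \<noteq> []"
      then have "length (snd u) < length (snd (e r))" using w(2) by simp
      then have "full (T r) (fst (e r), take (length (snd u)) (snd (e r)))"
        using round_rel[of r] by (auto simp: round_rel_def Let_def)
      then show False using nf w by simp
    qed
    then show ?thesis using w by (simp add: prod_eq_iff)
  qed
  \<comment> \<open>The kind wanted at \<open>u\<close> visits \<open>u\<close> infinitely often,
    and as long as \<open>u\<close> is not full each of these visits ends there and adds a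
    child.\<close>
  have fills: "\<exists>r. full (T r) u" if g: "good u" and u: "u \<in> T r0" for u r0
  proof (rule ccontr)
    assume neg: "\<not> (\<exists>r. full (T r) u)"
    define \<kappa> where "\<kappa> = fst (slot (length (snd u))) mod (s + t)"
    have k: "\<kappa> < s + t" using kinds by (simp add: \<kappa>_def)
    have "\<exists>r\<ge>r0. m \<le> card (children (T r) u)" for m
    proof (induction m)
      case (Suc m)
      then obtain r where r: "r \<ge> r0" "m \<le> card (children (T r) u)" by blast
      have "infinite (W \<kappa> u)" using g k by (simp add: good_def)
      then obtain r' where r': "r' \<ge> r" "r' \<in> W \<kappa> u" unfolding infinite_nat_iff_unbounded_le by blast
      then have "e r' = u" using visit_end[of r' u] neg by (auto simp: W_def)
      then have "card (children (T (Suc r')) u) = Suc (card (children (T r') u))"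
        using round_rel[of r'] r'(2) by (auto simp: round_rel_def Let_def \<kappa>_def W_def)
      moreover have "card (children (T r) u) \<le> card (children (T r') u)"
        using chmono[OF r'(1)] fch by (intro card_mono)
      ultimately show ?case using r r'(1) by (intro exI[of _ "Suc r'"]) auto
    qed auto
    then obtain r where r: "r \<ge> r0" "Suc q \<le> card (children (T r) u)" by blast
    then show False using tree_invD(10)[OF inv[of r], of u] u Tmono[OF r(1)] by auto
  qed
  have child: "\<exists>x. good (extend u x) \<and> (\<exists>r. extend u x \<in> T r)" if g: "good u" and u: "u \<in> T r0" for u r0
  proof -
    obtain r1 where r1: "full (T r1) u" using fills[OF g u] by blast
    let ?X = "children (T r1) u"
    define F where "F \<kappa> = {x\<in>?X. finite (W \<kappa> (extend u x))}" for \<kappa>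
    have cF: "card (F \<kappa>) \<le> offer_size \<kappa> - 1" if k: "\<kappa> < s + t" for \<kappa>
    proof -
      have "infinite (W \<kappa> u)" using g k by (simp add: good_def)
      \<comment> \<open>Only visits after \<open>u\<close> became full count: from then on its set
        of children is final, and every visit proceeds to one of them.\<close>
      then have "infinite (W \<kappa> u - {..<r1})" by simp
      then have "card (F \<kappa>) < offer_size \<kappa>" unfolding F_def
      proof (rule fair_choice[OF fch])
        fix r assume r: "r \<in> W \<kappa> u - {..<r1}"
        then have fr: "full (T r) u" "children (T r) u = ?X" using fullmono[OF r1, of r] by auto
        obtain w where w: "fst (e r) = fst u" "snd (e r) = snd u @ w"
          using r by (auto simp: W_def visits_def)
        have "w \<noteq> []"
        proof
          assume "w = []"
          then have "e r = u" using w by (simp add: prod_eq_iff)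
          then show False using round_rel[of r] fr(1) by (simp add: round_rel_def Let_def)
        qed
        then obtain y w' where y: "w = y # w'" by (cases w) auto
        have i: "length (snd u) < length (snd (e r))" using w(2) y by simp
        have eq: "(fst (e r), take (length (snd u)) (snd (e r))) = u" using w by simp
        have ey: "snd (e r) ! length (snd u) = y" using w(2) y by simp
        have rk: "r mod (s + t) = \<kappa>" using r by (simp add: W_def)
        have "\<exists>Y. least_in (children (T r) u) (\<lambda>x. visit_count (map e [0..<r]) \<kappa> (extend u x)) (offer_size \<kappa>) Y \<and> y \<in> Y"
        proof -
          have len: "length (map e [0..<r]) mod (s + t) = \<kappa>" using rk by simp
          have "\<exists>Y. least_in (children (T r) (fst (e r), take (length (snd u)) (snd (e r))))
              (\<lambda>x. visit_count (map e [0..<r]) \<kappa> (extend (fst (e r), take (length (snd u)) (snd (e r))) x)) (offer_size \<kappa>) Y \<and>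
            snd (e r) ! length (snd u) \<in> Y"
            using round_rel[of r] i unfolding round_rel_def Let_def len by blast
          then show ?thesis unfolding eq ey .
        qed
        then obtain Y where Y: "least_in ?X (\<lambda>x. visit_count (map e [0..<r]) \<kappa> (extend u x)) (offer_size \<kappa>) Y" "y \<in> Y"
          unfolding fr(2) by blast
        have "r \<in> W \<kappa> (extend u y)" using rk w y by (simp add: W_def visits_def extend_def)
        then show "\<exists>Y\<subseteq>?X. card Y = offer_size \<kappa> \<and> (\<forall>y\<in>Y. \<forall>z\<in>?X - Y.
          card (W \<kappa> (extend u y) \<inter> {..<r}) \<le> card (W \<kappa> (extend u z) \<inter> {..<r})) \<and> (\<exists>y\<in>Y. r \<in> W \<kappa> (extend u y))"
          using Y unfolding least_in_def cntW by blast
      qed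
      then show ?thesis by simp
    qed
    have "\<exists>x\<in>?X. good (extend u x)"
    proof (rule ccontr)
      assume neg: "\<not> (\<exists>x\<in>?X. good (extend u x))"
      then have "?X \<subseteq> (\<Union>\<kappa><s + t. F \<kappa>)" by (auto simp: good_def F_def)
      then have "card ?X \<le> card (\<Union>\<kappa><s + t. F \<kappa>)" using fch by (intro card_mono) (auto simp: F_def)
      also have "\<dots> \<le> (\<Sum>\<kappa><s + t. card (F \<kappa>))" by (rule card_UN_le) simp
      also have "\<dots> \<le> (\<Sum>\<kappa><s + t. offer_size \<kappa> - 1)" by (rule sum_mono) (use cF in simp)
      also have "\<dots> = s + 3 * t"
      proof -
        have "(\<Sum>\<kappa><s + t'. offer_size \<kappa> - 1) = s + 3 * t'" for t'
          by (induction t') (simp_all add: offer_size_def)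
        then show ?thesis .
      qed
      finally show False using r1 by (simp add: full_def q_def)
    qed
    then obtain x where "x \<in> ?X" "good (extend u x)" by blast
    then show ?thesis by (auto simp: children_def extend_def)
  qed
  obtain \<tau> where \<tau>: "\<tau> \<in> Tau" "good (\<tau>, [])" using root by blast
  define P where "P l p \<longleftrightarrow> length p = l \<and> good (\<tau>, p) \<and> (\<exists>r. (\<tau>, p) \<in> T r)" for l :: nat and p
  have P0: "P 0 []" using \<tau> tree_invD(3)[OF inv \<tau>(1)] by (auto simp: P_def)
  have PS: "\<exists>p'. P (Suc l) p' \<and> (\<exists>x. p' = p @ [x])" if p: "P l p" for l p
  proof -
    obtain r where r: "good (\<tau>, p)" "(\<tau>, p) \<in> T r" "length p = l" using p by (auto simp: P_def)
    obtain x where "good (\<tau>, p @ [x])" "\<exists>r. (\<tau>, p @ [x]) \<in> T r"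
      using child[OF r(1,2)] by (auto simp: extend_def)
    then show ?thesis using r(3) by (intro exI[of _ "p @ [x]"]) (auto simp: P_def)
  qed
  obtain ps where ps: "\<And>l. P l (ps l)" "\<And>l. \<exists>x. ps (Suc l) = ps l @ [x]"
    using dependent_nat_choice[of P "\<lambda>l p p'. \<exists>x. p' = p @ [x]"] P0 PS by metis
  define x where "x l = ps (Suc l) ! l" for l
  have "ps l = map x [0..<l]" for l
  proof (induction l)
    case 0
    then show ?case using ps(1)[of 0] by (simp add: P_def)
  next
    case (Suc l)
    obtain y where y: "ps (Suc l) = ps l @ [y]" using ps(2) by blast
    have "length (ps l) = l" using ps(1)[of l] by (simp add: P_def)
    then have "x l = y" unfolding x_def y by (simp add: nth_append)
    then show ?case using y Suc by simp
  qed
  then show ?thesis using ps(1) \<tau>(1) by (intro bexI[of _ \<tau>] exI[of _ x]) (auto simp: P_def)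
qed

lemma maker_builds_clique:
  "\<exists>\<sigma>. (\<forall>h. even (length h) \<and> distinct h \<and> set h \<subseteq> E0 \<longrightarrow> \<sigma> h \<in> E0 - set h) \<and>
     (\<forall>p. (\<forall>n. p n \<in> E0 \<and> p n \<notin> p ` {..<n}) \<and> follows \<sigma> p \<longrightarrow>
       (\<exists>\<tau>\<in>Tup. \<exists>x. inj x \<and> (\<forall>l. label_ok \<tau> (map x [0..<l]) (x l) \<and> x l \<notin> centres) \<and>
          clique (maker_edges p) (\<tau> ` {..<s} \<union> range x)))"
proof -
  \<comment> \<open>\<open>None\<close> is the position before the cliques of centres exist.
    Afterwards \<open>Tau\<close> is the fixed family of tuples, \<open>T\<close> the current tree,
    and \<open>es\<close> the list of nodes at which the rounds so far have ended.\<close>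
  define Inv where "Inv st h = (case st of None \<Rightarrow> h = [] | Some (Tau, T, es) \<Rightarrow>
     Tau \<subseteq> Tup \<and> real (n ^ s) / 2 ^ (s * s + 1) \<le> card Tau \<and> tree_inv Tau T h)"
    for st :: "((nat \<Rightarrow> nat) set \<times> node set \<times> node list) option" and h
  define Rel where "Rel st st' = (case (st, st') of
     (None, Some (Tau, T, es)) \<Rightarrow> es = []
   | (Some (Tau, T, es), Some (Tau', T', es')) \<Rightarrow> Tau' = Tau \<and> (\<exists>e. es' = es @ [e] \<and> round_rel Tau T es T' e)
   | _ \<Rightarrow> False)" for st st' :: "((nat \<Rightarrow> nat) set \<times> node set \<times> node list) option"
  have "\<exists>\<sigma>. (\<forall>h. even (length h) \<and> distinct h \<and> set h \<subseteq> E0 \<longrightarrow> \<sigma> h \<in> E0 - set h) \<and>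
     (\<forall>p. (\<forall>n. p n \<in> E0 \<and> p n \<notin> p ` {..<n}) \<and> follows \<sigma> p \<longrightarrow>
       (\<exists>S f. S 0 = None \<and> strict_mono f \<and>
          (\<forall>r. Inv (S r) (map p [0..<f r]) \<and> Rel (S r) (S (Suc r)))))"
  proof (rule strategy_from_force[OF infinite_E0])
    show "Inv None []" by (simp add: Inv_def)
    fix st h assume h: "legal E0 h" and I: "Inv st h"
    show "\<exists>N. force E0 N (\<lambda>h'. length h < length h' \<and> (\<exists>st'. Inv st' h' \<and> Rel st st')) h"
    proof (cases st)
      case None
      then have h0: "h = []" using I by (simp add: Inv_def)
      obtain N where N: "force E0 N (\<lambda>h. h \<noteq> [] \<and> (\<exists>T\<subseteq>Tup. real (n ^ s) / 2 ^ (s * s + 1) \<le> card T \<and>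
        (\<forall>\<tau>\<in>T. clique (maker_moves h) (\<tau> ` {..<s})))) []" using force_many_cliques by blast
      have "force E0 N (\<lambda>h'. length h < length h' \<and> (\<exists>st'. Inv st' h' \<and> Rel st st')) h"
        unfolding h0
      proof (rule force_mono[OF N])
        fix h' :: "nat set list" assume "h' \<noteq> [] \<and> (\<exists>T\<subseteq>Tup. real (n ^ s) / 2 ^ (s * s + 1) \<le> card T \<and>
          (\<forall>\<tau>\<in>T. clique (maker_moves h') (\<tau> ` {..<s})))"
        then obtain Tau where A: "h' \<noteq> []" "Tau \<subseteq> Tup" "real (n ^ s) / 2 ^ (s * s + 1) \<le> card Tau"
          "\<forall>\<tau>\<in>Tau. clique (maker_moves h') (\<tau> ` {..<s})" by blast
        have "finite Tau" using A(2) finite_Tup finite_subset by blast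
        moreover have "children ((\<lambda>\<tau>. (\<tau>, [])) ` Tau) u = {}" for u by (auto simp: children_def)
        ultimately have "tree_inv Tau ((\<lambda>\<tau>. (\<tau>, [])) ` Tau) h'"
          using A(4) by (auto simp: tree_inv_def)
        then have "Inv (Some (Tau, (\<lambda>\<tau>. (\<tau>, [])) ` Tau, [])) h'" using A by (simp add: Inv_def)
        moreover have "Rel st (Some (Tau, (\<lambda>\<tau>. (\<tau>, [])) ` Tau, []))" by (simp add: Rel_def None)
        moreover have "length [] < length h'" using A(1) by simp
        ultimately show "length [] < length h' \<and> (\<exists>st'. Inv st' h' \<and> Rel st st')" by blast
      qed
      then show ?thesis by blast
    next
      case (Some a)
      obtain Tau T es where st: "st = Some (Tau, T, es)" using Some by (cases a) auto
      have A: "Tau \<subseteq> Tup" "real (n ^ s) / 2 ^ (s * s + 1) \<le> card Tau" "tree_inv Tau T h"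
        using I by (simp_all add: Inv_def st)
      obtain N where N: "force E0 N (\<lambda>h'. length h < length h' \<and>
        (\<exists>T' e. tree_inv Tau T' h' \<and> round_rel Tau T es T' e)) h" using round_force[OF h A] by blast
      have "force E0 N (\<lambda>h'. length h < length h' \<and> (\<exists>st'. Inv st' h' \<and> Rel st st')) h"
      proof (rule force_mono[OF N])
        fix h' assume "length h < length h' \<and> (\<exists>T' e. tree_inv Tau T' h' \<and> round_rel Tau T es T' e)"
        then obtain T' e where B: "length h < length h'" "tree_inv Tau T' h'" "round_rel Tau T es T' e" by blast
        then have "Inv (Some (Tau, T', es @ [e])) h'" "Rel st (Some (Tau, T', es @ [e]))"
          using A by (auto simp: Inv_def Rel_def st simp del: split_paired_Ex)
        then show "length h < length h' \<and> (\<exists>st'. Inv st' h' \<and> Rel st st')" using B(1) by blast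
      qed
      then show ?thesis by blast
    qed
  qed
  then obtain \<sigma> where \<sigma>: "\<forall>h. even (length h) \<and> distinct h \<and> set h \<subseteq> E0 \<longrightarrow> \<sigma> h \<in> E0 - set h"
    "\<And>p. (\<forall>n. p n \<in> E0 \<and> p n \<notin> p ` {..<n}) \<and> follows \<sigma> p \<Longrightarrow>
       (\<exists>S f. S 0 = None \<and> strict_mono f \<and>
          (\<forall>r. Inv (S r) (map p [0..<f r]) \<and> Rel (S r) (S (Suc r))))" by blast
  have "\<exists>\<tau>\<in>Tup. \<exists>x. inj x \<and> (\<forall>l. label_ok \<tau> (map x [0..<l]) (x l) \<and> x l \<notin> centres) \<and>
          clique (maker_edges p) (\<tau> ` {..<s} \<union> range x)"
    if p: "(\<forall>n. p n \<in> E0 \<and> p n \<notin> p ` {..<n}) \<and> follows \<sigma> p" for p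
  proof -
    obtain S f where S: "S 0 = None" "\<And>r. Inv (S r) (map p [0..<f r])" "\<And>r. Rel (S r) (S (Suc r))"
      using \<sigma>(2)[OF p] by blast
    obtain Tau T0 where S1: "S 1 = Some (Tau, T0, [])"
    proof -
      have "Rel None (S 1)" using S(1) S(3)[of 0] by simp
      then show thesis using that by (auto simp: Rel_def split: option.splits)
    qed
    have "\<exists>T es. S (Suc r) = Some (Tau, T, es) \<and> length es = r" for r
    proof (induction r)
      case 0
      then show ?case using S1 by simp
    next
      case (Suc r)
      then obtain T es where "S (Suc r) = Some (Tau, T, es)" "length es = r" by blast
      then show ?case using S(3)[of "Suc r"] by (auto simp: Rel_def split: option.splits)
    qed
    then obtain T es where TE: "\<And>r. S (Suc r) = Some (Tau, T r, es r)" "\<And>r. length (es r) = r" by metis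
    define e where "e r = es (Suc r) ! r" for r
    have R: "es (Suc r) = es r @ [e r] \<and> round_rel Tau (T r) (es r) (T (Suc r)) (e r)" for r
    proof -
      obtain e' where "es (Suc r) = es r @ [e']" "round_rel Tau (T r) (es r) (T (Suc r)) e'"
        using S(3)[of "Suc r"] by (auto simp: Rel_def TE(1))
      then show ?thesis using TE(2)[of r] by (simp add: e_def nth_append)
    qed
    have es: "es r = map e [0..<r]" for r
      by (induction r) (use TE(2)[of 0] R in auto)
    have I: "Tau \<subseteq> Tup" "real (n ^ s) / 2 ^ (s * s + 1) \<le> card Tau"
      "tree_inv Tau (T r) (map p [0..<f (Suc r)])" for r
      using S(2)[of "Suc r"] by (simp_all add: Inv_def TE(1))
    obtain \<tau> x where x: "\<tau> \<in> Tau" "\<And>l. \<exists>r. (\<tau>, map x [0..<l]) \<in> T r"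
      using branch[OF I(1,2), of T "\<lambda>r. map p [0..<f (Suc r)]" e] I(3) R es by auto
    have mkp: "maker_moves (map p [0..<k]) \<subseteq> maker_edges p" for k
      by (auto simp: maker_moves_def maker_edges_def)
    \<comment> \<open>The branch exists only in the limit, but each finite part of it is a node of
      some \<open>T r\<close> and was a clique of Maker by then.\<close>
    have cl: "clique (maker_edges p) (\<tau> ` {..<s} \<union> x ` {..<l})" for l
    proof -
      obtain r where r: "(\<tau>, map x [0..<l]) \<in> T r" using x(2) by blast
      have "set (map x [0..<l]) = x ` {..<l}" by auto
      then show ?thesis using clique_mono[OF tree_invD(8)[OF I(3) r] mkp order_refl] by simp
    qed
    have dist: "distinct (map x [0..<l])" for l
    proof -
      obtain r where r: "(\<tau>, map x [0..<l]) \<in> T r" using x(2) by blast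
      note D = tree_invD[OF I(3)[of r]]
      show ?thesis
      proof (rule labels_unique_distinct[where W = "{p. (\<tau>, p) \<in> T r}"])
        show "p1 = p2" if "p1 @ [y] \<in> {p. (\<tau>, p) \<in> T r}" "p2 @ [y] \<in> {p. (\<tau>, p) \<in> T r}" for p1 p2 y
          using that D(9)[of \<tau> p1 y \<tau> p2] by simp
      qed (use r D(4) in auto)
    qed
    show ?thesis
    proof (intro bexI[of _ \<tau>] exI[of _ x] conjI allI)
      show "\<tau> \<in> Tup" using x(1) I(1) by blast
      show "inj x"
      proof (rule linorder_injI)
        fix i j :: nat assume "i < j"
        then have "x i \<in> x ` {0..<j}" by simp
        moreover have "x j \<notin> x ` {0..<j}" using dist[of "Suc j"] by simp
        ultimately show "x i \<noteq> x j" by metis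
      qed
      fix l
      obtain r where "(\<tau>, map x [0..<Suc l]) \<in> T r" using x(2) by blast
      then have "(\<tau>, map x [0..<l] @ [x l]) \<in> T r" by simp
      from tree_invD(5,6)[OF I(3) this] show "label_ok \<tau> (map x [0..<l]) (x l)" "x l \<notin> centres" by auto
    next
      show "clique (maker_edges p) (\<tau> ` {..<s} \<union> range x)"
        unfolding clique_def
      proof (intro ballI impI)
        fix y z assume yz: "y \<in> \<tau> ` {..<s} \<union> range x" "z \<in> \<tau> ` {..<s} \<union> range x" "y \<noteq> z"
        have "\<exists>l. y \<in> \<tau> ` {..<s} \<union> x ` {..<l}" "\<exists>l. z \<in> \<tau> ` {..<s} \<union> x ` {..<l}" using yz(1,2) by auto
        then obtain l l' where "y \<in> \<tau> ` {..<s} \<union> x ` {..<l}" "z \<in> \<tau> ` {..<s} \<union> x ` {..<l'}" by blast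
        then have "y \<in> \<tau> ` {..<s} \<union> x ` {..<max l l'}" "z \<in> \<tau> ` {..<s} \<union> x ` {..<max l l'}" by auto
        then show "{y, z} \<in> maker_edges p" using cl[of "max l l'"] yz(3) by (simp add: clique_def)
      qed
    qed
  qed
  then show ?thesis using \<sigma>(1) by blast
qed

end

section \<open>Copies of star forests\<close>

lemma copy_ofI:
  assumes g: "bij_betw g (verts H) (verts G)" and e: "edges G = (\<lambda>e. g ` e) ` edges H"
    and H: "\<And>e. e \<in> edges H \<Longrightarrow> e \<subseteq> verts H"
  shows "copy_of G H"
proof -
  let ?f = "inv_into (verts H) g"
  have inj: "inj_on g (verts H)" using g by (rule bij_betw_imp_inj_on)
  have "(\<lambda>e. ?f ` e) ` edges G = ((\<lambda>e. ?f ` e) \<circ> (\<lambda>e. g ` e)) ` edges H"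
    unfolding e by (rule image_comp)
  also have "\<dots> = id ` edges H"
    by (rule image_cong[OF refl]) (simp only: o_apply id_apply inv_into_image_cancel[OF inj H])
  finally have "edges H = (\<lambda>e. ?f ` e) ` edges G" by simp
  then show ?thesis unfolding copy_of_def using bij_betw_inv_into[OF g] by blast
qed

lemma copy_ofD:
  assumes "copy_of G H" "is_graph G"
  shows "\<exists>g. bij_betw g (verts H) (verts G) \<and> edges G = (\<lambda>e. g ` e) ` edges H"
proof -
  obtain f where f: "bij_betw f (verts G) (verts H)" "edges H = (\<lambda>e. f ` e) ` edges G"
    using assms(1) unfolding copy_of_def by blast
  have inj: "inj_on f (verts G)" using f(1) by (rule bij_betw_imp_inj_on)
  let ?g = "inv_into (verts G) f"
  have sub: "e \<subseteq> verts G" if "e \<in> edges G" for e using assms(2) that by (auto simp: is_graph_def)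
  have "(\<lambda>e. ?g ` e) ` edges H = ((\<lambda>e. ?g ` e) \<circ> (\<lambda>e. f ` e)) ` edges G"
    unfolding f(2) by (rule image_comp)
  also have "\<dots> = id ` edges G"
    by (rule image_cong[OF refl]) (simp only: o_apply id_apply inv_into_image_cancel[OF inj sub])
  finally have "edges G = (\<lambda>e. ?g ` e) ` edges H" by simp
  then show ?thesis using bij_betw_inv_into[OF f(1)] by blast
qed

text \<open>A common form of \<open>G_inf\<close> and \<open>G_star\<close>, with
  \<open>(i, 0)\<close> as the centre of star \<open>i\<close>; a star with \<open>V i = {0}\<close>
  is an isolated vertex.\<close>

definition star_forest :: "'i set \<Rightarrow> ('i \<Rightarrow> nat set) \<Rightarrow> ('i \<times> nat) ugraph" where
  "star_forest I V = \<lparr>verts = Sigma I V, edges = {{(i, 0), (i, v)} | i v. i \<in> I \<and> v \<in> V i \<and> 0 < v}\<rparr>"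

lemma disjoint_union_stars:
  assumes v: "\<And>i. verts (S i) = V i" and e: "\<And>i. edges (S i) = {{0, v} | v. v \<in> V i \<and> 0 < v}"
  shows "disjoint_union I S = star_forest I V"
proof -
  have "(\<Union>i\<in>I. (\<lambda>e. Pair i ` e) ` edges (S i)) = {{(i, 0), (i, v)} | i v. i \<in> I \<and> v \<in> V i \<and> 0 < v}"
  proof (intro set_eqI iffI)
    fix d assume "d \<in> (\<Union>i\<in>I. (\<lambda>e. Pair i ` e) ` edges (S i))"
    then obtain i v where iv: "i \<in> I" "v \<in> V i" "0 < v" "d = Pair i ` {0, v}" unfolding e by blast
    then have "d = {(i, 0), (i, v)}" by simp
    then show "d \<in> {{(i, 0), (i, v)} | i v. i \<in> I \<and> v \<in> V i \<and> 0 < v}" using iv(1-3) by blast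
  next
    fix d assume "d \<in> {{(i, 0), (i, v)} | i v. i \<in> I \<and> v \<in> V i \<and> 0 < v}"
    then obtain i v where iv: "i \<in> I" "v \<in> V i" "0 < v" "d = {(i, 0), (i, v)}" by blast
    then have "d = Pair i ` {0, v}" by simp
    moreover have "{0, v} \<in> edges (S i)" unfolding e using iv(2,3) by blast
    ultimately show "d \<in> (\<Union>i\<in>I. (\<lambda>e. Pair i ` e) ` edges (S i))" using iv(1) by blast
  qed
  then show ?thesis by (simp add: disjoint_union_def star_forest_def v)
qed

lemma G_inf_eq: "G_inf m = star_forest {..<m} (\<lambda>_. UNIV)"
  unfolding G_inf_def by (rule disjoint_union_stars) (simp_all add: S_aleph0_def)

lemma G_star_eq: "G_star = star_forest {1..} (\<lambda>j. {..<j})"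
  unfolding G_star_def by (rule disjoint_union_stars) (auto simp: star_def)

definition nbrs :: "'a ugraph \<Rightarrow> 'a \<Rightarrow> 'a set" where
  "nbrs G a = {y. {a, y} \<in> edges G}"

text \<open>The isomorphism is needed only for the centres \<open>c i\<close>; the leaves are then
  the neighbours of the centres in \<open>G\<close>, and the last conjunct preserves their
  number.\<close>

lemma star_forest_copy:
  fixes G :: "'a ugraph"
  assumes "copy_of G (star_forest I V)" "is_graph G" and V0: "\<And>i. i \<in> I \<Longrightarrow> 0 \<in> V i"
  shows "\<exists>c. inj_on c I \<and> verts G = c ` I \<union> (\<Union>i\<in>I. nbrs G (c i)) \<and>
    edges G = {{c i, y} | i y. i \<in> I \<and> y \<in> nbrs G (c i)} \<and>
    (\<forall>i\<in>I. \<forall>j\<in>I. i \<noteq> j \<longrightarrow> nbrs G (c i) \<inter> nbrs G (c j) = {}) \<and>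
    (\<forall>i\<in>I. \<forall>j\<in>I. c i \<notin> nbrs G (c j)) \<and>
    (\<forall>i\<in>I. \<exists>b. bij_betw b (V i - {0}) (nbrs G (c i)))"
proof -
  obtain g where g: "bij_betw g (Sigma I V) (verts G)"
    and e: "edges G = (\<lambda>e. g ` e) ` {{(i, 0), (i, v)} | i v. i \<in> I \<and> v \<in> V i \<and> 0 < v}"
    using copy_ofD[OF assms(1,2)] by (auto simp: star_forest_def)
  have inj: "inj_on g (Sigma I V)" and im: "g ` Sigma I V = verts G"
    using g by (auto simp: bij_betw_def)
  have geq: "u = w" if "g u = g w" "u \<in> Sigma I V" "w \<in> Sigma I V" for u w
    using inj that by (auto dest: inj_onD)
  define c where "c i = g (i, 0)" for i
  have cS: "(i, 0) \<in> Sigma I V" if "i \<in> I" for i using V0 that by simp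
  have e': "edges G = {{g (i, 0), g (i, v)} | i v. i \<in> I \<and> v \<in> V i \<and> 0 < v}"
    unfolding e by (auto simp: image_iff) blast
  have maker_nbrs: "nbrs G (c i) = (\<lambda>v. g (i, v)) ` (V i - {0})" if i: "i \<in> I" for i
  proof (intro set_eqI iffI)
    fix y assume "y \<in> nbrs G (c i)"
    then obtain j v where j: "{g (i, 0), y} = {g (j, 0), g (j, v)}" "j \<in> I" "v \<in> V j" "0 < v"
      unfolding nbrs_def c_def e' by blast
    have jS: "(j, v) \<in> Sigma I V" using j by simp
    from j(1) consider "g (i, 0) = g (j, 0)" "y = g (j, v)" | "g (i, 0) = g (j, v)"
      by (auto simp: doubleton_eq_iff)
    then show "y \<in> (\<lambda>v. g (i, v)) ` (V i - {0})"
    proof cases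
      case 1
      then have "i = j" using geq[OF 1(1) cS[OF i] cS[OF j(2)]] by simp
      then show ?thesis using 1 j by auto
    next
      case 2
      then show ?thesis using geq[OF 2 cS[OF i] jS] j(4) by simp
    qed
  next
    fix y assume "y \<in> (\<lambda>v. g (i, v)) ` (V i - {0})"
    then show "y \<in> nbrs G (c i)" unfolding nbrs_def c_def e' using i by auto
  qed
  show ?thesis
  proof (intro exI[of _ c] conjI ballI impI)
    show "inj_on c I" unfolding c_def by (rule inj_onI) (use geq cS in blast)
    show "verts G = c ` I \<union> (\<Union>i\<in>I. nbrs G (c i))"
    proof (intro set_eqI iffI)
      fix y assume "y \<in> verts G"
      then have "y \<in> g ` Sigma I V" unfolding im .
      then obtain i v where iv: "i \<in> I" "v \<in> V i" "y = g (i, v)" by blast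
      then show "y \<in> c ` I \<union> (\<Union>i\<in>I. nbrs G (c i))"
        using maker_nbrs[OF iv(1)] by (cases "v = 0") (auto simp: c_def)
    next
      fix y assume "y \<in> c ` I \<union> (\<Union>i\<in>I. nbrs G (c i))"
      then show "y \<in> verts G" using maker_nbrs cS im by (auto simp: c_def)
    qed
    show "edges G = {{c i, y} | i y. i \<in> I \<and> y \<in> nbrs G (c i)}"
    proof (intro set_eqI iffI)
      fix d assume "d \<in> edges G"
      then obtain i v where "i \<in> I" "v \<in> V i" "0 < v" "d = {g (i, 0), g (i, v)}" unfolding e' by blast
      then show "d \<in> {{c i, y} | i y. i \<in> I \<and> y \<in> nbrs G (c i)}"
        using maker_nbrs[of i] by (auto simp: c_def)
    qed (auto simp: nbrs_def)
    show "nbrs G (c i) \<inter> nbrs G (c j) = {}" if "i \<in> I" "j \<in> I" "i \<noteq> j" for i j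
      using maker_nbrs that geq by fastforce
    show "c i \<notin> nbrs G (c j)" if "i \<in> I" "j \<in> I" for i j
      using maker_nbrs that geq cS by (fastforce simp: c_def)
    show "\<exists>b. bij_betw b (V i - {0}) (nbrs G (c i))" if "i \<in> I" for i
      using maker_nbrs[OF that] that inj by (intro exI[of _ "\<lambda>v. g (i, v)"]) (auto simp: bij_betw_def inj_on_def)
  qed
qed

definition complete_on :: "'a set \<Rightarrow> 'a ugraph" where
  "complete_on V = \<lparr>verts = V, edges = {{x, y} | x y. x \<in> V \<and> y \<in> V \<and> x \<noteq> y}\<rparr>"

lemma is_graph_complete_on: "is_graph (complete_on V)"
  by (auto simp: is_graph_def complete_on_def)

lemma K_aleph0_eq: "K_aleph0 = complete_on UNIV"
  by (simp add: K_aleph0_def complete_on_def)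

lemma complete_on_copy:
  fixes V :: "nat set"
  assumes "infinite V"
  shows "copy_of (complete_on V) K_aleph0"
proof (rule copy_ofI)
  let ?g = "enumerate V"
  have g: "bij_betw ?g UNIV V" by (rule bij_enumerate[OF assms])
  then show "bij_betw ?g (verts K_aleph0) (verts (complete_on V))"
    by (simp add: K_aleph0_def complete_on_def)
  have inj: "inj ?g" and im: "range ?g = V" using g by (auto simp: bij_betw_def)
  show "edges (complete_on V) = (\<lambda>e. ?g ` e) ` edges K_aleph0"
  proof (intro set_eqI iffI)
    fix e assume "e \<in> edges (complete_on V)"
    then obtain x y where xy: "e = {x, y}" "x \<in> range ?g" "y \<in> range ?g" "x \<noteq> y"
      unfolding im by (auto simp: complete_on_def)
    then obtain i j where "x = ?g i" "y = ?g j" by blast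
    then have "e = ?g ` {i, j}" "{i, j} \<in> edges K_aleph0" using xy by (auto simp: E0_iff)
    then show "e \<in> (\<lambda>e. ?g ` e) ` edges K_aleph0" by blast
  next
    fix e assume "e \<in> (\<lambda>e. ?g ` e) ` edges K_aleph0"
    then obtain i j where "i \<noteq> j" "e = {?g i, ?g j}" by (auto simp: K_aleph0_def)
    moreover from this have "?g i \<noteq> ?g j" using inj by (simp add: inj_eq)
    moreover have "?g i \<in> V" "?g j \<in> V" using im by blast+
    ultimately show "e \<in> edges (complete_on V)" unfolding complete_on_def ugraph.simps by blast
  qed
qed (simp add: K_aleph0_def)

section \<open>How the branch meets the given forests\<close>

context star_game begin

lemma label_ok_pos:
  assumes "\<And>l. label_ok \<tau> (map x [0..<l]) (x l)" and i: "i < blob_size d"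
  shows "d mod (s + t) < s \<Longrightarrow> x (blob_start d + i) \<in> Lf (\<tau> (d mod (s + t)))"
    and "s \<le> d mod (s + t) \<Longrightarrow> i = 0 \<Longrightarrow> x (blob_start d + i) \<in> Ctr (d mod (s + t))"
    and "s \<le> d mod (s + t) \<Longrightarrow> 0 < i \<Longrightarrow> x (blob_start d + i) \<in> Lf (x (blob_start d))"
proof -
  have sl: "slot (length (map x [0..<blob_start d + i])) = (d, i)" using slot_start[OF i] by simp
  note L = assms(1)[of "blob_start d + i", unfolded label_ok_def sl]
  show "x (blob_start d + i) \<in> Lf (\<tau> (d mod (s + t)))" if "d mod (s + t) < s"
    using L that by (simp add: Let_def)
  show "x (blob_start d + i) \<in> Ctr (d mod (s + t))" if "s \<le> d mod (s + t)" "i = 0"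
    using L that by (simp add: Let_def)
  show "x (blob_start d + i) \<in> Lf (x (blob_start d))" if "s \<le> d mod (s + t)" "0 < i"
    using L that by (simp add: Let_def)
qed

lemma pos_cases: "\<exists>d i. i < blob_size d \<and> l = blob_start d + i"
  using slot_char[of l] by blast

lemma pos_inj:
  assumes "i < blob_size d" "i' < blob_size d'" "blob_start d + i = blob_start d' + i'"
  shows "d = d' \<and> i = i'"
proof -
  have "(d, i) = slot (blob_start d + i)" by (rule slot_start[OF assms(1), symmetric])
  also have "\<dots> = (d', i')" unfolding assms(3) by (rule slot_start[OF assms(2)])
  finally show ?thesis by simp
qed

text \<open>The forests are vertex disjoint, so the branch meets \<open>G \<kappa>\<close> exactly
  in its blobs of kind \<open>\<kappa>\<close>. For \<open>\<kappa> < s\<close> these are single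
  leaves of the tuple's centre \<open>\<tau> \<kappa>\<close>; for the other kinds they are stars of
  sizes 1, 2, 3 and so on, and distinct blobs lie in distinct stars of the forest.\<close>

lemma final_graphs:
  fixes G :: "nat \<Rightarrow> nat ugraph"
  assumes vG: "\<And>\<kappa>. \<kappa> < s + t \<Longrightarrow> verts (G \<kappa>) = Ctr \<kappa> \<union> (\<Union>a\<in>Ctr \<kappa>. Lf a)"
    and eG: "\<And>\<kappa>. \<kappa> < s + t \<Longrightarrow> edges (G \<kappa>) = {{a, y} | a y. a \<in> Ctr \<kappa> \<and> y \<in> Lf a}"
    and dG: "\<And>\<kappa> \<kappa>'. \<kappa> < s + t \<Longrightarrow> \<kappa>' < s + t \<Longrightarrow> \<kappa> \<noteq> \<kappa>' \<Longrightarrow> verts (G \<kappa>) \<inter> verts (G \<kappa>') = {}"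
    and \<tau>: "\<tau> \<in> Tup" and injx: "inj x" and lab: "\<And>l. label_ok \<tau> (map x [0..<l]) (x l)"
    and V: "V = \<tau> ` {..<s} \<union> range x"
  shows "\<kappa> < s \<Longrightarrow> copy_of (graph_inter (G \<kappa>) (complete_on V)) S_aleph0"
    and "s \<le> \<kappa> \<Longrightarrow> \<kappa> < s + t \<Longrightarrow> copy_of (graph_inter (G \<kappa>) (complete_on V)) G_star"
proof -
  note lp = label_ok_pos[OF lab]
  let ?K = "s + t"
  have Kpos: "0 < ?K" by (rule kinds)
  have kd: "d mod ?K < ?K" for d using Kpos by simp
  have \<tau>c: "\<tau> i \<in> Ctr i" if "i < s" for i using Tup_ctr[OF \<tau> that] .
  have xG: "x (blob_start d + i) \<in> verts (G (d mod ?K))" if i: "i < blob_size d" for d i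
  proof (cases "d mod ?K < s")
    case True
    then show ?thesis using lp(1)[OF i] \<tau>c vG[OF kd] by blast
  next
    case False
    then have c: "x (blob_start d) \<in> Ctr (d mod ?K)" using lp(2)[OF blob_size_pos[of d]] by simp
    show ?thesis
    proof (cases "i = 0")
      case True
      then show ?thesis using c vG[OF kd] by simp
    next
      case i0: False
      then have "x (blob_start d + i) \<in> Lf (x (blob_start d))" using lp(3)[OF i] False by simp
      then show ?thesis using c vG[OF kd] by blast
    qed
  qed
  have xk: "d mod ?K = \<kappa>" if "i < blob_size d" "x (blob_start d + i) \<in> verts (G \<kappa>)" "\<kappa> < ?K" for d i \<kappa>
    using xG[OF that(1)] that dG[OF kd that(3), of d] by blast
  have \<tau>k: "i = \<kappa>" if "i < s" "\<tau> i \<in> verts (G \<kappa>)" "\<kappa> < ?K" for i \<kappa>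
    using \<tau>c[OF that(1)] that dG[of i \<kappa>] vG[of i] by fastforce
  have eV: "edges (graph_inter (G \<kappa>) (complete_on V)) = {{a, y} | a y. a \<in> Ctr \<kappa> \<inter> V \<and> y \<in> Lf a \<inter> V}"
    if k: "\<kappa> < ?K" for \<kappa>
  proof -
    have "a \<noteq> y" if "a \<in> Ctr \<kappa>" "y \<in> Lf a" for a y using lf_ctr[OF k k that(1)] that by blast
    then show ?thesis unfolding graph_inter_def complete_on_def eG[OF k]
      by (auto simp: doubleton_eq_iff) blast+
  qed
  have vV: "verts (graph_inter (G \<kappa>) (complete_on V)) = verts (G \<kappa>) \<inter> V" for \<kappa>
    by (simp add: graph_inter_def complete_on_def)
  show "copy_of (graph_inter (G \<kappa>) (complete_on V)) S_aleph0" if k: "\<kappa> < s"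
  proof (rule copy_ofI)
    have kK: "\<kappa> < ?K" using k by simp
    \<comment> \<open>The centre of the star is the tuple's centre, and leaf \<open>e + 1\<close> is
      the vertex of blob number \<open>e\<close> of kind \<open>\<kappa>\<close>, counted from
      0.\<close>
    define g where "g m = (case m of 0 \<Rightarrow> \<tau> \<kappa> | Suc e \<Rightarrow> x (blob_start (\<kappa> + ?K * e)))" for m
    have dm: "(\<kappa> + ?K * e) mod ?K = \<kappa>" for e using kK by simp
    have szk: "blob_size d = 1" if "d mod ?K = \<kappa>" for d using that k by (simp add: blob_size_def)
    have xL: "x (blob_start (\<kappa> + ?K * e)) \<in> Lf (\<tau> \<kappa>)" for e
      using lp(1)[OF blob_size_pos, of "\<kappa> + ?K * e"] dm[of e] k by simp
    have dE: "\<exists>e. d = \<kappa> + ?K * e" if "d mod ?K = \<kappa>" for d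
      using that by (metis mod_mult_div_eq)
    have L\<tau>: "Lf (\<tau> \<kappa>) \<inter> Ctr i = {}" if "i < ?K" for i using lf_ctr[OF kK that \<tau>c[OF k]] .
    have im: "range g = verts (G \<kappa>) \<inter> V"
    proof (intro set_eqI iffI)
      fix y assume "y \<in> range g"
      then obtain m where "y = g m" by blast
      then show "y \<in> verts (G \<kappa>) \<inter> V"
        using \<tau>c[OF k] xL vG[OF kK] k unfolding V by (cases m) (auto simp: g_def)
    next
      fix y assume y: "y \<in> verts (G \<kappa>) \<inter> V"
      then consider i where "i < s" "y = \<tau> i" | l where "y = x l" unfolding V by blast
      then show "y \<in> range g"
      proof cases
        case 1
        then have "i = \<kappa>" using \<tau>k y kK by blast
        then have "y = g 0" using 1 by (simp add: g_def)
        then show ?thesis by blast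
      next
        case 2
        obtain d i where di: "i < blob_size d" "l = blob_start d + i" using pos_cases by blast
        then have dk: "d mod ?K = \<kappa>" using xk[OF di(1)] y 2 kK by blast
        then obtain e where "d = \<kappa> + ?K * e" using dE by blast
        then have "y = g (Suc e)" using 2 di szk[OF dk] by (simp add: g_def)
        then show ?thesis by blast
      qed
    qed
    have inj: "inj g"
    proof (rule injI)
      fix m m' assume eq: "g m = g m'"
      have ne: "\<tau> \<kappa> \<noteq> x (blob_start (\<kappa> + ?K * e))" for e
        using xL[of e] L\<tau>[OF kK] \<tau>c[OF k] by auto
      show "m = m'"
      proof (cases m; cases m')
        fix e e' assume m: "m = Suc e" "m' = Suc e'"
        then have "blob_start (\<kappa> + ?K * e) + 0 = blob_start (\<kappa> + ?K * e') + 0"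
          using eq injx by (simp add: g_def inj_eq)
        from pos_inj[OF blob_size_pos blob_size_pos this] have "\<kappa> + ?K * e = \<kappa> + ?K * e'" by simp
        then show ?thesis using m Kpos by auto
      qed (use eq ne in \<open>auto simp: g_def dest: sym\<close>)
    qed
    show "bij_betw g (verts S_aleph0) (verts (graph_inter (G \<kappa>) (complete_on V)))"
      unfolding vV using im inj by (simp add: bij_betw_def S_aleph0_def)
    have cV: "a = \<tau> \<kappa>" if "a \<in> Ctr \<kappa>" "a \<in> V" for a
    proof -
      have "a \<in> verts (G \<kappa>) \<inter> V" using that vG[OF kK] by blast
      then obtain m where "a = g m" unfolding im[symmetric] by blast
      then show ?thesis using xL that(1) L\<tau>[OF kK] by (cases m) (auto simp: g_def)
    qed
    show "edges (graph_inter (G \<kappa>) (complete_on V)) = (\<lambda>e. g ` e) ` edges S_aleph0"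
      unfolding eV[OF kK]
    proof (intro set_eqI iffI)
      fix e assume "e \<in> {{a, y} | a y. a \<in> Ctr \<kappa> \<inter> V \<and> y \<in> Lf a \<inter> V}"
      then obtain y where y: "e = {\<tau> \<kappa>, y}" "y \<in> Lf (\<tau> \<kappa>)" "y \<in> V" using cV by blast
      then have "y \<in> verts (G \<kappa>) \<inter> V" using vG[OF kK] \<tau>c[OF k] by blast
      then obtain m where m: "y = g m" unfolding im[symmetric] by blast
      have "0 < m"
      proof (rule ccontr)
        assume "\<not> 0 < m"
        then show False using m y(2) L\<tau>[OF kK] \<tau>c[OF k] by (auto simp: g_def)
      qed
      then have "{0, m} \<in> edges S_aleph0" by (auto simp: S_aleph0_def)
      moreover have "e = g ` {0, m}" using y m by (simp add: g_def)
      ultimately show "e \<in> (\<lambda>e. g ` e) ` edges S_aleph0" by blast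
    next
      fix e assume "e \<in> (\<lambda>e. g ` e) ` edges S_aleph0"
      then obtain m where m: "0 < m" "e = {g 0, g m}" by (auto simp: S_aleph0_def)
      then obtain e' where e': "m = Suc e'" by (cases m) auto
      have "g m \<in> V" using im by blast
      moreover have "g m \<in> Lf (\<tau> \<kappa>)" using xL by (simp add: g_def e')
      moreover have "\<tau> \<kappa> \<in> Ctr \<kappa> \<inter> V" using \<tau>c[OF k] k unfolding V by blast
      moreover have "g 0 = \<tau> \<kappa>" by (simp add: g_def)
      ultimately show "e \<in> {{a, y} | a y. a \<in> Ctr \<kappa> \<inter> V \<and> y \<in> Lf a \<inter> V}" using m(2) by auto
    qed
  qed (simp add: S_aleph0_def)
  show "copy_of (graph_inter (G \<kappa>) (complete_on V)) G_star" if k: "s \<le> \<kappa>" and kK: "\<kappa> < ?K"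
    unfolding G_star_eq
  proof (rule copy_ofI)
    \<comment> \<open>The blob of kind \<open>\<kappa>\<close> with \<open>j\<close> vertices. The
      subtracted 1 matches the added 1 in \<open>blob_size\<close>.\<close>
    define D where "D j = \<kappa> + ?K * (j - 1)" for j
    define g where "g = (\<lambda>(j, i). x (blob_start (D j) + i))"
    have Dm: "D j mod ?K = \<kappa>" for j using kK by (simp add: D_def)
    have szD: "blob_size (D j) = j" if "1 \<le> j" for j
    proof -
      have "?K \<noteq> 0" using Kpos by simp
      then have "D j div ?K = (j - 1) + \<kappa> div ?K" unfolding D_def by (rule div_mult_self2)
      then have "D j div ?K = j - 1" using kK by simp
      then show ?thesis using Dm[of j] k that by (simp add: blob_size_def)
    qed
    have Dinj: "j = j'" if "D j = D j'" "1 \<le> j" "1 \<le> j'" for j j'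
      using arg_cong[OF that(1), of blob_size] unfolding szD[OF that(2)] szD[OF that(3)] .
    have dE: "\<exists>j\<ge>1. d = D j" if "d mod ?K = \<kappa>" for d
    proof (intro exI conjI)
      show "1 \<le> d div ?K + 1" by simp
      show "d = D (d div ?K + 1)" using that mod_mult_div_eq[of d ?K] by (simp add: D_def)
    qed
    have gC: "g (j, 0) \<in> Ctr \<kappa>" if "1 \<le> j" for j
      using lp(2)[OF blob_size_pos, of "D j"] Dm[of j] k by (simp add: g_def)
    have gL: "g (j, i) \<in> Lf (g (j, 0))" if "1 \<le> j" "0 < i" "i < j" for i j
      using lp(3)[of i "D j"] Dm[of j] k szD[OF that(1)] that by (simp add: g_def)
    have im: "g ` Sigma {1..} (\<lambda>j. {..<j}) = verts (G \<kappa>) \<inter> V"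
    proof (intro set_eqI iffI)
      fix y assume "y \<in> g ` Sigma {1..} (\<lambda>j. {..<j})"
      then obtain j i where ji: "1 \<le> j" "i < j" "y = x (blob_start (D j) + i)" by (auto simp: g_def)
      then show "y \<in> verts (G \<kappa>) \<inter> V" using xG[of i "D j"] Dm[of j] szD[OF ji(1)] unfolding V by simp
    next
      fix y assume y: "y \<in> verts (G \<kappa>) \<inter> V"
      then consider i where "i < s" "y = \<tau> i" | l where "y = x l" unfolding V by blast
      then show "y \<in> g ` Sigma {1..} (\<lambda>j. {..<j})"
      proof cases
        case 1
        then have "i = \<kappa>" using \<tau>k y kK by blast
        then show ?thesis using 1 k by simp
      next
        case 2
        obtain d i where di: "i < blob_size d" "l = blob_start d + i" using pos_cases by blast
        then have "d mod ?K = \<kappa>" using xk[OF di(1)] y 2 kK by blast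
        then obtain j where j: "j \<ge> 1" "d = D j" using dE by blast
        then have "(j, i) \<in> Sigma {1..} (\<lambda>j. {..<j})" "y = g (j, i)"
          using 2 di szD[OF j(1)] by (simp_all add: g_def)
        then show ?thesis by blast
      qed
    qed
    have inj: "inj_on g (Sigma {1..} (\<lambda>j. {..<j}))"
    proof (rule inj_onI)
      fix u w assume u: "u \<in> Sigma {1..} (\<lambda>j. {..<j})" and w: "w \<in> Sigma {1..} (\<lambda>j. {..<j})" and eq: "g u = g w"
      obtain j i j' i' where uw: "u = (j, i)" "w = (j', i')" by (cases u; cases w) auto
      have b: "1 \<le> j" "i < j" "1 \<le> j'" "i' < j'" using u w uw by auto
      have "blob_start (D j) + i = blob_start (D j') + i'" using eq injx uw by (simp add: g_def inj_eq)
      then have "D j = D j' \<and> i = i'" using b szD by (intro pos_inj) simp_all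
      then show "u = w" using Dinj b uw by simp
    qed
    show "bij_betw g (verts (star_forest {1..} (\<lambda>j. {..<j}))) (verts (graph_inter (G \<kappa>) (complete_on V)))"
      unfolding vV using im inj by (simp add: bij_betw_def star_forest_def)
    show "e \<subseteq> verts (star_forest {1..} (\<lambda>j. {..<j}))" if "e \<in> edges (star_forest {1..} (\<lambda>j. {..<j :: nat}))" for e
      using that by (auto simp: star_forest_def)
    show "edges (graph_inter (G \<kappa>) (complete_on V)) = (\<lambda>e. g ` e) ` edges (star_forest {1..} (\<lambda>j. {..<j}))"
      unfolding eV[OF kK]
    proof (intro set_eqI iffI)
      fix e assume "e \<in> {{a, y} | a y. a \<in> Ctr \<kappa> \<inter> V \<and> y \<in> Lf a \<inter> V}"
      then obtain a y where ay: "e = {a, y}" "a \<in> Ctr \<kappa>" "a \<in> V" "y \<in> Lf a" "y \<in> V" by blast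
      then have "a \<in> verts (G \<kappa>) \<inter> V" "y \<in> verts (G \<kappa>) \<inter> V" using vG[OF kK] by blast+
      then obtain j i j' i' where ji: "a = g (j, i)" "1 \<le> j" "i < j" and ji': "y = g (j', i')" "1 \<le> j'" "i' < j'"
        unfolding im[symmetric] by auto
      have i0: "i = 0"
      proof (rule ccontr)
        assume "i \<noteq> 0"
        then have "a \<in> Lf (g (j, 0))" using gL ji by simp
        then show False using lf_ctr[OF kK kK gC[OF ji(2)]] ay(2) by blast
      qed
      have i'0: "i' \<noteq> 0"
      proof
        assume "i' = 0"
        then have "y \<in> Ctr \<kappa>" using gC ji' by simp
        then show False using lf_ctr[OF kK kK ay(2)] ay(4) by blast
      qed
      then have "y \<in> Lf (g (j', 0))" using gL ji' by simp
      \<comment> \<open>\<open>y\<close> is a leaf of \<open>a\<close> and also of the centre of its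
        own blob; leaf sets of different centres are disjoint.\<close>
      then have "a = g (j', 0)" using lf_disj[OF kK kK ay(2) gC[OF ji'(2)]] ay(4) by blast
      then have "e = g ` {(j', 0), (j', i')}" using ay(1) ji'(1) by simp
      moreover have "{(j', 0), (j', i')} \<in> edges (star_forest {1..} (\<lambda>j. {..<j}))"
        unfolding star_forest_def ugraph.simps
        by (rule CollectI, rule exI[of _ j'], rule exI[of _ i']) (use ji' i'0 in simp)
      ultimately show "e \<in> (\<lambda>e. g ` e) ` edges (star_forest {1..} (\<lambda>j. {..<j}))" by blast
    next
      fix e assume "e \<in> (\<lambda>e. g ` e) ` edges (star_forest {1..} (\<lambda>j. {..<j}))"
      then obtain j i where ji: "1 \<le> j" "0 < i" "i < j" "e = {g (j, 0), g (j, i)}"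
        by (auto simp: star_forest_def)
      have "g (j, 0) \<in> verts (G \<kappa>) \<inter> V" "g (j, i) \<in> verts (G \<kappa>) \<inter> V"
        unfolding im[symmetric] using ji by (auto intro!: imageI)
      then show "e \<in> {{a, y} | a y. a \<in> Ctr \<kappa> \<inter> V \<and> y \<in> Lf a \<inter> V}"
        using ji gC[OF ji(1)] gL[OF ji(1-3)] by blast
    qed
  qed
qed


lemma maker_can_claim_complete:
  assumes "\<And>\<tau> x. \<tau> \<in> Tup \<Longrightarrow> inj x \<Longrightarrow> (\<And>l. label_ok \<tau> (map x [0..<l]) (x l)) \<Longrightarrow>
    P (complete_on (\<tau> ` {..<s} \<union> range x))"
  shows "maker_can_claim K_aleph0 P"
proof -
  obtain \<sigma> where \<sigma>: "\<forall>h. even (length h) \<and> distinct h \<and> set h \<subseteq> E0 \<longrightarrow> \<sigma> h \<in> E0 - set h"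
    "\<And>p. (\<forall>n. p n \<in> E0 \<and> p n \<notin> p ` {..<n}) \<and> follows \<sigma> p \<Longrightarrow>
       (\<exists>\<tau>\<in>Tup. \<exists>x. inj x \<and> (\<forall>l. label_ok \<tau> (map x [0..<l]) (x l) \<and> x l \<notin> centres) \<and>
          clique (maker_edges p) (\<tau> ` {..<s} \<union> range x))"
    using maker_builds_clique by blast
  show ?thesis
    unfolding maker_can_claim_def
  proof (intro exI[of _ \<sigma>] conjI allI impI)
    show "maker_strategy K_aleph0 \<sigma>" using \<sigma>(1) unfolding maker_strategy_def .
    fix p assume "is_play K_aleph0 p \<and> follows \<sigma> p"
    then have "(\<forall>n. p n \<in> E0 \<and> p n \<notin> p ` {..<n}) \<and> follows \<sigma> p" by (simp add: is_play_def)
    from \<sigma>(2)[OF this] obtain \<tau> x where A: "\<tau> \<in> Tup" "inj x" "\<And>l. label_ok \<tau> (map x [0..<l]) (x l)"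
      "clique (maker_edges p) (\<tau> ` {..<s} \<union> range x)" by blast
    let ?K = "complete_on (\<tau> ` {..<s} \<union> range x)"
    have "subgraph ?K K_aleph0"
      unfolding subgraph_def K_aleph0_eq
      by (intro conjI is_graph_complete_on) (auto simp: complete_on_def)
    moreover have "edges ?K \<subseteq> maker_edges p"
      using A(4) unfolding clique_def complete_on_def by auto
    moreover have "P ?K" by (rule assms[OF A(1-3)])
    ultimately show "\<exists>K. subgraph K K_aleph0 \<and> edges K \<subseteq> maker_edges p \<and> P K" by blast
  qed
qed

end

section \<open>The bound on the number of stars\<close>

text \<open>Turns the bound on \<open>C'\<close> into the requirements of \<open>star_game\<close>:
  the second argument of the maximum in \<open>C\<close> serves whenever \<open>0 < t\<close>, the
  first one when \<open>t = 0\<close>.\<close>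

lemma numerics:
  fixes s t C C' :: nat
  assumes s: "0 < s" and C: "C = max (nat \<lceil>(real s)\<^sup>2 * 2 powi (int s - 3)\<rceil>) (2 ^ (3 * s + 1) * t)"
    and C': "3 * C * (s + 1) ^ (C * s + 1) \<le> C'"
  shows "(s + 1) * (s + t) * 2 ^ (s * s + s) < C'"
    and "0 < t \<Longrightarrow> (s + 1) * (s + t) * 2 ^ (s * s + 2 * s + 2) < C'"
proof -
  \<comment> \<open>The bound is monotone in \<open>C\<close>, so any convenient lower bound
    \<open>c\<close> for \<open>C\<close> may replace it.\<close>
  have mono: "3 * c * (s + 1) ^ (c * s + 1) \<le> C'" if "c \<le> C" for c
  proof -
    have "(s + 1) ^ (c * s + 1) \<le> (s + 1) ^ (C * s + 1)" using that by (intro power_increasing) auto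
    then have "3 * c * (s + 1) ^ (c * s + 1) \<le> 3 * C * (s + 1) ^ (C * s + 1)"
      using that by (intro mult_le_mono) auto
    then show ?thesis using C' by linarith
  qed
  have s2: "s + 1 \<le> 2 ^ s" using Suc_leI[OF less_exp[of s]] by (simp only: Suc_eq_plus1)
  show star: "(s + 1) * (s + t) * 2 ^ (s * s + 2 * s + 2) < C'" if t: "0 < t"
  proof -
    \<comment> \<open>Estimating \<open>s + 1\<close> by \<open>2 ^ s\<close> and
      \<open>s + t\<close> by \<open>2 ^ s * t\<close> turns the left-hand side into this number
      times \<open>2 ^ (s * s + s + 1)\<close>. The power is absorbed by
      \<open>(s + 1) ^ (c * s + 1)\<close>, and the factor 3 makes the inequality strict.\<close>
    have c: "2 ^ (3 * s + 1) * t \<le> C" using C by simp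
    have "s + 1 \<le> 2 ^ (3 * s + 1)" using less_exp[of "3 * s + 1"] by linarith
    then have "s * (s + 1) \<le> s * (2 ^ (3 * s + 1) * t)" using t by (intro mult_le_mono2) (simp add: le_trans)
    then have e: "s * s + s + 1 \<le> 2 ^ (3 * s + 1) * t * s + 1" by (simp add: algebra_simps)
    have "(2::nat) ^ (s * s + s + 1) \<le> 2 ^ (2 ^ (3 * s + 1) * t * s + 1)" by (rule power_increasing[OF e]) simp
    also have "\<dots> \<le> (s + 1) ^ (2 ^ (3 * s + 1) * t * s + 1)" using s by (intro power_mono) auto
    finally have "3 * (2 ^ (3 * s + 1) * t) * 2 ^ (s * s + s + 1) \<le> C'"
      using mono[OF c] by (meson le_trans mult_le_mono2)
    moreover have "(s + 1) * (s + t) * 2 ^ (s * s + 2 * s + 2) \<le> 2 ^ s * (2 ^ s * t) * 2 ^ (s * s + 2 * s + 2)"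
    proof (intro mult_le_mono1 mult_le_mono s2)
      have "s * 1 \<le> s * t" using t by (intro mult_le_mono2) simp
      then have "s + t \<le> (s + 1) * t" by simp
      also have "\<dots> \<le> 2 ^ s * t" using s2 by (rule mult_le_mono1)
      finally show "s + t \<le> 2 ^ s * t" .
    qed
    moreover have "2 ^ s * (2 ^ s * t) * 2 ^ (s * s + 2 * s + 2) = 2 ^ (3 * s + 1) * t * 2 ^ (s * s + s + 1)"
      by (simp add: power_add power_mult algebra_simps eval_nat_numeral)
    moreover have "0 < 2 ^ (3 * s + 1) * t * 2 ^ (s * s + s + 1)" using t by simp
    ultimately show ?thesis by linarith
  qed
  show "(s + 1) * (s + t) * 2 ^ (s * s + s) < C'"
  proof (cases "t = 0")
    case False
    have "(2::nat) ^ (s * s + s) \<le> 2 ^ (s * s + 2 * s + 2)" by (rule power_increasing) auto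
    then have "(s + 1) * (s + t) * 2 ^ (s * s + s) \<le> (s + 1) * (s + t) * 2 ^ (s * s + 2 * s + 2)"
      by (rule mult_le_mono2)
    also have "\<dots> < C'" by (rule star) (use False in simp)
    finally show ?thesis .
  next
    case True
    have ceil: "c \<le> C" if "real c \<le> (real s)\<^sup>2 * 2 powi (int s - 3)" for c
    proof -
      have "real_of_int (int c) \<le> of_int \<lceil>(real s)\<^sup>2 * 2 powi (int s - 3)\<rceil>"
        unfolding of_int_of_nat_eq by (rule order_trans[OF that le_of_int_ceiling])
      then have "int c \<le> \<lceil>(real s)\<^sup>2 * 2 powi (int s - 3)\<rceil>" by (simp only: of_int_le_iff)
      then show ?thesis using C by simp
    qed
    \<comment> \<open>For \<open>s < 3\<close> the power of two is below 1, and the ceiling yields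
      \<open>1 \<le> C\<close> and \<open>2 \<le> C\<close>, respectively. From 3 on the power is at
      least 1, so \<open>s * s \<le> C\<close>.\<close>
    consider "s = 1" | "s = 2" | "3 \<le> s" using s by linarith
    then show ?thesis
    proof cases
      case 1
      have "0 < (real s)\<^sup>2 * 2 powi (int s - 3)" using s by simp
      then have "0 < \<lceil>(real s)\<^sup>2 * 2 powi (int s - 3)\<rceil>" by simp
      then have "1 \<le> C" using C by linarith
      from mono[OF this] show ?thesis using 1 True by (simp add: eval_nat_numeral)
    next
      case 2
      have "2 \<le> C" by (rule ceil) (simp add: 2 power_int_minus)
      from mono[OF this] show ?thesis using 2 True by simp
    next
      case 3
      have "(1::real) \<le> 2 powi (int s - 3)"
      proof -
        have "int s - 3 = int (s - 3)" using 3 by simp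
        then have "(2::real) powi (int s - 3) = 2 ^ (s - 3)" by (metis power_int_of_nat)
        then show ?thesis by simp
      qed
      then have "(real s)\<^sup>2 * 1 \<le> (real s)\<^sup>2 * 2 powi (int s - 3)" by (intro mult_left_mono) auto
      then have "s * s \<le> C" by (intro ceil) (simp add: power2_eq_square)
      note m = mono[OF this]
      have ss: "3 * s \<le> s * s" "s * s * 1 \<le> s * s * s" using 3 by (intro mult_le_mono2 mult_le_mono1; simp)+
      have "a + b \<le> 2 * (c + 1)" if "b \<le> a" "a * 1 \<le> c" for a b c :: nat
        using that by presburger
      from this[OF ss] have e: "s * s + 3 * s \<le> 2 * (s * s * s + 1)" .
      have "(s + 1) * (s + t) * 2 ^ (s * s + s) \<le> 2 ^ s * 2 ^ s * 2 ^ (s * s + s)"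
        using s2 True by (intro mult_le_mono) auto
      also have "\<dots> = 2 ^ (s * s + 3 * s)" by (simp flip: power_add)
      also have "\<dots> \<le> 2 ^ (2 * (s * s * s + 1))" by (rule power_increasing[OF e]) simp
      also have "\<dots> = 4 ^ (s * s * s + 1)" by (subst power_mult) simp
      also have "\<dots> \<le> (s + 1) ^ (s * s * s + 1)" using 3 by (intro power_mono) auto
      also have "\<dots> < 3 * (s * s) * (s + 1) ^ (s * s * s + 1)"
      proof -
        have "1 < 3 * (s * s)" using ss(1) 3 by linarith
        then have "1 * (s + 1) ^ (s * s * s + 1) < 3 * (s * s) * (s + 1) ^ (s * s * s + 1)"
          by (rule mult_strict_right_mono) simp
        then show ?thesis by simp
      qed
      finally show ?thesis using m by linarith
    qed
  qed
qed

lemma numerics_real: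
  fixes s t C' :: nat
  assumes s: "0 < s" and l: "(s + 1) * (s + t) * 2 ^ (s * s + s) < C'"
  shows "real (s * s + 1) * 2 ^ (s * s + 1) \<le> real C'"
    and "real ((s + 1) * (s + t)) * 2 ^ (s * s + s) < real C'"
proof -
  have "1 \<le> s" using s by simp
  then have "s * s + 1 \<le> (s + 1) * (s + t)" by (simp add: algebra_simps)
  moreover have "(2::nat) ^ (s * s + 1) \<le> 2 ^ (s * s + s)" using \<open>1 \<le> s\<close> by (intro power_increasing) auto
  ultimately have "(s * s + 1) * 2 ^ (s * s + 1) \<le> (s + 1) * (s + t) * 2 ^ (s * s + s)" by (rule mult_le_mono)
  then have "(s * s + 1) * 2 ^ (s * s + 1) \<le> C'" using l by linarith
  then have "real ((s * s + 1) * 2 ^ (s * s + 1)) \<le> real C'" by (simp only: of_nat_le_iff)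
  then show "real (s * s + 1) * 2 ^ (s * s + 1) \<le> real C'"
    by (simp only: of_nat_mult of_nat_power of_nat_numeral)
  have "real ((s + 1) * (s + t) * 2 ^ (s * s + s)) < real C'" using l by (simp only: of_nat_less_iff)
  then show "real ((s + 1) * (s + t)) * 2 ^ (s * s + s) < real C'"
    by (simp only: of_nat_mult of_nat_power of_nat_numeral)
qed

text \<open>If \<open>s = t = 0\<close> there are no kinds at all, so an arbitrary auxiliary family of stars is used.\<close>

lemma dummy_star_game:
  "star_game 0 1 6 (\<lambda>_. range (\<lambda>m. prod_encode (m, 0)))
    (\<lambda>a. (\<lambda>i. prod_encode (fst (prod_decode a), Suc i)) ` {..<fst (prod_decode a)})"
proof
  fix \<kappa> Z :: nat
  let ?Lf = "\<lambda>a. (\<lambda>i. prod_encode (fst (prod_decode a), Suc i)) ` {..<fst (prod_decode a)}"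
  have "card (?Lf (prod_encode (m, 0))) = m" for m
    by (subst card_image) (auto simp: inj_on_def prod_encode_eq)
  then have "(\<lambda>m. prod_encode (m, 0)) ` {Z..} \<subseteq> {a \<in> range (\<lambda>m. prod_encode (m, 0)). Z \<le> card (?Lf a)}"
    by auto
  moreover have "infinite ((\<lambda>m. prod_encode (m, 0)) ` {Z..})"
    by (subst finite_image_iff) (auto simp: inj_on_def prod_encode_eq infinite_Ici)
  ultimately show "infinite {a \<in> range (\<lambda>m. prod_encode (m, 0)). Z \<le> card (?Lf a)}"
    using finite_subset by blast
qed (auto simp: prod_encode_eq)

theorem theorem1p4:
  fixes s t C C' :: nat and B :: "nat ugraph" and G :: "nat \<Rightarrow> nat ugraph"
  assumes "B = K_aleph0"
    and "C = max (nat \<lceil>(real s)\<^sup>2 * 2 powi (int s - 3)\<rceil>) (2 ^ (3 * s + 1) * t)"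
    and "C' \<ge> 3 * C * (s + 1) ^ (C * s + 1)"
    and "\<And>i. i \<in> {1..s + t} \<Longrightarrow> subgraph (G i) B"
    and "disjoint_family_on (\<lambda>i. verts (G i)) {1..s + t}"
    and "\<And>i. i \<in> {1..s} \<Longrightarrow> copy_of (G i) (G_inf C')"
    and "\<And>j. j \<in> {s + 1..s + t} \<Longrightarrow> copy_of (G j) G_star"
  shows "maker_can_claim B (\<lambda>K.
           copy_of K K_aleph0 \<and>
           (\<forall>i\<in>{1..s}. copy_of (graph_inter (G i) K) S_aleph0) \<and>
           (\<forall>j\<in>{s + 1..s + t}. copy_of (graph_inter (G j) K) G_star))"
proof -
  have inf: "infinite (A \<union> range x)" if "inj x" for A and x :: "nat \<Rightarrow> nat"
    using range_inj_infinite[OF that] by simp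
  show ?thesis
  proof (cases "s + t = 0")
    case True
    interpret star_game 0 1 6 "\<lambda>_. range (\<lambda>m. prod_encode (m, 0))"
      "\<lambda>a. (\<lambda>i. prod_encode (fst (prod_decode a), Suc i)) ` {..<fst (prod_decode a)}"
      by (rule dummy_star_game)
    show ?thesis unfolding assms(1)
      by (rule maker_can_claim_complete) (use True in \<open>simp add: complete_on_copy range_inj_infinite\<close>)
  next
    case False
    \<comment> \<open>\<open>I \<kappa>\<close> and \<open>W \<kappa>\<close> put
      \<open>G_inf C'\<close> and \<open>G_star\<close> into the form \<open>star_forest\<close>,
      and \<open>H\<close> shifts the indices from \<open>{1..s + t}\<close> to kinds starting at
      0.\<close>
    define I where "I \<kappa> = (if \<kappa> < s then {..<C'} else {1..})" for \<kappa>
    define W where "W \<kappa> j = (if \<kappa> < s then UNIV else {..<j})" for \<kappa> j :: nat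
    define H where "H \<kappa> = G (Suc \<kappa>)" for \<kappa>
    have gr: "is_graph (H \<kappa>)" if "\<kappa> < s + t" for \<kappa>
      using assms(4)[of "Suc \<kappa>"] that by (simp add: H_def subgraph_def)
    have cp: "copy_of (H \<kappa>) (star_forest (I \<kappa>) (W \<kappa>))" if "\<kappa> < s + t" for \<kappa>
      using assms(6)[of "Suc \<kappa>"] assms(7)[of "Suc \<kappa>"] that
      unfolding H_def I_def W_def G_inf_eq G_star_eq by (cases "\<kappa> < s") simp_all
    define Pr where "Pr \<kappa> c \<longleftrightarrow> inj_on c (I \<kappa>) \<and> verts (H \<kappa>) = c ` I \<kappa> \<union> (\<Union>i\<in>I \<kappa>. nbrs (H \<kappa>) (c i)) \<and>
      edges (H \<kappa>) = {{c i, y} | i y. i \<in> I \<kappa> \<and> y \<in> nbrs (H \<kappa>) (c i)} \<and>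
      (\<forall>i\<in>I \<kappa>. \<forall>j\<in>I \<kappa>. i \<noteq> j \<longrightarrow> nbrs (H \<kappa>) (c i) \<inter> nbrs (H \<kappa>) (c j) = {}) \<and>
      (\<forall>i\<in>I \<kappa>. \<forall>j\<in>I \<kappa>. c i \<notin> nbrs (H \<kappa>) (c j)) \<and>
      (\<forall>i\<in>I \<kappa>. \<exists>b. bij_betw b (W \<kappa> i - {0}) (nbrs (H \<kappa>) (c i)))" for \<kappa> and c :: "nat \<Rightarrow> nat"
    have ex: "\<exists>c. Pr \<kappa> c" if "\<kappa> < s + t" for \<kappa>
      unfolding Pr_def
      by (rule star_forest_copy[OF cp[OF that] gr[OF that]]) (auto simp: I_def W_def split: if_splits)
    define c where "c \<kappa> = (SOME c. Pr \<kappa> c)" for \<kappa>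
    have c: "Pr \<kappa> (c \<kappa>)" if "\<kappa> < s + t" for \<kappa> unfolding c_def by (rule someI_ex[OF ex[OF that]])
    have c1: "inj_on (c \<kappa>) (I \<kappa>)"
      and c2: "verts (H \<kappa>) = c \<kappa> ` I \<kappa> \<union> (\<Union>i\<in>I \<kappa>. nbrs (H \<kappa>) (c \<kappa> i))"
      and c3: "edges (H \<kappa>) = {{c \<kappa> i, y} | i y. i \<in> I \<kappa> \<and> y \<in> nbrs (H \<kappa>) (c \<kappa> i)}"
      and c4: "\<forall>i\<in>I \<kappa>. \<forall>j\<in>I \<kappa>. i \<noteq> j \<longrightarrow> nbrs (H \<kappa>) (c \<kappa> i) \<inter> nbrs (H \<kappa>) (c \<kappa> j) = {}"
      and c5: "\<forall>i\<in>I \<kappa>. \<forall>j\<in>I \<kappa>. c \<kappa> i \<notin> nbrs (H \<kappa>) (c \<kappa> j)"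
      and c6: "\<forall>i\<in>I \<kappa>. \<exists>b. bij_betw b (W \<kappa> i - {0}) (nbrs (H \<kappa>) (c \<kappa> i))"
      if "\<kappa> < s + t" for \<kappa>
      using c[OF that] unfolding Pr_def by - (elim conjE, assumption)+
    have dH: "verts (H \<kappa>) \<inter> verts (H \<kappa>') = {}" if "\<kappa> < s + t" "\<kappa>' < s + t" "\<kappa> \<noteq> \<kappa>'" for \<kappa> \<kappa>'
      using assms(5) that unfolding disjoint_family_on_def H_def by simp
    define Ctr where "Ctr \<kappa> = c \<kappa> ` I \<kappa>" for \<kappa>
    \<comment> \<open>The leaf sets in \<open>star_game\<close> depend on the centre alone. The
      union achieves this, since a centre of one forest has no neighbours in the others.\<close>
    define Lf where "Lf a = (\<Union>\<kappa><s + t. nbrs (H \<kappa>) a)" for a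
    have Cv: "Ctr \<kappa> \<subseteq> verts (H \<kappa>)" if "\<kappa> < s + t" for \<kappa> unfolding Ctr_def c2[OF that] by blast
    have Lf: "Lf a = nbrs (H \<kappa>) a" if k: "\<kappa> < s + t" "a \<in> Ctr \<kappa>" for a \<kappa>
    proof -
      have "nbrs (H \<kappa>') a = {}" if k': "\<kappa>' < s + t" "\<kappa>' \<noteq> \<kappa>" for \<kappa>'
      proof (rule ccontr)
        assume "nbrs (H \<kappa>') a \<noteq> {}"
        then obtain y where "{a, y} \<in> edges (H \<kappa>')" by (auto simp: nbrs_def)
        then have "a \<in> verts (H \<kappa>')" using gr[OF k'(1)] by (auto simp: is_graph_def)
        then show False using dH[OF k' (1) k(1) k'(2)] Cv[OF k(1)] k(2) by blast
      qed
      then show ?thesis unfolding Lf_def using k(1) by auto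
    qed
    have vH: "verts (H \<kappa>) = Ctr \<kappa> \<union> (\<Union>a\<in>Ctr \<kappa>. Lf a)" if k: "\<kappa> < s + t" for \<kappa>
    proof -
      have "verts (H \<kappa>) = Ctr \<kappa> \<union> (\<Union>i\<in>I \<kappa>. nbrs (H \<kappa>) (c \<kappa> i))" unfolding Ctr_def by (rule c2[OF k])
      also have "(\<Union>i\<in>I \<kappa>. nbrs (H \<kappa>) (c \<kappa> i)) = (\<Union>a\<in>Ctr \<kappa>. Lf a)"
        using Lf[OF k] by (simp add: Ctr_def)
      finally show ?thesis .
    qed
    have eH: "edges (H \<kappa>) = {{a, y} | a y. a \<in> Ctr \<kappa> \<and> y \<in> Lf a}" if k: "\<kappa> < s + t" for \<kappa>
    proof -
      have "edges (H \<kappa>) = {{c \<kappa> i, y} | i y. i \<in> I \<kappa> \<and> y \<in> nbrs (H \<kappa>) (c \<kappa> i)}" by (rule c3[OF k])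
      also have "\<dots> = {{a, y} | a y. a \<in> Ctr \<kappa> \<and> y \<in> nbrs (H \<kappa>) a}" unfolding Ctr_def by blast
      also have "\<dots> = {{a, y} | a y. a \<in> Ctr \<kappa> \<and> y \<in> Lf a}" using Lf[OF k] by blast
      finally show ?thesis .
    qed
    have bij: "\<exists>b. bij_betw b (W \<kappa> i - {0}) (Lf (c \<kappa> i))" if k: "\<kappa> < s + t" and i: "i \<in> I \<kappa>" for \<kappa> i
      using c6[OF k] Lf[OF k, of "c \<kappa> i"] i unfolding Ctr_def by simp
    have cC: "\<exists>i\<in>I \<kappa>. a = c \<kappa> i" if "a \<in> Ctr \<kappa>" for a \<kappa> using that by (auto simp: Ctr_def)
    \<comment> \<open>If \<open>s = 0\<close>, no infinite stars prescribe \<open>n\<close>, and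
      \<open>4 * t + 2\<close> satisfies the numerical assumptions.\<close>
    define n where "n = (if s = 0 then 4 * t + 2 else C')"
    interpret star_game s t n Ctr Lf
    proof
      show "0 < s + t" using False by simp
      show "finite (Ctr \<kappa>)" if "\<kappa> < s" for \<kappa> using that by (simp add: Ctr_def I_def)
      show "card (Ctr \<kappa>) = n" if "\<kappa> < s" for \<kappa>
      proof -
        have "card (Ctr \<kappa>) = card (I \<kappa>)" unfolding Ctr_def using c1[of \<kappa>] that by (intro card_image) simp
        then show ?thesis using that by (simp add: I_def n_def)
      qed
      show "infinite (Lf a)" if k: "\<kappa> < s" "a \<in> Ctr \<kappa>" for \<kappa> a
      proof -
        obtain i where i: "i \<in> I \<kappa>" "a = c \<kappa> i" using cC[OF k(2)] by blast
        obtain b where "bij_betw b (W \<kappa> i - {0}) (Lf a)" using bij[of \<kappa> i] k(1) i by auto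
        moreover have "infinite (W \<kappa> i - {0})" using k(1) by (simp add: W_def)
        ultimately show ?thesis using bij_betw_finite by blast
      qed
      show "finite (Lf a)" if k: "s \<le> \<kappa>" "\<kappa> < s + t" "a \<in> Ctr \<kappa>" for \<kappa> a
      proof -
        obtain i where i: "i \<in> I \<kappa>" "a = c \<kappa> i" using cC[OF k(3)] by blast
        obtain b where "bij_betw b (W \<kappa> i - {0}) (Lf a)" using bij[of \<kappa> i] k(2) i by auto
        moreover have "finite (W \<kappa> i - {0})" using k(1) by (simp add: W_def)
        ultimately show ?thesis using bij_betw_finite by blast
      qed
      show "infinite {a \<in> Ctr \<kappa>. Z \<le> card (Lf a)}" if k: "s \<le> \<kappa>" "\<kappa> < s + t" for \<kappa> Z
      proof -
        have "c \<kappa> ` {Suc Z..} \<subseteq> {a \<in> Ctr \<kappa>. Z \<le> card (Lf a)}"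
        proof (rule image_subsetI)
          fix j assume j: "j \<in> {Suc Z..}"
          then have jI: "j \<in> I \<kappa>" using k(1) by (simp add: I_def)
          then obtain b where "bij_betw b (W \<kappa> j - {0}) (Lf (c \<kappa> j))" using bij[OF k(2)] by blast
          then have "card (Lf (c \<kappa> j)) = card ({..<j} - {0})"
            using k(1) by (simp add: W_def bij_betw_same_card[symmetric])
          also have "\<dots> = j - 1" using j by (simp add: card_Diff_singleton)
          finally show "c \<kappa> j \<in> {a \<in> Ctr \<kappa>. Z \<le> card (Lf a)}" using j jI by (auto simp: Ctr_def)
        qed
        moreover have "inj_on (c \<kappa>) {Suc Z..}"
          using c1[OF k(2)] k(1) by (auto simp: I_def inj_on_def)
        then have "infinite (c \<kappa> ` {Suc Z..})" by (simp add: finite_image_iff infinite_Ici)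
        ultimately show ?thesis using finite_subset by blast
      qed
      show "Ctr \<kappa> \<inter> Ctr \<kappa>' = {}" if "\<kappa> < s + t" "\<kappa>' < s + t" "\<kappa> \<noteq> \<kappa>'" for \<kappa> \<kappa>'
        using dH[OF that] Cv[OF that(1)] Cv[OF that(2)] by blast
      show "Lf a \<inter> Lf b = {}" if k: "\<kappa> < s + t" "\<kappa>' < s + t" "a \<in> Ctr \<kappa>" "b \<in> Ctr \<kappa>'" "a \<noteq> b" for \<kappa> \<kappa>' a b
      proof (cases "\<kappa> = \<kappa>'")
        case True
        obtain i j where ij: "i \<in> I \<kappa>" "a = c \<kappa> i" "j \<in> I \<kappa>" "b = c \<kappa> j"
          using cC k(3,4) True by blast
        then have "nbrs (H \<kappa>) a \<inter> nbrs (H \<kappa>) b = {}"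
          using bspec[OF bspec[OF c4[OF k(1)] ij(1)] ij(3)] k(5) by auto
        then show ?thesis using Lf[OF k(1,3)] Lf[OF k(1), of b] k(4) True by simp
      next
        case False
        then show ?thesis using dH[OF k(1,2)] vH[OF k(1)] vH[OF k(2)] k(3,4) by blast
      qed
      show "Lf a \<inter> Ctr \<kappa>' = {}" if k: "\<kappa> < s + t" "\<kappa>' < s + t" "a \<in> Ctr \<kappa>" for \<kappa> \<kappa>' a
      proof (cases "\<kappa> = \<kappa>'")
        case True
        obtain i where i: "i \<in> I \<kappa>" "a = c \<kappa> i" using cC[OF k(3)] by blast
        then have "c \<kappa> j \<notin> Lf a" if "j \<in> I \<kappa>" for j using c5[OF k(1)] Lf[OF k(1,3)] that by auto
        then show ?thesis using True by (auto simp: Ctr_def)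
      next
        case False
        then show ?thesis using dH[OF k(1,2)] vH[OF k(1)] Cv[OF k(2)] k(3) by blast
      qed
      show "real (s * s + 1) * 2 ^ (s * s + 1) \<le> real n"
        using numerics_real(1)[OF _ numerics(1)[OF _ assms(2,3)]] by (cases "s = 0") (simp_all add: n_def)
      show "real ((s + 1) * (s + t)) * 2 ^ (s * s + s) < real n" if "0 < s"
        using numerics_real(2)[OF that numerics(1)[OF that assms(2,3)]] that by (simp add: n_def)
      show "real ((s + 1) * (s + t)) * 2 ^ (s * s + 2 * s + 2) < real n" if "0 < t"
      proof (cases "s = 0")
        case True
        then show ?thesis by (simp add: n_def)
      next
        case False
        then have "(s + 1) * (s + t) * 2 ^ (s * s + 2 * s + 2) < n"
          using numerics(2)[OF _ assms(2,3) that] by (simp add: n_def)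
        then have "real ((s + 1) * (s + t) * 2 ^ (s * s + 2 * s + 2)) < real n" by (simp only: of_nat_less_iff)
        then show ?thesis by (simp only: of_nat_mult of_nat_power of_nat_numeral)
      qed
    qed
    show ?thesis
      unfolding assms(1)
    proof (rule maker_can_claim_complete, intro conjI ballI)
      fix \<tau> x assume A: "\<tau> \<in> Tup" "inj x" "\<And>l. label_ok \<tau> (map x [0..<l]) (x l)"
      let ?V = "\<tau> ` {..<s} \<union> range x"
      show "copy_of (complete_on ?V) K_aleph0" by (rule complete_on_copy[OF inf[OF A(2)]])
      note F = final_graphs[of H, OF vH eH dH A(1-3) refl]
      show "copy_of (graph_inter (G i) (complete_on ?V)) S_aleph0" if "i \<in> {1..s}" for i
        using F(1)[of "i - 1"] that by (cases i) (auto simp: H_def)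
      show "copy_of (graph_inter (G j) (complete_on ?V)) G_star" if "j \<in> {s + 1..s + t}" for j
        using F(2)[of "j - 1"] that by (cases j) (auto simp: H_def)
    qed
  qed
qed

end
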